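(* Let $\alpha,\beta>0$ and $\psi\in L^1(\mathbb R)\cap\widehat{W_0}$. Then the map $T:\ell^2(AP(\mathbb Z))\to AP_2(\mathbb R)$, defined for $a=(a^\ell)_{\ell\in\mathbb Z}$ by prescribing the Fourier coefficients $$(Ta,e_\lambda)_{AP_2}=\sum_{\ell\in\mathbb Z}\widehat\psi(\lambda-\ell\beta)\cdot(a^\ell,\tilde e_{\lambda\alpha})_{AP(\mathbb Z)},\qquad\lambda\in\mathbb R,$$ is well defined and continuous. Moreover, there is a constant $C$ such that $$\sum_{\ell\in\mathbb Z}\big\|\big(\langle f,T_{\alpha k}M_{\beta\ell}\psi\rangle\big)_{k\in\mathbb Z}\big\|_{AP(\mathbb Z)}^2\le C\|f\|_{AP}^2$$ for every $f\in AP(\mathbb R)$.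
   Context: $AP(\mathbb R)$ is the space of Bohr almost periodic functions: continuous $f:\mathbb R\to\mathbb C$ such that for every $\epsilon>0$ there is $L>0$ such that every interval of length greater than $L$ contains $\tau$ with $\sup_t|f(t+\tau)-f(t)|\le\epsilon$. It carries the inner product $(f,g)_{AP}=\lim_{T\to\infty}\frac1{2T}\int_{-T}^Tf(t)\overline{g(t)}\,dt$, with norm $\|\cdot\|_{AP}$. $AP_2(\mathbb R)$ is the Hilbert space completion of $(AP(\mathbb R),\|\cdot\|_{AP})$, with inner product denoted $(\cdot,\cdot)_{AP_2}$; the functions $e_\lambda(t)=e^{i\lambda t}$, $\lambda\in\mathbb R$, form an orthonormal basis of it, and an element is determined by its Fourier coefficients $(f,e_\lambda)_{AP_2}$. $AP(\mathbb Z)$ is the space of almost periodic sequences: complex sequences $(a_n)_{n\in\mathbb Z}$ such that for every $\epsilon>0$ there is $N\in\mathbb N$ such that any $N$ consecutive integers contain an integer $p$ with $\sup_n|a_{n+p}-a_n|\le\epsilon$. It carries the inner product $(a,b)_{AP(\mathbb Z)}=\lim_{p\to\infty}\frac1{2p}\sum_{n=-p}^pa_n\overline{b_n}$, with norm $\|\cdot\|_{AP(\mathbb Z)}$. $\tilde e_\lambda=(e^{i\lambda n})_{n\in\mathbb Z}\in AP(\mathbb Z)$. $\ell^2(AP(\mathbb Z))$ is the space of families $a=(a^\ell)_{\ell\in\mathbb Z}$ with $a^\ell\in AP(\mathbb Z)$ and $\|a\|^2:=\sum_\ell\|a^\ell\|_{AP(\mathbb Z)}^2<\infty$. $\widehat\psi(\lambda)=\int_{\mathbb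 R}\psi(t)e^{-i\lambda t}\,dt$ for $\psi\in L^1(\mathbb R)$. $W_0$ is the space of continuous $\varphi:\mathbb R\to\mathbb C$ with $\|\varphi\|_W=\sum_{k\in\mathbb Z}\sup_{x\in[0,1]}|\varphi(x-k)|<\infty$, and $\widehat{W_0}$ is the set of Fourier transforms of elements of $W_0$, so that $\psi\in L^1(\mathbb R)\cap\widehat{W_0}$ means $\psi\in L^1(\mathbb R)$ and $\widehat\psi\in W_0$. $T_x\psi(t)=\psi(t-x)$, $M_\omega\psi(t)=e^{i\omega t}\psi(t)$, $\langle f,g\rangle=\int_{\mathbb R}f(t)\overline{g(t)}\,dt$. For $f\in AP(\mathbb R)$ the sequence $(\langle f,T_{\alpha k}M_{\beta\ell}\psi\rangle)_k$ is in $AP(\mathbb Z)$. *)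

theory Defs
  imports "HOL-Analysis.Analysis"
begin

definition AP_R :: "(real \<Rightarrow> complex) set" where
  "AP_R = {f. continuous_on UNIV f \<and>
     (\<forall>\<epsilon>>0. \<exists>L>0. \<forall>x y. y - x > L \<longrightarrow> (\<exists>\<tau>\<in>{x..y}. \<forall>t. norm (f (t + \<tau>) - f t) \<le> \<epsilon>))}"

definition ap_inner :: "(real \<Rightarrow> complex) \<Rightarrow> (real \<Rightarrow> complex) \<Rightarrow> complex" where
  "ap_inner f g = Lim at_top (\<lambda>T::real. integral {-T..T} (\<lambda>t. f t * cnj (g t)) / of_real (2 * T))"

definition ap_norm :: "(real \<Rightarrow> complex) \<Rightarrow> real" where
  "ap_norm f = sqrt (Re (ap_inner f f))"

definition ap_exp :: "real \<Rightarrow> real \<Rightarrow> complex" where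
  "ap_exp \<nu> t = exp (\<i> * of_real (\<nu> * t))"


text \<open>The completion of \<open>AP_R\<close> is realised as the Cauchy sequences in \<open>AP_R\<close> for
  \<open>ap_norm\<close>, modulo null sequences. Its elements are therefore equivalence classes, and the
  operations below are given through representatives.\<close>

definition AP_cauchy :: "(nat \<Rightarrow> real \<Rightarrow> complex) set" where
  "AP_cauchy = {X. (\<forall>n. X n \<in> AP_R) \<and>
     (\<forall>\<epsilon>>0. \<exists>N. \<forall>m\<ge>N. \<forall>n\<ge>N. ap_norm (\<lambda>t. X m t - X n t) < \<epsilon>)}"

definition AP_rel :: "((nat \<Rightarrow> real \<Rightarrow> complex) \<times> (nat \<Rightarrow> real \<Rightarrow> complex)) set" where
  "AP_rel = {(X, Y). X \<in> AP_cauchy \<and> Y \<in> AP_cauchy \<and>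
     (\<lambda>n. ap_norm (\<lambda>t. X n t - Y n t)) \<longlonglongrightarrow> 0}"

type_synonym ap2 = "(nat \<Rightarrow> real \<Rightarrow> complex) set"

definition AP2 :: "ap2 set" where
  "AP2 = AP_cauchy // AP_rel"

definition AP2_of :: "(real \<Rightarrow> complex) \<Rightarrow> ap2" where
  "AP2_of f = AP_rel `` {\<lambda>n. f}"

definition AP2_diff :: "ap2 \<Rightarrow> ap2 \<Rightarrow> ap2" where
  "AP2_diff F G = AP_rel `` {(\<lambda>n t. X n t - Y n t) | X Y. X \<in> F \<and> Y \<in> G}"

definition AP2_inner :: "ap2 \<Rightarrow> ap2 \<Rightarrow> complex" where
  "AP2_inner F G = (THE z. \<forall>X\<in>F. \<forall>Y\<in>G. (\<lambda>n. ap_inner (X n) (Y n)) \<longlonglongrightarrow> z)"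

definition AP2_norm :: "ap2 \<Rightarrow> real" where
  "AP2_norm F = sqrt (Re (AP2_inner F F))"


definition AP_Z :: "(int \<Rightarrow> complex) set" where
  "AP_Z = {a. \<forall>\<epsilon>>0. \<exists>N::nat. \<forall>m::int. \<exists>p\<in>{m..<m + int N}. \<forall>n. norm (a (n + p) - a n) \<le> \<epsilon>}"

definition apz_inner :: "(int \<Rightarrow> complex) \<Rightarrow> (int \<Rightarrow> complex) \<Rightarrow> complex" where
  "apz_inner a b = lim (\<lambda>p::nat. (\<Sum>n=-int p..int p. a n * cnj (b n)) / of_nat (2 * p))"

definition apz_norm :: "(int \<Rightarrow> complex) \<Rightarrow> real" where
  "apz_norm a = sqrt (Re (apz_inner a a))"

definition apz_exp :: "real \<Rightarrow> int \<Rightarrow> complex" where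
  "apz_exp \<nu> n = exp (\<i> * of_real (\<nu> * of_int n))"

definition l2_APZ :: "(int \<Rightarrow> int \<Rightarrow> complex) set" where
  "l2_APZ = {a. (\<forall>l. a l \<in> AP_Z) \<and> (\<lambda>l. (apz_norm (a l))\<^sup>2) summable_on UNIV}"

definition l2_norm :: "(int \<Rightarrow> int \<Rightarrow> complex) \<Rightarrow> real" where
  "l2_norm a = sqrt (\<Sum>\<^sub>\<infinity>l. (apz_norm (a l))\<^sup>2)"


definition fourier :: "(real \<Rightarrow> complex) \<Rightarrow> real \<Rightarrow> complex" where
  "fourier \<psi> \<nu> = (LINT t|lebesgue. \<psi> t * exp (- \<i> * of_real (\<nu> * t)))"

definition W0 :: "(real \<Rightarrow> complex) set" where
  "W0 = {\<phi>. continuous_on UNIV \<phi> \<and>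
     (\<lambda>k::int. SUP x\<in>{0..1}. norm (\<phi> (x - of_int k))) summable_on UNIV}"

definition transl :: "real \<Rightarrow> (real \<Rightarrow> complex) \<Rightarrow> real \<Rightarrow> complex" where
  "transl x \<psi> t = \<psi> (t - x)"

definition modul :: "real \<Rightarrow> (real \<Rightarrow> complex) \<Rightarrow> real \<Rightarrow> complex" where
  "modul \<omega> \<psi> t = exp (\<i> * of_real (\<omega> * t)) * \<psi> t"

definition bracket :: "(real \<Rightarrow> complex) \<Rightarrow> (real \<Rightarrow> complex) \<Rightarrow> complex" where
  "bracket f g = (LINT t|lebesgue. f t * cnj (g t))"

definition gabor_coeffs ::
  "real \<Rightarrow> real \<Rightarrow> (real \<Rightarrow> complex) \<Rightarrow> (real \<Rightarrow> complex) \<Rightarrow> int \<Rightarrow> int \<Rightarrow> complex" where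
  "gabor_coeffs \<alpha> \<beta> \<psi> f l k =
     bracket f (transl (\<alpha> * of_int k) (modul (\<beta> * of_int l) \<psi>))"

text \<open>\<open>has_sum\<close> makes the convergence of the series part of the prescription.\<close>

definition is_synthesis ::
  "real \<Rightarrow> real \<Rightarrow> (real \<Rightarrow> complex) \<Rightarrow> (int \<Rightarrow> int \<Rightarrow> complex) \<Rightarrow> ap2 \<Rightarrow> bool" where
  "is_synthesis \<alpha> \<beta> \<psi> a F \<longleftrightarrow> F \<in> AP2 \<and>
     (\<forall>\<nu>. ((\<lambda>l::int. fourier \<psi> (\<nu> - of_int l * \<beta>) * apz_inner (a l) (apz_exp (\<nu> * \<alpha>)))
        has_sum AP2_inner F (AP2_of (ap_exp \<nu>))) UNIV)"

definition synthesis ::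
  "real \<Rightarrow> real \<Rightarrow> (real \<Rightarrow> complex) \<Rightarrow> (int \<Rightarrow> int \<Rightarrow> complex) \<Rightarrow> ap2" where
  "synthesis \<alpha> \<beta> \<psi> a = (THE F. is_synthesis \<alpha> \<beta> \<psi> a F)"

end

theory Submission
  imports Defs
begin

text \<open>
  Write \<open>\<phi>\<close> for the Fourier transform of \<open>\<psi>\<close>. As \<open>\<phi>\<close> lies in the Wiener space, the sums of \<open>|\<phi>|\<close>
  over all translates of a lattice have a common bound (\<open>wiener_lattice_sum_bounded\<close>); let \<open>A\<close> be such
  a bound for the lattice \<open>\<beta>\<int>\<close>, and \<open>D\<close> one for \<open>(2\<pi>/\<alpha>)\<int>\<close>. Both halves of the theorem hold with the
  constant \<open>A D\<close>, by the Schur test.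

  For the synthesis, the Cauchy-Schwarz inequality with weights \<open>|\<phi>(\<nu> - \<ell>\<beta>)|\<close> gives
  \<open>|c(\<nu>)|\<^sup>2 \<le> A \<Sum>\<^sub>\<ell> |\<phi>(\<nu> - \<ell>\<beta>)| |(a\<^sub>\<ell>, e\<^sub>\<nu>\<^sub>\<alpha>)|\<^sup>2\<close> for the prescribed coefficients \<open>c\<close>. The inner product
  on the right depends on \<open>\<nu>\<alpha>\<close> modulo \<open>2\<pi>\<close> only, and the frequencies \<open>\<nu>\<close> with the same residue form a
  translate of \<open>(2\<pi>/\<alpha>)\<int>\<close>; so summing over \<open>\<nu>\<close> costs a factor \<open>D\<close>, and Bessel's inequality for almost
  periodic sequences leaves \<open>A D \<parallel>a\<parallel>\<^sup>2\<close> (\<open>synthesis_coefficients\<close>). A square summable family of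
  coefficients belongs to an element of the completion (\<open>riesz_fischer\<close>), and to one only
  (\<open>AP2_eqI\<close>); continuity is this bound applied to a difference.

  For the analysis, sampling \<open>f\<close> against the Gabor system maps \<open>e\<^sub>\<nu>\<close> to the sequence
  \<open>cnj (\<phi>(\<nu> - \<ell>\<beta>)) e\<^sub>\<nu>\<^sub>\<alpha>\<close>, so on trigonometric polynomials the bound is the same computation
  transposed (\<open>analysis_trigpoly_bound\<close>). It extends to every \<open>f\<close> because trigonometric
  polynomials are uniformly dense and each sequence of coefficients depends continuously on \<open>f\<close> in
  the supremum norm.

  Uniqueness and the last extension both rest on Bohr's approximation theorem (\<open>trigpoly_dense\<close>),
  which is proved by Bogolyubov's method. If \<open>E\<close> is a relatively dense set of integers, then
  \<open>E - E + E - E\<close> contains a Bohr set, that is, all \<open>\<tau>\<close> at which finitely many characters are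
  close to \<open>1\<close> (\<open>bogolyubov\<close>); this is finite Fourier analysis and a compactness argument. Hence an
  almost periodic function has a Bohr set of \<open>\<epsilon>\<close>-almost periods. Finitely many translates of a Bohr
  set cover the group (\<open>bohr_set_syndetic\<close>), so this property characterises almost periodicity; in
  this form sums, products and samples are immediate. Averaging the translates of \<open>f\<close> against a high
  power of a product of raised cosines, which concentrates on the Bohr set, gives trigonometric
  polynomials that approximate \<open>f\<close> uniformly.
\<close>

section \<open>Bohr sets and Bogolyubov's theorem\<close>

definition bohr_set :: "real set \<Rightarrow> real \<Rightarrow> real set" where
  "bohr_set \<Lambda> \<delta> = {t. \<forall>\<nu>\<in>\<Lambda>. norm (cis (\<nu> * t) - 1) < \<delta>}"

lemma norm_cis_diff: "norm (cis (\<nu> * (x - y)) - 1) = norm (cis (\<nu> * x) - cis (\<nu> * y))"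
proof -
  have "cis (\<nu> * x) - cis (\<nu> * y) = cis (\<nu> * y) * (cis (\<nu> * (x - y)) - 1)"
    by (simp add: algebra_simps cis_mult)
  then show ?thesis by (simp add: norm_mult)
qed

lemma bohr_set_Un: "bohr_set (\<Lambda> \<union> \<Lambda>') (min \<delta> \<delta>') \<subseteq> bohr_set \<Lambda> \<delta> \<inter> bohr_set \<Lambda>' \<delta>'"
  by (auto simp: bohr_set_def)

lemma bohr_set_uminus: "- x \<in> bohr_set \<Lambda> \<delta> \<longleftrightarrow> x \<in> bohr_set \<Lambda> \<delta>"
proof -
  have "norm (cis (\<nu> * - x) - 1) = norm (cis (\<nu> * x) - 1)" for \<nu>
    using norm_cis_diff[of \<nu> 0 x] by (simp add: norm_minus_commute)
  then show ?thesis by (simp add: bohr_set_def)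
qed

text \<open>
  Pigeonhole principle: the values of finitely many characters lie in a compact set, which splits
  into finitely many cells of diameter less than \<open>\<delta>\<close>. Two points of the same cell differ by an element of
  the Bohr set, so one representative of each occupied cell suffices. Choosing the representatives
  in \<open>X\<close> makes the statement usable for the integers inside the line.
\<close>

lemma bohr_set_syndetic:
  assumes "finite \<Lambda>" "\<delta> > 0"
  obtains S where "finite S" "S \<subseteq> X" "\<And>x. x \<in> X \<Longrightarrow> \<exists>s\<in>S. x - s \<in> bohr_set \<Lambda> \<delta>"
proof -
  define r where "r = \<delta> / 2"
  have r: "r > 0" using assms by (simp add: r_def)
  define cell where "cell x = restrict (\<lambda>\<nu>. (\<lfloor>cos (\<nu> * x) / r\<rfloor>, \<lfloor>sin (\<nu> * x) / r\<rfloor>)) \<Lambda>" for x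
  define J where "J = {\<lfloor>-1 / r\<rfloor>..\<lfloor>1 / r\<rfloor>}"
  have J: "\<lfloor>u / r\<rfloor> \<in> J" if "- 1 \<le> u" "u \<le> 1" for u
    unfolding J_def using divide_right_mono[OF that(1), of r] divide_right_mono[OF that(2), of r] r
    by (auto intro: floor_mono)
  have "cell ` X \<subseteq> (\<Pi>\<^sub>E \<nu>\<in>\<Lambda>. J \<times> J)"
    unfolding cell_def using J by (intro image_subsetI restrict_PiE_iff[THEN iffD2] ballI SigmaI) auto
  moreover have "finite (\<Pi>\<^sub>E \<nu>\<in>\<Lambda>. J \<times> J)"
    using assms(1) by (intro finite_PiE) (auto simp: J_def)
  ultimately have "finite (cell ` X)" by (rule finite_subset)
  then obtain S where S: "S \<subseteq> X" "finite S" "cell ` X = cell ` S"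
    using finite_subset_image[of "cell ` X" cell X] by auto
  have close: "\<bar>u - v\<bar> < r" if "\<lfloor>u / r\<rfloor> = \<lfloor>v / r\<rfloor>" for u v :: real
  proof -
    have "\<bar>u / r - v / r\<bar> < 1" using that by linarith
    then show ?thesis using r by (simp add: diff_divide_distrib[symmetric] abs_divide)
  qed
  have "\<exists>s\<in>S. x - s \<in> bohr_set \<Lambda> \<delta>" if "x \<in> X" for x
  proof -
    obtain s where s: "s \<in> S" "cell x = cell s" using S(3) \<open>x \<in> X\<close> by blast
    have "norm (cis (\<nu> * (x - s)) - 1) < \<delta>" if "\<nu> \<in> \<Lambda>" for \<nu>
    proof -
      have "(\<lfloor>cos (\<nu> * x) / r\<rfloor>, \<lfloor>sin (\<nu> * x) / r\<rfloor>) = (\<lfloor>cos (\<nu> * s) / r\<rfloor>, \<lfloor>sin (\<nu> * s) / r\<rfloor>)"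
        using fun_cong[OF s(2), of \<nu>] that by (simp add: cell_def)
      then have "\<bar>cos (\<nu> * x) - cos (\<nu> * s)\<bar> < r" "\<bar>sin (\<nu> * x) - sin (\<nu> * s)\<bar> < r"
        using close by auto
      moreover have "norm (cis (\<nu> * x) - cis (\<nu> * s))
          \<le> \<bar>cos (\<nu> * x) - cos (\<nu> * s)\<bar> + \<bar>sin (\<nu> * x) - sin (\<nu> * s)\<bar>"
        using cmod_le[of "cis (\<nu> * x) - cis (\<nu> * s)"] by simp
      ultimately show ?thesis by (simp add: norm_cis_diff r_def)
    qed
    then show ?thesis using s by (auto simp: bohr_set_def)
  qed
  then show ?thesis using S that by blast
qed

lemma sum_cis_residues:
  fixes q :: nat and k :: int
  assumes "q > 0"
  shows "(\<Sum>j<q. cis (2 * pi * of_int k * real j / real q)) = (if int q dvd k then of_nat q else 0)"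
proof -
  define w where "w = cis (2 * pi * of_int k / real q)"
  have pw: "cis (2 * pi * of_int k * real j / real q) = w ^ j" for j
    unfolding w_def Complex.DeMoivre by (rule arg_cong[where f = cis]) (simp add: field_simps)
  have w1: "w = 1 \<longleftrightarrow> int q dvd k"
  proof
    assume "w = 1"
    then have "exp (\<i> * of_real (2 * pi * of_int k / real q)) = 1" by (simp add: w_def cis_conv_exp)
    then obtain n :: int where "2 * pi * of_int k / real q = of_int (2 * n) * pi"
      by (auto simp: exp_eq_1)
    then have "real_of_int k = real_of_int (n * int q)" using assms by (simp add: field_simps)
    then have "k = n * int q" by linarith
    then show "int q dvd k" by simp
  next
    assume "int q dvd k"
    then obtain n where "k = int q * n" by blast
    then have "2 * pi * of_int k / real q = 2 * pi * of_int n" using assms by simp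
    then show "w = 1" unfolding w_def by simp
  qed
  have "w ^ q = cis (2 * pi * of_int k)" using pw[of q] assms by simp
  then have "w ^ q = 1" by simp
  then have "(\<Sum>j<q. w ^ j) = (if w = 1 then of_nat q else 0)"
    by (simp add: sum_gp_strict)
  then show ?thesis by (simp add: pw w1)
qed

text \<open>
  Orthogonality of the characters modulo \<open>q\<close>, for the exponential sum \<open>S\<close> of the set \<open>A\<close>. The weighted
  sum of \<open>|S|\<^sup>4\<close> counts the representations of \<open>\<tau>\<close> as \<open>a - b + c - d\<close> modulo \<open>q\<close>, so it vanishes if
  there are none.
\<close>

lemma fourth_power_spectrum:
  fixes A :: "int set" and q :: nat and \<tau> :: int
  assumes A: "finite A" "q > 0" and inj: "\<And>a b. a \<in> A \<Longrightarrow> b \<in> A \<Longrightarrow> int q dvd a - b \<Longrightarrow> a = b"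
    and norep: "\<And>a b c d. \<lbrakk>a \<in> A; b \<in> A; c \<in> A; d \<in> A\<rbrakk> \<Longrightarrow> \<not> int q dvd (a - b + c - d - \<tau>)"
  defines "S \<equiv> \<lambda>j::nat. \<Sum>a\<in>A. cis (2 * pi * of_int a * real j / real q)"
  shows "(\<Sum>j<q. (norm (S j))\<^sup>2) = real q * real (card A)"
    and "(\<Sum>j<q. (norm (S j)) ^ 4 * cos (2 * pi * of_int \<tau> * real j / real q)) = 0"
proof -
  have cc: "cis (2 * pi * of_int a * real j / real q) * cis (2 * pi * of_int b * real j / real q)
      = cis (2 * pi * of_int (a + b) * real j / real q)" for a b :: int and j
    by (simp add: cis_mult distrib_left distrib_right add_divide_distrib)
  have sq: "complex_of_real ((norm (S j))\<^sup>2)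
      = (\<Sum>a\<in>A. \<Sum>b\<in>A. cis (2 * pi * of_int (a - b) * real j / real q))" for j
  proof -
    have c: "cnj (S j) = (\<Sum>b\<in>A. cis (2 * pi * of_int (- b) * real j / real q))"
      by (simp add: S_def cis_cnj)
    have "complex_of_real ((norm (S j))\<^sup>2) = S j * cnj (S j)"
      by (rule complex_norm_square)
    then show ?thesis unfolding c by (simp only: S_def sum_product cc diff_conv_add_uminus)
  qed
  have "complex_of_real (\<Sum>j<q. (norm (S j))\<^sup>2)
      = (\<Sum>a\<in>A. \<Sum>b\<in>A. \<Sum>j<q. cis (2 * pi * of_int (a - b) * real j / real q))"
    by (simp only: of_real_sum sq sum.swap[of _ A "{..<q}"])
  also have "\<dots> = (\<Sum>a\<in>A. \<Sum>b\<in>A. if b = a then of_nat q else 0)"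
    unfolding sum_cis_residues[OF A(2)] by (intro sum.cong refl) (auto dest: inj)
  also have "\<dots> = of_real (real q * real (card A))" using A by simp
  finally show "(\<Sum>j<q. (norm (S j))\<^sup>2) = real q * real (card A)" by (simp only: of_real_eq_iff)
  have four: "complex_of_real ((norm (S j)) ^ 4) * cis (2 * pi * of_int (- \<tau>) * real j / real q)
      = (\<Sum>a\<in>A. \<Sum>b\<in>A. \<Sum>c\<in>A. \<Sum>d\<in>A.
          cis (2 * pi * of_int (a - b + c - d - \<tau>) * real j / real q))" for j
  proof -
    have "complex_of_real ((norm (S j)) ^ 4)
        = complex_of_real ((norm (S j))\<^sup>2) * complex_of_real ((norm (S j))\<^sup>2)"
      by (simp add: power4_eq_xxxx power2_eq_square)
    then have "complex_of_real ((norm (S j)) ^ 4) * cis (2 * pi * of_int (- \<tau>) * real j / real q)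
       = (\<Sum>a\<in>A. \<Sum>b\<in>A. \<Sum>c\<in>A. \<Sum>d\<in>A. cis (2 * pi * of_int (a - b) * real j / real q) *
            cis (2 * pi * of_int (c - d) * real j / real q) * cis (2 * pi * of_int (- \<tau>) * real j / real q))"
      by (simp only: sq sum_distrib_left[symmetric] sum_distrib_right[symmetric])
    also have "\<dots> = (\<Sum>a\<in>A. \<Sum>b\<in>A. \<Sum>c\<in>A. \<Sum>d\<in>A.
          cis (2 * pi * of_int (a - b + c - d - \<tau>) * real j / real q))"
      by (simp only: cc diff_conv_add_uminus add.assoc)
    finally show ?thesis .
  qed
  have "(\<Sum>j<q. complex_of_real ((norm (S j)) ^ 4) * cis (2 * pi * of_int (- \<tau>) * real j / real q))
      = (\<Sum>a\<in>A. \<Sum>b\<in>A. \<Sum>c\<in>A. \<Sum>d\<in>A. \<Sum>j<q.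
          cis (2 * pi * of_int (a - b + c - d - \<tau>) * real j / real q))"
    by (simp only: four sum.swap[of _ A "{..<q}"])
  also have "\<dots> = 0"
    unfolding sum_cis_residues[OF A(2)] by (intro sum.neutral ballI) (simp add: norep)
  finally have "Re (\<Sum>j<q. complex_of_real ((norm (S j)) ^ 4) * cis (2 * pi * of_int (- \<tau>) * real j / real q)) = 0"
    by simp
  then show "(\<Sum>j<q. (norm (S j)) ^ 4 * cos (2 * pi * of_int \<tau> * real j / real q)) = 0"
    by simp
qed

definition double_differences :: "int set \<Rightarrow> int set" where
  "double_differences E = {a - b + c - d | a b c d. {a, b, c, d} \<subseteq> E}"

text \<open>
  The set \<open>A\<close> is regarded modulo \<open>q = 4 N\<close>, which is large enough to exclude wrap-around. By Parseval's
  identity at most \<open>32 N0\<^sup>2\<close> residues have a large exponential sum, independently of \<open>N\<close>; their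
  frequencies are the \<open>\<theta> i\<close>. If these do not make the cosines negative, then the term for the residue
  \<open>0\<close> outweighs all the small ones in the sum of \<open>fourth_power_spectrum\<close>, which therefore is not zero.
\<close>

lemma bogolyubov_finite:
  fixes A :: "int set" and N N0 :: nat
  assumes A: "A \<subseteq> {0..<int N}" and N: "N > 0" and dens: "N \<le> N0 * card A"
  obtains \<theta> :: "nat \<Rightarrow> real" where "\<And>i. \<theta> i \<in> {0..2 * pi}"
    "\<And>\<tau>. \<bar>\<tau>\<bar> < 2 * int N \<Longrightarrow> (\<And>i. i < 32 * N0\<^sup>2 \<Longrightarrow> cos (\<theta> i * of_int \<tau>) \<ge> 0) \<Longrightarrow>
       \<tau> \<in> double_differences A"
proof -
  have fA: "finite A" using A finite_subset by blast
  have cA: "card A > 0" using dens N by (intro gr0I) auto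
  have N0: "N0 > 0" using dens N by (intro gr0I) auto
  define q where "q = 4 * N"
  have q: "q > 0" using N by (simp add: q_def)
  define S where "S = (\<lambda>j::nat. \<Sum>a\<in>A. cis (2 * pi * of_int a * real j / real q))"
  define \<rho> where "\<rho> = 1 / (8 * real N0)"
  define R where "R = {j. j < q \<and> (norm (S j))\<^sup>2 \<ge> \<rho> * (real (card A))\<^sup>2}"
  have \<rho>: "\<rho> > 0" using N0 by (simp add: \<rho>_def)
  have dens': "real N \<le> real N0 * real (card A)" using dens by (simp flip: of_nat_mult)
  have small: "x = 0" if "\<bar>x\<bar> < int q" "int q dvd x" for x :: int
    using that zdvd_not_zless[of "\<bar>x\<bar>" "int q"] by (cases "x = 0") auto
  have dist: "a = b" if "a \<in> A" "b \<in> A" "int q dvd a - b" for a b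
  proof -
    have "\<bar>a - b\<bar> < int q" using A[THEN subsetD, OF that(1)] A[THEN subsetD, OF that(2)]
      by (auto simp: q_def)
    then show ?thesis using small[of "a - b"] that(3) by simp
  qed
  have fR: "finite R" by (simp add: R_def)
  show ?thesis
  proof (cases "\<forall>\<tau>. \<bar>\<tau>\<bar> < 2 * int N \<longrightarrow> \<tau> \<in> double_differences A")
    case True
    then show ?thesis by (intro that[of "\<lambda>_. 0"]) auto
  next
    case False
    have norep: "\<not> int q dvd (a - b + c - d - \<tau>)"
      if "\<bar>\<tau>\<bar> < 2 * int N" "\<tau> \<notin> double_differences A"
        and "a \<in> A" "b \<in> A" "c \<in> A" "d \<in> A" for \<tau> a b c d
    proof
      have "0 \<le> a" "a < int N" "0 \<le> b" "b < int N" "0 \<le> c" "c < int N" "0 \<le> d" "d < int N"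
        using that A by auto
      moreover assume "int q dvd (a - b + c - d - \<tau>)"
      ultimately have "a - b + c - d - \<tau> = 0" using that(1) by (intro small) (auto simp: q_def)
      then have "\<tau> = a - b + c - d" by simp
      then show False using that unfolding double_differences_def by blast
    qed
    have sumsq: "(\<Sum>j<q. (norm (S j))\<^sup>2) = real q * real (card A)"
      using False fourth_power_spectrum(1)[OF fA q dist norep] unfolding S_def by blast
    have "real (card R) * (\<rho> * (real (card A))\<^sup>2) \<le> (\<Sum>j\<in>R. (norm (S j))\<^sup>2)"
      by (intro sum_bounded_below) (simp add: R_def)
    also have "\<dots> \<le> (\<Sum>j<q. (norm (S j))\<^sup>2)" by (intro sum_mono2) (auto simp: R_def)
    also have "\<dots> \<le> 4 * (real N0 * real (card A)) * real (card A)"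
      unfolding sumsq using dens' by (intro mult_right_mono) (auto simp: q_def)
    finally have "real (card R) * (real (card A))\<^sup>2 \<le> (32 * (real N0)\<^sup>2) * (real (card A))\<^sup>2"
      using N0 by (simp add: \<rho>_def field_simps power2_eq_square)
    then have "real (card R) \<le> 32 * (real N0)\<^sup>2" using cA by simp
    also have "\<dots> = real (32 * N0\<^sup>2)" by simp
    finally have cardR: "card R \<le> 32 * N0\<^sup>2" by (simp only: of_nat_le_iff)
    obtain n and h :: "nat \<Rightarrow> nat" where h: "R = h ` {i. i < n}" "inj_on h {i. i < n}"
      using finite_imp_nat_seg_image_inj_on[OF fR] by blast
    then have "card R = n" by (simp add: card_image)
    with h have h: "R = h ` {i. i < card R}" by simp
    define \<theta> where "\<theta> i = (if i < card R then 2 * pi * real (h i) / real q else 0)" for i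
    show ?thesis
    proof (rule that[of \<theta>])
      fix i
      have "h i < q" if "i < card R" using h that by (auto simp: R_def)
      then show "\<theta> i \<in> {0..2 * pi}" using q by (auto simp: \<theta>_def field_simps)
    next
      fix \<tau> :: int
      assume \<tau>: "\<bar>\<tau>\<bar> < 2 * int N" and pos: "\<And>i. i < 32 * N0\<^sup>2 \<Longrightarrow> cos (\<theta> i * of_int \<tau>) \<ge> 0"
      show "\<tau> \<in> double_differences A"
      proof (rule ccontr)
        assume no: "\<not> ?thesis"
        define M where "M = real (card A)"
        have M: "M > 0" using cA by (simp add: M_def)
        have zero: "(\<Sum>j<q. (norm (S j)) ^ 4 * cos (2 * pi * of_int \<tau> * real j / real q)) = 0"
          using fourth_power_spectrum(2)[OF fA q dist norep[OF \<tau> no]] by (simp add: S_def)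
        have ge: "(if j = 0 then M ^ 4 else 0) - \<rho> * M\<^sup>2 * (norm (S j))\<^sup>2
            \<le> (norm (S j)) ^ 4 * cos (2 * pi * of_int \<tau> * real j / real q)" if j: "j < q" for j
        proof (cases "j \<in> R")
          case True
          then obtain i where i: "i < card R" "j = h i" using h by blast
          then have "cos (2 * pi * of_int \<tau> * real j / real q) \<ge> 0"
            using pos[of i] cardR by (simp add: \<theta>_def mult_ac)
          then have "(norm (S j)) ^ 4 * cos (2 * pi * of_int \<tau> * real j / real q) \<ge> 0" by simp
          moreover have "\<rho> * M\<^sup>2 * (norm (S j))\<^sup>2 \<ge> 0" using \<rho> by simp
          moreover have "S 0 = of_real M" by (simp add: S_def M_def)
          ultimately show ?thesis using M by auto
        next
          case False
          then have s: "(norm (S j))\<^sup>2 \<le> \<rho> * M\<^sup>2" using j by (simp add: R_def M_def)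
          have "(norm (S j)) ^ 4 * cos (2 * pi * of_int \<tau> * real j / real q) \<ge> (norm (S j)) ^ 4 * (-1)"
            by (intro mult_left_mono) auto
          moreover have "(norm (S j)) ^ 4 \<le> \<rho> * M\<^sup>2 * (norm (S j))\<^sup>2"
            using mult_right_mono[OF s, of "(norm (S j))\<^sup>2"] by (simp add: power4_eq_xxxx power2_eq_square)
          moreover have "j \<noteq> 0"
          proof
            assume "j = 0"
            moreover have "S 0 = of_real M" by (simp add: S_def M_def)
            ultimately have "M\<^sup>2 \<le> \<rho> * M\<^sup>2" using s by simp
            moreover have "\<rho> < 1" using N0 by (simp add: \<rho>_def)
            ultimately show False using M by simp
          qed
          ultimately show ?thesis by simp
        qed
        have "(\<Sum>j<q. (if j = 0 then M ^ 4 else 0) - \<rho> * M\<^sup>2 * (norm (S j))\<^sup>2) \<le> 0"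
          by (rule order_trans[OF sum_mono[OF ge] eq_refl[OF zero]]) simp
        then have "M ^ 4 \<le> \<rho> * M\<^sup>2 * (real q * M)"
          using q by (simp add: sum_subtractf sumsq M_def flip: sum_distrib_left)
        also have "\<dots> \<le> \<rho> * M\<^sup>2 * (4 * (real N0 * M) * M)"
          using dens' \<rho> M by (intro mult_left_mono mult_right_mono) (auto simp: q_def M_def)
        also have "\<dots> = M ^ 4 / 2" using N0 by (simp add: \<rho>_def field_simps power4_eq_xxxx power2_eq_square)
        finally show False using M by simp
      qed
    qed
  qed
qed

lemma bounded_sequences_convergent_subsequence:
  fixes x :: "nat \<Rightarrow> nat \<Rightarrow> real"
  assumes "\<And>k i. x k i \<in> {a..b}"
  shows "\<exists>r y. strict_mono r \<and> (\<forall>i<m. (\<lambda>k. x (r k) i) \<longlonglongrightarrow> y i)"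
proof (induction m)
  case 0
  then show ?case by (auto intro: exI[of _ id] strict_mono_id)
next
  case (Suc m)
  then obtain r y where r: "strict_mono r" and y: "\<And>i. i < m \<Longrightarrow> (\<lambda>k. x (r k) i) \<longlonglongrightarrow> y i"
    by blast
  have "\<forall>k. x (r k) m \<in> {a..b}" using assms by blast
  then obtain l s where s: "strict_mono s" and l: "((\<lambda>k. x (r k) m) \<circ> s) \<longlonglongrightarrow> l"
    using compact_Icc[of a b] unfolding compact_def by meson
  have "(\<lambda>k. x ((r \<circ> s) k) i) \<longlonglongrightarrow> (y(m := l)) i" if "i < Suc m" for i
  proof (cases "i = m")
    case True
    then show ?thesis using l by (simp add: o_def)
  next
    case False
    then show ?thesis
      using LIMSEQ_subseq_LIMSEQ[OF y[of i] s] that by (simp add: o_def)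
  qed
  moreover have "strict_mono (r \<circ> s)" using r s by (rule strict_mono_o)
  ultimately show ?case by blast
qed

text \<open>
  The number of frequencies in \<open>bogolyubov_finite\<close> depends on the gap length \<open>N0\<close> only. Along a
  subsequence of windows the frequencies therefore converge, and the limits serve for every \<open>\<tau>\<close>: a strict
  inequality at the limit persists for all large windows of the subsequence.
\<close>

lemma bogolyubov:
  fixes E :: "int set"
  assumes dense: "\<And>m. \<exists>p\<in>{m..<m + int N0}. p \<in> E"
  obtains \<Lambda> where "finite \<Lambda>"
    "\<And>\<tau>. of_int \<tau> \<in> bohr_set \<Lambda> 1 \<Longrightarrow> \<tau> \<in> double_differences E"
proof -
  have N0: "N0 > 0" using dense[of 0] by (intro gr0I) auto
  define m where "m = 32 * N0\<^sup>2"
  have ex: "\<exists>\<theta> :: nat \<Rightarrow> real. (\<forall>i. \<theta> i \<in> {0..2 * pi}) \<and>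
      (\<forall>\<tau>. \<bar>\<tau>\<bar> \<le> int k \<longrightarrow> (\<forall>i<m. cos (\<theta> i * of_int \<tau>) \<ge> 0) \<longrightarrow>
         \<tau> \<in> double_differences E)" for k
  proof -
    define N where "N = N0 * Suc k"
    define A where "A = E \<inter> {0..<int N}"
    have "\<forall>j. \<exists>p. p \<in> E \<and> p \<in> {int N0 * int j..<int N0 * int j + int N0}"
      using dense by blast
    then obtain p where p: "\<And>j. p j \<in> E" "\<And>j. p j \<in> {int N0 * int j..<int N0 * int j + int N0}"
      by metis
    have lt: "p i < p j" if "i < j" for i j
    proof -
      have "int N0 * int i + int N0 = int N0 * int (Suc i)" by (simp add: algebra_simps)
      also have "\<dots> \<le> int N0 * int j" using that by (intro mult_left_mono) auto
      finally show ?thesis using p(2)[of i] p(2)[of j] by auto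
    qed
    have "inj p" using lt by (intro strict_mono_imp_inj_on) (simp add: strict_mono_def)
    have sub: "p ` {..k} \<subseteq> A"
    proof
      fix y assume "y \<in> p ` {..k}"
      then obtain j where j: "y = p j" "j \<le> k" by auto
      have "int N0 * int j + int N0 = int N0 * int (Suc j)" by (simp add: algebra_simps)
      also have "\<dots> \<le> int N0 * int (Suc k)" using j by (intro mult_left_mono) auto
      also have "\<dots> = int N" by (simp only: N_def of_nat_mult)
      finally have "int N0 * int j + int N0 \<le> int N" .
      then have "p j < int N" using p(2)[of j] by simp
      moreover have "0 \<le> p j" using p(2)[of j] by (meson atLeastLessThan_iff order_trans zero_le_mult_iff of_nat_0_le_iff)
      ultimately show "y \<in> A" using p(1)[of j] j(1) by (simp add: A_def)
    qed
    have "Suc k = card (p ` {..k})" using \<open>inj p\<close> by (simp add: card_image inj_on_subset)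
    also have "\<dots> \<le> card A" using sub by (intro card_mono) (auto simp: A_def)
    finally have dens: "N \<le> N0 * card A" unfolding N_def by (rule mult_le_mono2)
    have AN: "A \<subseteq> {0..<int N}" "N > 0" using N0 by (auto simp: A_def N_def)
    have "1 * Suc k \<le> N0 * Suc k" using N0 by (intro mult_le_mono1) simp
    then have "Suc k \<le> N" by (simp only: N_def mult_1)
    then have kN: "int k < 2 * int N" by linarith
    show ?thesis
    proof (rule bogolyubov_finite[OF AN dens])
      fix \<theta> :: "nat \<Rightarrow> real" assume \<theta>: "\<And>i. \<theta> i \<in> {0..2 * pi}"
      "\<And>\<tau>. \<bar>\<tau>\<bar> < 2 * int N \<Longrightarrow> (\<And>i. i < 32 * N0\<^sup>2 \<Longrightarrow> cos (\<theta> i * of_int \<tau>) \<ge> 0) \<Longrightarrow>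
         \<tau> \<in> double_differences A"
    have "\<tau> \<in> double_differences E"
      if "\<bar>\<tau>\<bar> \<le> int k" "\<forall>i<m. cos (\<theta> i * of_int \<tau>) \<ge> 0" for \<tau>
    proof -
      have "\<tau> \<in> double_differences A"
        using that kN by (intro \<theta>(2)) (auto simp: m_def)
      then show ?thesis unfolding A_def double_differences_def by blast
    qed
    then show ?thesis using \<theta>(1) by blast
    qed
  qed
  then obtain x :: "nat \<Rightarrow> nat \<Rightarrow> real" where x: "\<And>k i. x k i \<in> {0..2 * pi}"
    "\<And>k \<tau>. \<bar>\<tau>\<bar> \<le> int k \<Longrightarrow> (\<And>i. i < m \<Longrightarrow> cos (x k i * of_int \<tau>) \<ge> 0) \<Longrightarrow>
         \<tau> \<in> double_differences E"
    by metis
  obtain r y where r: "strict_mono r" and y: "\<And>i. i < m \<Longrightarrow> (\<lambda>k. x (r k) i) \<longlonglongrightarrow> y i"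
    using bounded_sequences_convergent_subsequence[of x, OF x(1), of m] by auto
  show ?thesis
  proof (rule that[of "y ` {..<m}"])
    show "finite (y ` {..<m})" by simp
    fix \<tau> :: int assume \<tau>: "of_int \<tau> \<in> bohr_set (y ` {..<m}) 1"
    have pos: "cos (y i * of_int \<tau>) > 0" if "i < m" for i
    proof -
      have "norm (cis (y i * of_int \<tau>) - 1) < 1" using \<tau> that by (auto simp: bohr_set_def)
      then have "\<bar>Re (cis (y i * of_int \<tau>) - 1)\<bar> < 1" using abs_Re_le_cmod le_less_trans by blast
      then show ?thesis by simp
    qed
    have "\<forall>\<^sub>F k in sequentially. cos (x (r k) i * of_int \<tau>) > 0" if "i < m" for i
      by (rule order_tendstoD(1)[OF _ pos[OF that]]) (intro tendsto_intros y that)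
    then have "\<forall>\<^sub>F k in sequentially. \<forall>i\<in>{..<m}. cos (x (r k) i * of_int \<tau>) > 0"
      by (intro eventually_ball_finite) auto
    moreover have "\<forall>\<^sub>F k in sequentially. nat \<bar>\<tau>\<bar> \<le> k" by (rule eventually_ge_at_top)
    ultimately have "\<forall>\<^sub>F k in sequentially. (\<forall>i\<in>{..<m}. cos (x (r k) i * of_int \<tau>) > 0) \<and> nat \<bar>\<tau>\<bar> \<le> k"
      by (rule eventually_conj)
    then obtain k where k: "\<forall>i\<in>{..<m}. cos (x (r k) i * of_int \<tau>) > 0" "nat \<bar>\<tau>\<bar> \<le> k"
      using eventually_happens'[OF sequentially_bot] by blast
    have "\<bar>\<tau>\<bar> \<le> int (r k)" using k(2) seq_suble[OF r, of k] by linarith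
    then show "\<tau> \<in> double_differences E"
      using k(1) by (intro x(2)[of \<tau> "r k"]) (auto intro: less_imp_le)
  qed
qed

section \<open>Almost periodicity through Bohr sets\<close>

text \<open>
  The embedding \<open>e\<close> of the group into the line lets one notion serve the integers and the line, on
  which Bohr sets are defined.
\<close>

definition bohr_ap :: "('g::ab_group_add \<Rightarrow> real) \<Rightarrow> ('g \<Rightarrow> complex) \<Rightarrow> bool" where
  "bohr_ap e f \<longleftrightarrow> (\<forall>\<epsilon>>0. \<exists>\<Lambda> \<delta>. finite \<Lambda> \<and> \<delta> > 0 \<and>
     (\<forall>p. e p \<in> bohr_set \<Lambda> \<delta> \<longrightarrow> (\<forall>t. norm (f (t + p) - f t) \<le> \<epsilon>)))"

lemma bohr_apE:
  assumes "bohr_ap e f" "\<epsilon> > 0"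
  obtains \<Lambda> \<delta> where "finite \<Lambda>" "\<delta> > 0"
    "\<And>p t. e p \<in> bohr_set \<Lambda> \<delta> \<Longrightarrow> norm (f (t + p) - f t) \<le> \<epsilon>"
proof -
  have "\<exists>\<Lambda> \<delta>. finite \<Lambda> \<and> \<delta> > 0 \<and> (\<forall>p. e p \<in> bohr_set \<Lambda> \<delta> \<longrightarrow> (\<forall>t. norm (f (t + p) - f t) \<le> \<epsilon>))"
    using assms unfolding bohr_ap_def by simp
  then show ?thesis using that by auto
qed

lemma bohr_ap_bounded:
  fixes e :: "'g::ab_group_add \<Rightarrow> real"
  assumes "bohr_ap e f" and e: "\<And>x y. e (x - y) = e x - e y"
  shows "\<exists>B\<ge>0. \<forall>t. norm (f t) \<le> B"
proof -
  obtain \<Lambda> \<delta> where L: "finite \<Lambda>" "\<delta> > 0"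
    and ap: "\<And>p t. e p \<in> bohr_set \<Lambda> \<delta> \<Longrightarrow> norm (f (t + p) - f t) \<le> 1"
    using bohr_apE[OF assms(1), of 1] by auto
  obtain S where S: "finite S" "S \<subseteq> range e" "\<And>x. x \<in> range e \<Longrightarrow> \<exists>s\<in>S. x - s \<in> bohr_set \<Lambda> \<delta>"
    using bohr_set_syndetic[OF L] by metis
  obtain S' where S': "finite S'" "S = e ` S'" using finite_subset_image[OF S(1,2)] by blast
  define B where "B = (\<Sum>s\<in>S'. norm (f s)) + 1"
  have "norm (f t) \<le> B" for t
  proof -
    obtain s where s: "s \<in> S'" "e t - e s \<in> bohr_set \<Lambda> \<delta>" using S(3)[of "e t"] S' by auto
    have "norm (f (s + (t - s)) - f s) \<le> 1" using s by (intro ap) (simp add: e)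
    then have "norm (f t) \<le> norm (f s) + 1" using norm_triangle_ineq2[of "f t" "f s"] by simp
    also have "norm (f s) \<le> (\<Sum>s\<in>S'. norm (f s))" using s S' by (intro member_le_sum) auto
    finally show ?thesis by (simp add: B_def)
  qed
  moreover have "B \<ge> 0" unfolding B_def by (intro add_nonneg_nonneg sum_nonneg) auto
  ultimately show ?thesis by blast
qed

text \<open>
  Two Bohr sets contain a common one, so almost periods can be shared. This is what makes sums and
  products almost periodic, and it is not visible from relative density alone.
\<close>

lemma bohr_ap_combine:
  assumes "bohr_ap e f" "bohr_ap e g"
    and "\<And>s t. norm (h s - h t) \<le> C * norm (f s - f t) + D * norm (g s - g t)"
  shows "bohr_ap e h"
  unfolding bohr_ap_def
proof (intro allI impI)
  fix \<epsilon> :: real assume \<epsilon>: "\<epsilon> > 0"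
  define c where "c = 1 + \<bar>C\<bar> + \<bar>D\<bar>"
  have c: "c > 0" by (simp add: c_def add_pos_nonneg)
  obtain \<Lambda> \<delta> where 1: "finite \<Lambda>" "\<delta> > 0"
    "\<And>p t. e p \<in> bohr_set \<Lambda> \<delta> \<Longrightarrow> norm (f (t + p) - f t) \<le> \<epsilon> / c"
    using bohr_apE[OF assms(1), of "\<epsilon> / c"] \<epsilon> c by auto
  obtain \<Lambda>' \<delta>' where 2: "finite \<Lambda>'" "\<delta>' > 0"
    "\<And>p t. e p \<in> bohr_set \<Lambda>' \<delta>' \<Longrightarrow> norm (g (t + p) - g t) \<le> \<epsilon> / c"
    using bohr_apE[OF assms(2), of "\<epsilon> / c"] \<epsilon> c by auto
  show "\<exists>\<Lambda> \<delta>. finite \<Lambda> \<and> \<delta> > 0 \<and> (\<forall>p. e p \<in> bohr_set \<Lambda> \<delta> \<longrightarrow> (\<forall>t. norm (h (t + p) - h t) \<le> \<epsilon>))"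
  proof (intro exI[of _ "\<Lambda> \<union> \<Lambda>'"] exI[of _ "min \<delta> \<delta>'"] conjI allI impI)
    fix p t assume "e p \<in> bohr_set (\<Lambda> \<union> \<Lambda>') (min \<delta> \<delta>')"
    then have p: "e p \<in> bohr_set \<Lambda> \<delta>" "e p \<in> bohr_set \<Lambda>' \<delta>'" using bohr_set_Un by blast+
    have "norm (h (t + p) - h t) \<le> C * norm (f (t + p) - f t) + D * norm (g (t + p) - g t)"
      by (rule assms(3))
    also have "\<dots> \<le> \<bar>C\<bar> * (\<epsilon> / c) + \<bar>D\<bar> * (\<epsilon> / c)"
      using p 1(3) 2(3) by (intro add_mono mult_mono) auto
    also have "\<dots> \<le> c * (\<epsilon> / c)"
      unfolding distrib_right[symmetric] using c \<epsilon> by (intro mult_right_mono) (auto simp: c_def)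
    finally show "norm (h (t + p) - h t) \<le> \<epsilon>" using c by simp
  qed (use 1 2 in auto)
qed

lemma bohr_ap_lipschitz:
  assumes "bohr_ap e f" "\<And>s t. norm (h s - h t) \<le> C * norm (f s - f t)"
  shows "bohr_ap e h"
  using bohr_ap_combine[OF assms(1,1), of h C 0] assms(2) by simp

lemma bohr_ap_const: "bohr_ap e (\<lambda>t. c)"
  unfolding bohr_ap_def by (auto intro!: exI[of _ "{}"] exI[of _ 1])

lemma bohr_ap_add: "bohr_ap e f \<Longrightarrow> bohr_ap e g \<Longrightarrow> bohr_ap e (\<lambda>t. f t + g t)"
  by (rule bohr_ap_combine[where C = 1 and D = 1 and f = f and g = g])
     (auto simp: add_diff_add intro: norm_triangle_ineq)

lemma bohr_ap_cnj: "bohr_ap e f \<Longrightarrow> bohr_ap e (\<lambda>t. cnj (f t))"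
  by (rule bohr_ap_lipschitz[where C = 1 and f = f])
     (simp_all flip: complex_cnj_diff)

lemma bohr_ap_mult:
  fixes e :: "'g::ab_group_add \<Rightarrow> real"
  assumes "bohr_ap e f" "bohr_ap e g" and e: "\<And>x y. e (x - y) = e x - e y"
  shows "bohr_ap e (\<lambda>t. f t * g t)"
proof -
  obtain B where B: "\<And>t. norm (f t) \<le> B" "B \<ge> 0" using bohr_ap_bounded[OF assms(1) e] by blast
  obtain D where D: "\<And>t. norm (g t) \<le> D" "D \<ge> 0" using bohr_ap_bounded[OF assms(2) e] by blast
  have "norm (f s * g s - f t * g t) \<le> D * norm (f s - f t) + B * norm (g s - g t)" for s t
  proof -
    have "f s * g s - f t * g t = (f s - f t) * g s + f t * (g s - g t)" by (simp add: algebra_simps)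
    also have "norm \<dots> \<le> norm (f s - f t) * norm (g s) + norm (f t) * norm (g s - g t)"
      by (metis norm_triangle_ineq norm_mult)
    also have "\<dots> \<le> norm (f s - f t) * D + B * norm (g s - g t)"
      using B D by (intro add_mono mult_left_mono mult_right_mono) auto
    finally show ?thesis by (simp add: mult.commute)
  qed
  then show ?thesis by (rule bohr_ap_combine[OF assms(1,2)])
qed

lemma bohr_ap_translate: "bohr_ap e f \<Longrightarrow> bohr_ap e (\<lambda>t. f (t + s))"
  unfolding bohr_ap_def by (simp add: add.assoc) (metis add.assoc add.commute)

lemma bohr_ap_reflect:
  assumes "bohr_ap e f" and e: "\<And>x y. e (x - y) = e x - e y"
  shows "bohr_ap e (\<lambda>t. f (- t))"
  unfolding bohr_ap_def
proof (intro allI impI)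
  fix \<epsilon> :: real assume "\<epsilon> > 0"
  then obtain \<Lambda> \<delta> where 1: "finite \<Lambda>" "\<delta> > 0"
    "\<And>p t. e p \<in> bohr_set \<Lambda> \<delta> \<Longrightarrow> norm (f (t + p) - f t) \<le> \<epsilon>"
    using bohr_apE[OF assms(1)] by blast
  have em: "e (- p) = - e p" for p using e[of 0 p] e[of 0 0] by simp
  have "norm (f (- (t + p)) - f (- t)) \<le> \<epsilon>" if "e p \<in> bohr_set \<Lambda> \<delta>" for p t
    using 1(3)[of "- p" "- t"] that by (simp add: em bohr_set_uminus)
  then show "\<exists>\<Lambda> \<delta>. finite \<Lambda> \<and> \<delta> > 0 \<and>
      (\<forall>p. e p \<in> bohr_set \<Lambda> \<delta> \<longrightarrow> (\<forall>t. norm (f (- (t + p)) - f (- t)) \<le> \<epsilon>))"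
    using 1(1,2) by blast
qed

lemma bohr_ap_cis:
  assumes e: "\<And>x y. e (x + y) = e x + e y"
  shows "bohr_ap e (\<lambda>t. cis (\<nu> * e t))"
  unfolding bohr_ap_def
proof (intro allI impI)
  fix \<epsilon> :: real assume \<epsilon>: "\<epsilon> > 0"
  have "norm (cis (\<nu> * e (t + p)) - cis (\<nu> * e t)) \<le> \<epsilon>" if "e p \<in> bohr_set {\<nu>} \<epsilon>" for p t
    using that norm_cis_diff[of \<nu> "e (t + p)" "e t"] by (simp add: e bohr_set_def)
  then show "\<exists>\<Lambda> \<delta>. finite \<Lambda> \<and> \<delta> > 0 \<and>
      (\<forall>p. e p \<in> bohr_set \<Lambda> \<delta> \<longrightarrow> (\<forall>t. norm (cis (\<nu> * e (t + p)) - cis (\<nu> * e t)) \<le> \<epsilon>))"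
    using \<epsilon> by (intro exI[of _ "{\<nu>}"] exI[of _ \<epsilon>]) auto
qed

text \<open>
  Differences of \<open>\<epsilon>/4\<close>-almost periods, taken twice, are \<open>\<epsilon>\<close>-almost periods, so this is Bogolyubov's
  theorem for the set of almost periods in the subgroup \<open>range \<iota>\<close>.
\<close>

lemma almost_periods_contain_bohr_set:
  fixes f :: "'g::ab_group_add \<Rightarrow> complex" and \<iota> :: "int \<Rightarrow> 'g"
  assumes \<iota>: "\<And>m n. \<iota> (m - n) = \<iota> m - \<iota> n"
    and dense: "\<And>m. \<exists>p\<in>{m..<m + int N}. \<forall>t. norm (f (t + \<iota> p) - f t) \<le> \<epsilon> / 4"
  shows "\<exists>\<Lambda>. finite \<Lambda> \<and> (\<forall>n t. of_int n \<in> bohr_set \<Lambda> 1 \<longrightarrow> norm (f (t + \<iota> n) - f t) \<le> \<epsilon>)"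
proof -
  define E where "E = {n. \<forall>t. norm (f (t + \<iota> n) - f t) \<le> \<epsilon> / 4}"
  have E: "norm (f (t + \<iota> n) - f t) \<le> \<epsilon> / 4" if "n \<in> E" for n t
    using that by (simp add: E_def)
  have "\<exists>p\<in>{m..<m + int N}. p \<in> E" for m using dense by (simp add: E_def)
  from bogolyubov[OF this] obtain \<Lambda> where \<Lambda>: "finite \<Lambda>"
    "\<And>\<tau>. of_int \<tau> \<in> bohr_set \<Lambda> 1 \<Longrightarrow> \<tau> \<in> double_differences E"
    by blast
  have "norm (f (t + \<iota> n) - f t) \<le> \<epsilon>" if n: "real_of_int n \<in> bohr_set \<Lambda> 1" for n t
  proof -
    obtain b c d e where bcde: "b \<in> E" "c \<in> E" "d \<in> E" "e \<in> E" "n = b - c + d - e"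
      using \<Lambda>(2)[OF n] unfolding double_differences_def by blast
    define s where "s = t + \<iota> b - \<iota> c"
    have "n = (b - c) - (e - d)" using bcde(5) by simp
    then have "\<iota> n = \<iota> b - \<iota> c - (\<iota> e - \<iota> d)" by (simp only: \<iota>)
    then have "s + \<iota> d = t + \<iota> n + \<iota> e" "s + \<iota> c = t + \<iota> b" by (simp_all add: s_def algebra_simps)
    then show ?thesis
      using E[OF bcde(1), of t] E[OF bcde(2), of s] E[OF bcde(3), of s] E[OF bcde(4), of "t + \<iota> n"]
        norm_triangle_ineq4[of "f (t + \<iota> b) - f t" "f (t + \<iota> b) - f s"]
        norm_triangle_ineq4[of "f (s + \<iota> d) - f s" "f (s + \<iota> d) - f (t + \<iota> n)"]
        norm_triangle_ineq[of "f (t + \<iota> n) - f s" "f s - f t"]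
      by simp
  qed
  then show ?thesis using \<Lambda>(1) by blast
qed

theorem AP_Z_iff_bohr_ap: "a \<in> AP_Z \<longleftrightarrow> bohr_ap of_int a"
proof
  assume a: "a \<in> AP_Z"
  show "bohr_ap of_int a"
    unfolding bohr_ap_def
  proof (intro allI impI)
    fix \<epsilon> :: real assume "\<epsilon> > 0"
    then obtain N :: nat where "\<And>m. \<exists>p\<in>{m..<m + int N}. \<forall>n. norm (a (n + p) - a n) \<le> \<epsilon> / 4"
      using a[unfolded AP_Z_def mem_Collect_eq, rule_format, of "\<epsilon> / 4"] by auto
    from almost_periods_contain_bohr_set[of "\<lambda>p. p", OF refl this]
    show "\<exists>\<Lambda> \<delta>. finite \<Lambda> \<and> \<delta> > 0 \<and> (\<forall>p. real_of_int p \<in> bohr_set \<Lambda> \<delta> \<longrightarrow> (\<forall>n. norm (a (n + p) - a n) \<le> \<epsilon>))"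
      by (metis zero_less_one)
  qed
next
  assume a: "bohr_ap of_int a"
  show "a \<in> AP_Z"
    unfolding AP_Z_def mem_Collect_eq
  proof (intro allI impI)
    fix \<epsilon> :: real assume "\<epsilon> > 0"
    then obtain \<Lambda> \<delta> where L: "finite \<Lambda>" "\<delta> > 0"
      and ap: "\<And>p n. real_of_int p \<in> bohr_set \<Lambda> \<delta> \<Longrightarrow> norm (a (n + p) - a n) \<le> \<epsilon>"
      using bohr_apE[OF a] by blast
    obtain S where S: "finite S" "S \<subseteq> range real_of_int"
      "\<And>x. x \<in> range real_of_int \<Longrightarrow> \<exists>s\<in>S. x - s \<in> bohr_set \<Lambda> \<delta>"
      using bohr_set_syndetic[OF L] by metis
    obtain S' where S': "finite S'" "S = real_of_int ` S'" using finite_subset_image[OF S(1,2)] by blast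
    define M where "M = (\<Sum>s\<in>S'. \<bar>s\<bar>)"
    have M0: "M \<ge> 0" unfolding M_def by (intro sum_nonneg) auto
    have "\<exists>p\<in>{m..<m + int (nat (2 * M + 1))}. \<forall>n. norm (a (n + p) - a n) \<le> \<epsilon>" for m
    proof -
      obtain s where s: "s \<in> S'" "real_of_int (m + M) - real_of_int s \<in> bohr_set \<Lambda> \<delta>"
        using S(3)[of "real_of_int (m + M)"] S' by blast
      have "\<bar>s\<bar> \<le> M" unfolding M_def using s S' by (intro member_le_sum) auto
      then have "m + M - s \<in> {m..<m + int (nat (2 * M + 1))}" using M0 by auto
      moreover have "\<forall>n. norm (a (n + (m + M - s)) - a n) \<le> \<epsilon>"
        using s(2) by (intro allI ap) simp
      ultimately show ?thesis by blast
    qed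
    then show "\<exists>N::nat. \<forall>m. \<exists>p\<in>{m..<m + int N}. \<forall>n. norm (a (n + p) - a n) \<le> \<epsilon>" by blast
  qed
qed

lemma AP_R_period:
  assumes "f \<in> AP_R" "\<epsilon> > 0"
  obtains L where "L > 0" "\<And>x. \<exists>\<tau>\<in>{x..x + L}. \<forall>t. norm (f (t + \<tau>) - f t) \<le> \<epsilon>"
proof -
  obtain L where L: "L > 0" "\<forall>x y. y - x > L \<longrightarrow> (\<exists>\<tau>\<in>{x..y}. \<forall>t. norm (f (t + \<tau>) - f t) \<le> \<epsilon>)"
    using assms unfolding AP_R_def by blast
  have "\<exists>\<tau>\<in>{x..x + (L + 1)}. \<forall>t. norm (f (t + \<tau>) - f t) \<le> \<epsilon>" for x
    using L(1) by (intro L(2)[rule_format]) simp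
  then show ?thesis using that[of "L + 1"] L(1) by auto
qed

text \<open>
  An almost period moves any pair of neighbouring points into a fixed compact interval.
\<close>

lemma AP_R_uniformly_continuous:
  assumes f: "f \<in> AP_R" and \<epsilon>: "\<epsilon> > 0"
  obtains \<eta> where "\<eta> > 0" "\<And>x y. \<bar>x - y\<bar> < \<eta> \<Longrightarrow> norm (f x - f y) < \<epsilon>"
proof -
  have cont: "continuous_on UNIV f" using f by (simp add: AP_R_def)
  obtain L where L: "L > 0" "\<And>x. \<exists>\<tau>\<in>{x..x + L}. \<forall>t. norm (f (t + \<tau>) - f t) \<le> \<epsilon> / 3"
    using AP_R_period[OF f, of "\<epsilon> / 3"] \<epsilon> by auto
  have "uniformly_continuous_on {-1..L + 1} f"
    by (rule compact_uniformly_continuous[OF continuous_on_subset[OF cont]]) auto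
  then obtain d where d: "d > 0"
    "\<forall>x\<in>{-1..L + 1}. \<forall>y\<in>{-1..L + 1}. dist y x < d \<longrightarrow> dist (f y) (f x) < \<epsilon> / 3"
    using \<epsilon> unfolding uniformly_continuous_on_def
    by (elim allE[of _ "\<epsilon> / 3"]) auto
  show ?thesis
  proof (rule that[of "min d 1"])
    fix x y :: real assume xy: "\<bar>x - y\<bar> < min d 1"
    obtain \<tau> where \<tau>: "\<tau> \<in> {- x..- x + L}" "\<And>t. norm (f (t + \<tau>) - f t) \<le> \<epsilon> / 3"
      using L(2)[of "- x"] by blast
    have "dist (f (x + \<tau>)) (f (y + \<tau>)) < \<epsilon> / 3"
      using xy \<tau>(1) by (intro d(2)[rule_format]) (auto simp: dist_real_def)
    then have 1: "norm (f (x + \<tau>) - f (y + \<tau>)) < \<epsilon> / 3" by (simp add: dist_norm)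
    have "f x - f y = (f (y + \<tau>) - f y) - (f (x + \<tau>) - f x) + (f (x + \<tau>) - f (y + \<tau>))" by simp
    also have "norm \<dots> \<le> norm (f (y + \<tau>) - f y) + norm (f (x + \<tau>) - f x) + norm (f (x + \<tau>) - f (y + \<tau>))"
      by (intro order_trans[OF norm_triangle_ineq] add_right_mono norm_triangle_ineq4)
    finally show "norm (f x - f y) < \<epsilon>" using \<tau>(2)[of x] \<tau>(2)[of y] 1 by simp
  qed (use d in auto)
qed

lemma cis_near_one_imp_near_integer:
  assumes "\<eta> > 0" "\<eta> \<le> 1 / 2"
  obtains \<delta> where "\<delta> > 0" "\<And>x. norm (cis (2 * pi * x) - 1) < \<delta> \<Longrightarrow> \<exists>n::int. \<bar>x - of_int n\<bar> < \<eta>"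
proof (rule that[of "1 - cos (2 * pi * \<eta>)"])
  have "cos (2 * pi * \<eta>) < cos 0" using assms by (intro cos_monotone_0_pi) auto
  then show "1 - cos (2 * pi * \<eta>) > 0" by simp
  fix x :: real assume x: "norm (cis (2 * pi * x) - 1) < 1 - cos (2 * pi * \<eta>)"
  define n where "n = \<lfloor>x + 1 / 2\<rfloor>"
  have n: "\<bar>x - of_int n\<bar> \<le> 1 / 2" unfolding n_def by linarith
  have "\<bar>x - of_int n\<bar> < \<eta>"
  proof (rule ccontr)
    assume "\<not> \<bar>x - of_int n\<bar> < \<eta>"
    then have "cos (2 * pi * \<bar>x - of_int n\<bar>) \<le> cos (2 * pi * \<eta>)"
      using n assms by (intro cos_monotone_0_pi_le) auto
    moreover have "cos (2 * pi * \<bar>x - of_int n\<bar>) = cos (2 * pi * (x - of_int n))"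
      by (simp add: abs_if) (metis cos_minus minus_diff_eq mult_minus_right)
    moreover have "\<dots> = cos (2 * pi * x - 2 * pi * of_int n)" by (simp add: right_diff_distrib)
    moreover have "\<dots> = cos (2 * pi * x)" unfolding cos_diff by simp
    moreover have "1 - cos (2 * pi * x) \<le> norm (cis (2 * pi * x) - 1)"
      using abs_Re_le_cmod[of "cis (2 * pi * x) - 1"] by simp
    ultimately show False using x by linarith
  qed
  then show "\<exists>n::int. \<bar>x - of_int n\<bar> < \<eta>" by blast
qed

lemma norm_cis_minus_one_le: "norm (cis x - 1) \<le> \<bar>x\<bar>"
proof -
  have "norm (cis x - 1) = 2 * \<bar>sin (x / 2)\<bar>" by (simp add: cis_conv_exp dist_exp_i_1)
  also have "\<dots> \<le> 2 * \<bar>x / 2\<bar>" by (intro mult_left_mono abs_sin_x_le_abs_x) auto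
  finally show ?thesis by simp
qed


text \<open>
  By uniform continuity, almost periods of the line can be rounded to a fine lattice \<open>g\<int>\<close>. There
  Bogolyubov's theorem applies, and the additional frequency \<open>2 * pi / g\<close> carries the resulting Bohr set of
  the lattice back to the line.
\<close>

theorem AP_R_iff_bohr_ap: "f \<in> AP_R \<longleftrightarrow> continuous_on UNIV f \<and> bohr_ap (\<lambda>x. x) f"
proof
  assume f: "f \<in> AP_R"
  have "bohr_ap (\<lambda>x. x) f"
    unfolding bohr_ap_def
  proof (intro allI impI)
    fix \<epsilon> :: real assume \<epsilon>: "\<epsilon> > 0"
    obtain h where h: "h > 0" "\<And>x y. \<bar>x - y\<bar> < h \<Longrightarrow> norm (f x - f y) < \<epsilon> / 16"
      using AP_R_uniformly_continuous[OF f, of "\<epsilon> / 16"] \<epsilon> by auto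
    define g where "g = h / 2"
    have g: "g > 0" "g < h" using h by (auto simp: g_def)
    obtain L where L: "L > 0" "\<And>x. \<exists>\<tau>\<in>{x..x + L}. \<forall>t. norm (f (t + \<tau>) - f t) \<le> \<epsilon> / 16"
      using AP_R_period[OF f, of "\<epsilon> / 16"] \<epsilon> by auto
    have "\<exists>p\<in>{m..<m + int (nat (\<lfloor>L / g\<rfloor> + 2))}. \<forall>t. norm (f (t + g * of_int p) - f t) \<le> \<epsilon> / 2 / 4" for m
    proof -
      obtain \<tau> where \<tau>: "\<tau> \<in> {g * of_int m..g * of_int m + L}"
        "\<And>t. norm (f (t + \<tau>) - f t) \<le> \<epsilon> / 16" using L(2)[of "g * of_int m"] by blast
      define p where "p = \<lfloor>\<tau> / g\<rfloor>"
      have p: "\<bar>\<tau> / g - of_int p\<bar> < 1" unfolding p_def by linarith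
      have "\<tau> - g * of_int p = g * (\<tau> / g - of_int p)" using g by (simp add: field_simps)
      then have "\<bar>\<tau> - g * of_int p\<bar> = g * \<bar>\<tau> / g - of_int p\<bar>" using g by (simp add: abs_mult)
      also have "\<dots> < h" using p g mult_strict_left_mono[OF p g(1)] by linarith
      finally have close: "\<bar>g * of_int p - \<tau>\<bar> < h" by (simp add: abs_minus_commute)
      have "norm (f (t + g * of_int p) - f t) \<le> \<epsilon> / 2 / 4" for t
        using h(2)[of "t + g * of_int p" "t + \<tau>"] close \<tau>(2)[of t]
          norm_triangle_ineq[of "f (t + g * of_int p) - f (t + \<tau>)" "f (t + \<tau>) - f t"] by simp
      moreover have "real_of_int m \<le> \<tau> / g" "\<tau> / g \<le> real_of_int m + L / g"
        using \<tau>(1) g by (auto simp: field_simps)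
      then have "p \<in> {m..<m + int (nat (\<lfloor>L / g\<rfloor> + 2))}"
        unfolding p_def using L g by (auto simp: le_floor_iff) linarith
      ultimately show ?thesis by blast
    qed
    moreover have "g * of_int (m - n) = g * of_int m - g * of_int n" for m n :: int
      by (simp add: right_diff_distrib)
    ultimately obtain \<Lambda> where \<Lambda>: "finite \<Lambda>"
      and per: "\<And>n t. real_of_int n \<in> bohr_set \<Lambda> 1 \<Longrightarrow> norm (f (t + g * of_int n) - f t) \<le> \<epsilon> / 2"
      using almost_periods_contain_bohr_set[of "\<lambda>n. g * of_int n" _ f "\<epsilon> / 2"] by metis
    \<comment> \<open>A small value of \<open>cis (2 * pi * p / g) - 1\<close> puts \<open>p\<close> near a lattice point \<open>g * n\<close>, and \<open>\<eta>\<close> is so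
      small that passing from \<open>p / g\<close> to \<open>n\<close> moves each character with frequency in \<open>\<Lambda>\<close> by at most \<open>1/2\<close>.\<close>
    define M where "M = 1 + (\<Sum>\<nu>\<in>\<Lambda>. \<bar>\<nu>\<bar>)"
    have M: "M > 0" unfolding M_def by (intro add_pos_nonneg sum_nonneg) auto
    define \<eta> where "\<eta> = min (1 / 2) (1 / (2 * M))"
    have \<eta>: "\<eta> > 0" "\<eta> \<le> 1 / 2" using M by (auto simp: \<eta>_def)
    obtain \<delta> where \<delta>: "\<delta> > 0" "\<And>x. norm (cis (2 * pi * x) - 1) < \<delta> \<Longrightarrow> \<exists>n::int. \<bar>x - of_int n\<bar> < \<eta>"
      using cis_near_one_imp_near_integer[OF \<eta>] by auto
    define \<Lambda>' where "\<Lambda>' = insert (2 * pi / g) ((\<lambda>\<nu>. \<nu> / g) ` \<Lambda>)"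
    have "norm (f (t + p) - f t) \<le> \<epsilon>" if p: "p \<in> bohr_set \<Lambda>' (min \<delta> (1 / 2))" for p t
    proof -
      have "norm (cis (2 * pi * (p / g)) - 1) < \<delta>" using p by (simp add: bohr_set_def \<Lambda>'_def)
      then obtain n :: int where n: "\<bar>p / g - of_int n\<bar> < \<eta>" using \<delta>(2) by blast
      have "real_of_int n \<in> bohr_set \<Lambda> 1"
        unfolding bohr_set_def mem_Collect_eq
      proof
        fix \<nu> assume \<nu>: "\<nu> \<in> \<Lambda>"
        have 1: "norm (cis (\<nu> * (p / g)) - 1) < 1 / 2"
          using p \<nu> by (simp add: bohr_set_def \<Lambda>'_def)
        have "\<bar>\<nu>\<bar> \<le> (\<Sum>\<nu>\<in>\<Lambda>. \<bar>\<nu>\<bar>)" using \<Lambda> \<nu> by (intro member_le_sum) auto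
        then have "\<bar>\<nu>\<bar> \<le> M" by (simp add: M_def)
        have "norm (cis (\<nu> * of_int n) - cis (\<nu> * (p / g))) \<le> \<bar>\<nu> * (of_int n - p / g)\<bar>"
          using norm_cis_minus_one_le norm_cis_diff by metis
        also have "\<dots> = \<bar>\<nu>\<bar> * \<bar>p / g - of_int n\<bar>" by (simp add: abs_mult abs_minus_commute)
        also have "\<dots> \<le> M * (1 / (2 * M))"
          using n \<open>\<bar>\<nu>\<bar> \<le> M\<close> M by (intro mult_mono) (auto simp: \<eta>_def)
        also have "\<dots> = 1 / 2" using M by simp
        finally show "norm (cis (\<nu> * of_int n) - 1) < 1"
          using 1 norm_triangle_ineq[of "cis (\<nu> * of_int n) - cis (\<nu> * (p / g))" "cis (\<nu> * (p / g)) - 1"]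
          by simp
      qed
      then have 1: "norm (f (t + g * of_int n) - f t) \<le> \<epsilon> / 2" by (rule per)
      have "p - g * of_int n = g * (p / g - of_int n)" using g by (simp add: field_simps)
      then have "\<bar>p - g * of_int n\<bar> = g * \<bar>p / g - of_int n\<bar>" using g by (simp add: abs_mult)
      also have "\<dots> \<le> g * 1" using n \<eta> g by (intro mult_left_mono) auto
      finally have "norm (f (t + p) - f (t + g * of_int n)) < \<epsilon> / 16"
        using g by (intro h) auto
      then show ?thesis
        using 1 \<epsilon> norm_triangle_ineq[of "f (t + p) - f (t + g * of_int n)" "f (t + g * of_int n) - f t"] by simp
    qed
    moreover have "finite \<Lambda>'" "min \<delta> (1 / 2) > 0" using \<Lambda> \<delta> by (auto simp: \<Lambda>'_def)
    ultimately show "\<exists>\<Lambda> \<delta>. finite \<Lambda> \<and> \<delta> > 0 \<and> (\<forall>p. p \<in> bohr_set \<Lambda> \<delta> \<longrightarrow> (\<forall>t. norm (f (t + p) - f t) \<le> \<epsilon>))"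
      by blast
  qed
  then show "continuous_on UNIV f \<and> bohr_ap (\<lambda>x. x) f" using f by (simp add: AP_R_def)
next
  assume f: "continuous_on UNIV f \<and> bohr_ap (\<lambda>x. x) f"
  have "\<exists>L>0. \<forall>x y. y - x > L \<longrightarrow> (\<exists>\<tau>\<in>{x..y}. \<forall>t. norm (f (t + \<tau>) - f t) \<le> \<epsilon>)" if \<epsilon>: "\<epsilon> > 0" for \<epsilon>
  proof -
    obtain \<Lambda> \<delta> where L: "finite \<Lambda>" "\<delta> > 0"
      and ap: "\<And>p t. p \<in> bohr_set \<Lambda> \<delta> \<Longrightarrow> norm (f (t + p) - f t) \<le> \<epsilon>"
      using bohr_apE[OF conjunct2[OF f] \<epsilon>] by blast
    obtain S where S: "finite S" "\<And>x. \<exists>s\<in>S. x - s \<in> bohr_set \<Lambda> \<delta>"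
      using bohr_set_syndetic[OF L, of UNIV] by auto
    define M where "M = 1 + (\<Sum>s\<in>S. \<bar>s\<bar>)"
    have M: "M > 0" unfolding M_def by (intro add_pos_nonneg sum_nonneg) auto
    have "\<exists>\<tau>\<in>{x..y}. \<forall>t. norm (f (t + \<tau>) - f t) \<le> \<epsilon>" if "y - x > 2 * M" for x y
    proof -
      obtain s where s: "s \<in> S" "x + M - s \<in> bohr_set \<Lambda> \<delta>" using S(2) by blast
      have "\<bar>s\<bar> \<le> (\<Sum>s\<in>S. \<bar>s\<bar>)" using s S by (intro member_le_sum) auto
      then have "x + M - s \<in> {x..y}" using that by (auto simp: M_def)
      then show ?thesis using ap[OF s(2)] by blast
    qed
    then show ?thesis using M by (intro exI[of _ "2 * M"]) auto
  qed
  then show "f \<in> AP_R" using f by (simp add: AP_R_def)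
qed

section \<open>Algebras of functions with a mean\<close>

text \<open>
  The sequences and the functions share their Hilbert space geometry, which is developed here from
  an algebra of functions with a positive normalised linear functional.
\<close>

locale mean_functional =
  fixes V :: "('g \<Rightarrow> complex) set" and M :: "('g \<Rightarrow> complex) \<Rightarrow> complex"
  assumes const_mem: "(\<lambda>t. c) \<in> V"
    and add_mem: "f \<in> V \<Longrightarrow> g \<in> V \<Longrightarrow> (\<lambda>t. f t + g t) \<in> V"
    and mult_mem: "f \<in> V \<Longrightarrow> g \<in> V \<Longrightarrow> (\<lambda>t. f t * g t) \<in> V"
    and cnj_mem: "f \<in> V \<Longrightarrow> (\<lambda>t. cnj (f t)) \<in> V"
    and mean_add: "f \<in> V \<Longrightarrow> g \<in> V \<Longrightarrow> M (\<lambda>t. f t + g t) = M f + M g"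
    and mean_cmult: "f \<in> V \<Longrightarrow> M (\<lambda>t. c * f t) = c * M f"
    and mean_cnj: "f \<in> V \<Longrightarrow> M (\<lambda>t. cnj (f t)) = cnj (M f)"
    and mean_one: "M (\<lambda>t. 1) = 1"
    and mean_nonneg: "f \<in> V \<Longrightarrow> (\<And>t. f t \<in> \<real>) \<Longrightarrow> (\<And>t. Re (f t) \<ge> 0) \<Longrightarrow> Re (M f) \<ge> 0"
begin

definition ip :: "('g \<Rightarrow> complex) \<Rightarrow> ('g \<Rightarrow> complex) \<Rightarrow> complex" where
  "ip f g = M (\<lambda>t. f t * cnj (g t))"

definition nrm :: "('g \<Rightarrow> complex) \<Rightarrow> real" where
  "nrm f = sqrt (Re (ip f f))"

lemma cmult_mem: "f \<in> V \<Longrightarrow> (\<lambda>t. c * f t) \<in> V"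
  by (intro mult_mem const_mem)

lemma diff_mem: "f \<in> V \<Longrightarrow> g \<in> V \<Longrightarrow> (\<lambda>t. f t - g t) \<in> V"
  using add_mem[of f "\<lambda>t. -1 * g t"] cmult_mem[of g "-1"] by simp

lemma sum_mem: "finite I \<Longrightarrow> (\<And>i. i \<in> I \<Longrightarrow> f i \<in> V) \<Longrightarrow> (\<lambda>t. \<Sum>i\<in>I. f i t) \<in> V"
  by (induction I rule: finite_induct) (auto intro: const_mem add_mem)

lemma mean_diff: "f \<in> V \<Longrightarrow> g \<in> V \<Longrightarrow> M (\<lambda>t. f t - g t) = M f - M g"
  using mean_add[of f "\<lambda>t. -1 * g t"] cmult_mem[of g "-1"] mean_cmult[of g "-1"] by simp

lemma mean_const: "M (\<lambda>t. c) = c"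
  using mean_cmult[OF const_mem[of 1], of c] mean_one by simp

lemma mean_sum: "finite I \<Longrightarrow> (\<And>i. i \<in> I \<Longrightarrow> f i \<in> V) \<Longrightarrow> M (\<lambda>t. \<Sum>i\<in>I. f i t) = (\<Sum>i\<in>I. M (f i))"
  by (induction I rule: finite_induct) (auto simp: mean_const mean_add sum_mem)

lemma mean_Re_nonneg:
  assumes f: "f \<in> V" and "\<And>t. Re (f t) \<ge> 0"
  shows "Re (M f) \<ge> 0"
proof -
  have "0 \<le> Re (M (\<lambda>t. f t + cnj (f t)))"
    using assms by (intro mean_nonneg add_mem cnj_mem) (auto simp: complex_is_Real_iff)
  also have "\<dots> = 2 * Re (M f)" using f by (simp add: mean_add mean_cnj cnj_mem)
  finally show ?thesis by simp
qed

lemma mean_mono: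
  assumes "f \<in> V" "g \<in> V" "\<And>t. Re (f t) \<le> Re (g t)"
  shows "Re (M f) \<le> Re (M g)"
  using mean_Re_nonneg[OF diff_mem[OF assms(2,1)]] assms by (simp add: mean_diff)

lemma norm_mean_le:
  assumes f: "f \<in> V" and g: "g \<in> V" and le: "\<And>t. norm (f t) \<le> Re (g t)"
  shows "norm (M f) \<le> Re (M g)"
proof (cases "M f = 0")
  case True
  then show ?thesis using mean_Re_nonneg[OF g] order_trans[OF norm_ge_zero le] by simp
next
  case False
  define c where "c = cnj (M f) / of_real (norm (M f))"
  have c: "norm c = 1" using False by (simp add: c_def norm_divide)
  have "c * M f = of_real (norm (M f))"
    using False by (simp add: c_def mult.commute[of "cnj _"] power2_eq_square flip: complex_norm_square)
  then have "norm (M f) = Re (M (\<lambda>t. c * f t))" using mean_cmult[OF f, of c] by simp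
  also have "\<dots> \<le> Re (M g)"
  proof (rule mean_mono[OF cmult_mem[OF f] g])
    fix t show "Re (c * f t) \<le> Re (g t)"
      using complex_Re_le_cmod[of "c * f t"] le[of t] c by (simp add: norm_mult)
  qed
  finally show ?thesis .
qed

lemma ip_mem: "f \<in> V \<Longrightarrow> g \<in> V \<Longrightarrow> (\<lambda>t. f t * cnj (g t)) \<in> V"
  by (intro mult_mem cnj_mem)

lemma ip_commute: "f \<in> V \<Longrightarrow> g \<in> V \<Longrightarrow> ip g f = cnj (ip f g)"
  using mean_cnj[OF ip_mem[of f g]] by (simp add: ip_def mult.commute)

lemma ip_diff_left: "f \<in> V \<Longrightarrow> g \<in> V \<Longrightarrow> h \<in> V \<Longrightarrow> ip (\<lambda>t. f t - g t) h = ip f h - ip g h"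
  by (simp add: ip_def left_diff_distrib mean_diff ip_mem)

lemma ip_diff_right: "f \<in> V \<Longrightarrow> g \<in> V \<Longrightarrow> h \<in> V \<Longrightarrow> ip h (\<lambda>t. f t - g t) = ip h f - ip h g"
  by (simp add: ip_def right_diff_distrib mean_diff ip_mem)

lemma ip_cmult_left: "f \<in> V \<Longrightarrow> g \<in> V \<Longrightarrow> ip (\<lambda>t. c * f t) g = c * ip f g"
  by (simp add: ip_def mult.assoc mean_cmult ip_mem)

lemma ip_cmult_right: "f \<in> V \<Longrightarrow> g \<in> V \<Longrightarrow> ip f (\<lambda>t. c * g t) = cnj c * ip f g"
  by (simp add: ip_def mult.left_commute mean_cmult ip_mem)

lemma ip_sum_left:
  "finite I \<Longrightarrow> (\<And>i. i \<in> I \<Longrightarrow> f i \<in> V) \<Longrightarrow> g \<in> V \<Longrightarrow> ip (\<lambda>t. \<Sum>i\<in>I. f i t) g = (\<Sum>i\<in>I. ip (f i) g)"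
  by (simp add: ip_def sum_distrib_right mean_sum ip_mem)

lemma ip_sum_right:
  "finite I \<Longrightarrow> (\<And>i. i \<in> I \<Longrightarrow> f i \<in> V) \<Longrightarrow> g \<in> V \<Longrightarrow> ip g (\<lambda>t. \<Sum>i\<in>I. f i t) = (\<Sum>i\<in>I. ip g (f i))"
  by (simp add: ip_def sum_distrib_left mean_sum ip_mem)

lemma ip_self_nonneg: "f \<in> V \<Longrightarrow> Re (ip f f) \<ge> 0"
  unfolding ip_def by (intro mean_Re_nonneg ip_mem) auto

lemma ip_self: "f \<in> V \<Longrightarrow> ip f f = of_real ((nrm f)\<^sup>2)"
  using ip_commute[of f f] ip_self_nonneg[of f] by (simp add: nrm_def complex_eq_iff)

lemma nrm_nonneg [simp]: "f \<in> V \<Longrightarrow> nrm f \<ge> 0"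
  by (simp add: nrm_def ip_self_nonneg)

lemma nrm_sq: "f \<in> V \<Longrightarrow> (nrm f)\<^sup>2 = Re (ip f f)"
  by (simp add: ip_self)

lemma nrm_zero [simp]: "nrm (\<lambda>t. 0) = 0"
  by (simp add: nrm_def ip_def mean_const)

lemma nrm_diff_sq:
  assumes "f \<in> V" "g \<in> V"
  shows "(nrm (\<lambda>t. f t - g t))\<^sup>2 = (nrm f)\<^sup>2 + (nrm g)\<^sup>2 - 2 * Re (ip f g)"
  using assms ip_commute[OF assms]
  by (simp add: nrm_sq diff_mem ip_diff_left ip_diff_right)

lemma cauchy_schwarz:
  assumes f: "f \<in> V" and g: "g \<in> V"
  shows "norm (ip f g) \<le> nrm f * nrm g"
proof -
  \<comment> \<open>\<open>c\<close> is a phase, and \<open>r\<close> runs over the reals: the discriminant of \<open>r \<mapsto> \<parallel>f - r c g\<parallel>\<^sup>2\<close> is nonpositive\<close>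
  define c where "c = (if ip f g = 0 then 1 else ip f g / of_real (norm (ip f g)))"
  have c: "norm c = 1" by (auto simp: c_def norm_divide)
  have cg: "(\<lambda>t. c * g t) \<in> V" using g by (rule cmult_mem)
  have ipc: "ip f (\<lambda>t. c * g t) = of_real (norm (ip f g))"
  proof (cases "ip f g = 0")
    case False
    then show ?thesis
      unfolding ip_cmult_right[OF f g]
      by (simp add: c_def mult.commute[of "cnj _"] power2_eq_square flip: complex_norm_square)
  qed (simp add: ip_cmult_right f g)
  have "ip (\<lambda>t. c * g t) (\<lambda>t. c * g t) = (c * cnj c) * ip g g"
    using g cg by (simp add: ip_cmult_left ip_cmult_right)
  then have "ip (\<lambda>t. c * g t) (\<lambda>t. c * g t) = ip g g"
    using c by (simp flip: complex_norm_square)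
  then have nc: "nrm (\<lambda>t. c * g t) = nrm g" by (simp add: nrm_def)
  have quad: "0 \<le> (nrm f)\<^sup>2 + r\<^sup>2 * (nrm g)\<^sup>2 - 2 * r * norm (ip f g)" for r :: real
  proof -
    have rg: "(\<lambda>t. of_real r * (c * g t)) \<in> V" by (intro cmult_mem g)
    have "(nrm (\<lambda>t. of_real r * (c * g t)))\<^sup>2 = r\<^sup>2 * (nrm (\<lambda>t. c * g t))\<^sup>2"
      using rg cg by (simp only: nrm_sq ip_cmult_left ip_cmult_right) (simp add: power2_eq_square)
    moreover have "Re (ip f (\<lambda>t. of_real r * (c * g t))) = r * norm (ip f g)"
      using ipc by (simp only: ip_cmult_right[OF f cg]) simp
    ultimately show ?thesis
      using nrm_diff_sq[OF f rg] nc zero_le_power2[of "nrm (\<lambda>t. f t - of_real r * (c * g t))"]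
      by simp
  qed
  show ?thesis
  proof (cases "nrm g = 0")
    case True
    have "norm (ip f g) = 0"
    proof (rule ccontr)
      assume n: "norm (ip f g) \<noteq> 0"
      then show False using quad[of "((nrm f)\<^sup>2 + 1) / (2 * norm (ip f g))"] True by simp
    qed
    then show ?thesis using True by simp
  next
    case False
    then have g0: "nrm g > 0" using nrm_nonneg[OF g] by linarith
    have "0 \<le> (nrm f)\<^sup>2 - (norm (ip f g))\<^sup>2 / (nrm g)\<^sup>2"
      using quad[of "norm (ip f g) / (nrm g)\<^sup>2"] g0 by (simp add: field_simps power2_eq_square)
    then have "(norm (ip f g))\<^sup>2 \<le> (nrm f * nrm g)\<^sup>2"
      using g0 by (simp add: field_simps power_mult_distrib)
    then show ?thesis using f g by (intro power2_le_imp_le[of "norm (ip f g)"]) auto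
  qed
qed

lemma ip_diff_le:
  assumes f: "f \<in> V" "f' \<in> V" and g: "g \<in> V" "g' \<in> V"
  shows "norm (ip f g - ip f' g') \<le> nrm (\<lambda>t. f t - f' t) * nrm g + nrm f' * nrm (\<lambda>t. g t - g' t)"
proof -
  have eq: "ip f g - ip f' g' = ip (\<lambda>t. f t - f' t) g + ip f' (\<lambda>t. g t - g' t)"
    using assms by (simp add: ip_diff_left ip_diff_right)
  show ?thesis
    unfolding eq
    using norm_triangle_ineq[of "ip (\<lambda>t. f t - f' t) g" "ip f' (\<lambda>t. g t - g' t)"]
      cauchy_schwarz[OF diff_mem[OF f] g(1)] cauchy_schwarz[OF f(2) diff_mem[OF g]] by linarith
qed

lemma nrm_diff_triangle:
  assumes "f \<in> V" "g \<in> V"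
  shows "nrm (\<lambda>t. f t - g t) \<le> nrm f + nrm g"
proof (rule power2_le_imp_le)
  have "- Re (ip f g) \<le> nrm f * nrm g"
    using cauchy_schwarz[OF assms] abs_Re_le_cmod[of "ip f g"] by linarith
  then show "(nrm (\<lambda>t. f t - g t))\<^sup>2 \<le> (nrm f + nrm g)\<^sup>2"
    by (simp add: nrm_diff_sq assms power2_sum)
qed (use assms in auto)

lemma nrm_triangle3:
  assumes "f \<in> V" "g \<in> V" "h \<in> V"
  shows "nrm (\<lambda>t. f t - h t) \<le> nrm (\<lambda>t. f t - g t) + nrm (\<lambda>t. h t - g t)"
  using nrm_diff_triangle[OF diff_mem[OF assms(1,2)] diff_mem[OF assms(3,2)]] by simp

lemma nrm_diff_diff_le:
  assumes "f \<in> V" "f' \<in> V" "g \<in> V" "g' \<in> V"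
  shows "nrm (\<lambda>t. f t - g t - (f' t - g' t)) \<le> nrm (\<lambda>t. f t - f' t) + nrm (\<lambda>t. g t - g' t)"
proof -
  have "(\<lambda>t. f t - g t - (f' t - g' t)) = (\<lambda>t. (f t - f' t) - (g t - g' t))" by auto
  then show ?thesis using nrm_diff_triangle[OF diff_mem[OF assms(1,2)] diff_mem[OF assms(3,4)]] by simp
qed

lemma nrm_minus_commute: "nrm (\<lambda>t. f t - g t) = nrm (\<lambda>t. g t - f t)"
proof -
  have "(f t - g t) * cnj (f t - g t) = (g t - f t) * cnj (g t - f t)" for t
    by (simp add: algebra_simps)
  then show ?thesis unfolding nrm_def ip_def by presburger
qed

lemma nrm_triangle2:
  assumes "f \<in> V" "g \<in> V"
  shows "nrm f \<le> nrm g + nrm (\<lambda>t. f t - g t)"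
  using nrm_triangle3[OF assms const_mem[of 0]] nrm_minus_commute[of "\<lambda>t. 0" g] by simp

lemma nrm_reverse_triangle:
  assumes "f \<in> V" "g \<in> V"
  shows "\<bar>nrm f - nrm g\<bar> \<le> nrm (\<lambda>t. f t - g t)"
  using nrm_triangle2[OF assms] nrm_triangle2[OF assms(2,1)] nrm_minus_commute[of f g] by linarith

lemma nrm_le_bound:
  assumes f: "f \<in> V" and le: "\<And>t. norm (f t) \<le> c" and "c \<ge> 0"
  shows "nrm f \<le> c"
proof -
  have "norm (ip f f) \<le> Re (M (\<lambda>t. of_real (c\<^sup>2)))"
    unfolding ip_def
  proof (rule norm_mean_le[OF ip_mem[OF f f] const_mem])
    fix t
    have "norm (f t) * norm (f t) \<le> c * c" using le[of t] assms(3) by (intro mult_mono) auto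
    then show "norm (f t * cnj (f t)) \<le> Re (complex_of_real (c\<^sup>2))"
      by (simp add: norm_mult power2_eq_square)
  qed
  then have "(nrm f)\<^sup>2 \<le> c\<^sup>2" using f by (simp add: mean_const ip_self norm_power)
  then show ?thesis using assms(3) by (rule power2_le_imp_le)
qed

lemma ip_orthonormal_sum:
  assumes I: "finite I" and e: "\<And>i. i \<in> I \<Longrightarrow> e i \<in> V"
    and on: "\<And>i j. i \<in> I \<Longrightarrow> j \<in> I \<Longrightarrow> ip (e i) (e j) = (if i = j then 1 else 0)"
    and j: "j \<in> I"
  shows "ip (\<lambda>t. \<Sum>i\<in>I. c i * e i t) (e j) = c j"
proof -
  have "ip (\<lambda>t. \<Sum>i\<in>I. c i * e i t) (e j) = (\<Sum>i\<in>I. c i * ip (e i) (e j))"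
    using I e j by (simp add: ip_sum_left cmult_mem ip_cmult_left)
  also have "\<dots> = (\<Sum>i\<in>I. if i = j then c i else 0)"
    using j on by (intro sum.cong) auto
  finally show ?thesis using I j by simp
qed

lemma nrm_orthonormal_sum:
  assumes I: "finite I" and e: "\<And>i. i \<in> I \<Longrightarrow> e i \<in> V"
    and on: "\<And>i j. i \<in> I \<Longrightarrow> j \<in> I \<Longrightarrow> ip (e i) (e j) = (if i = j then 1 else 0)"
  shows "(nrm (\<lambda>t. \<Sum>i\<in>I. c i * e i t))\<^sup>2 = (\<Sum>i\<in>I. (norm (c i))\<^sup>2)"
proof -
  have p: "(\<lambda>t. \<Sum>i\<in>I. c i * e i t) \<in> V" using I e by (intro sum_mem cmult_mem)
  have "ip (\<lambda>t. \<Sum>i\<in>I. c i * e i t) (\<lambda>t. \<Sum>i\<in>I. c i * e i t)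
      = (\<Sum>j\<in>I. cnj (c j) * ip (\<lambda>t. \<Sum>i\<in>I. c i * e i t) (e j))"
    using I e p by (subst ip_sum_right) (auto simp: cmult_mem ip_cmult_right)
  also have "\<dots> = (\<Sum>j\<in>I. of_real ((norm (c j))\<^sup>2))"
    using ip_orthonormal_sum[OF I e on]
    by (intro sum.cong refl) (simp only: complex_norm_square mult.commute)
  finally show ?thesis by (simp add: nrm_sq[OF p])
qed

lemma bessel:
  assumes I: "finite I" and e: "\<And>i. i \<in> I \<Longrightarrow> e i \<in> V"
    and on: "\<And>i j. i \<in> I \<Longrightarrow> j \<in> I \<Longrightarrow> ip (e i) (e j) = (if i = j then 1 else 0)"
    and f: "f \<in> V"
  shows "(\<Sum>i\<in>I. (norm (ip f (e i)))\<^sup>2) \<le> (nrm f)\<^sup>2"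
proof -
  define p where "p = (\<lambda>t. \<Sum>i\<in>I. ip f (e i) * e i t)"
  have p: "p \<in> V" unfolding p_def using I e by (intro sum_mem cmult_mem)
  have "ip f p = (\<Sum>i\<in>I. cnj (ip f (e i)) * ip f (e i))"
    unfolding p_def using I e f by (simp add: ip_sum_right cmult_mem ip_cmult_right)
  also have "\<dots> = (\<Sum>i\<in>I. of_real ((norm (ip f (e i)))\<^sup>2))"
    by (intro sum.cong refl) (simp only: complex_norm_square mult.commute)
  finally have "Re (ip f p) = (\<Sum>i\<in>I. (norm (ip f (e i)))\<^sup>2)" by simp
  then show ?thesis
    using nrm_diff_sq[OF f p] nrm_orthonormal_sum[OF I e on, of "\<lambda>i. ip f (e i)"]
      zero_le_power2[of "nrm (\<lambda>t. f t - p t)"]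
    by (simp add: p_def)
qed

end

section \<open>Existence of means on the integers and on the line\<close>

lemma AP_Z_bounded:
  assumes "a \<in> AP_Z"
  shows "\<exists>B\<ge>0. \<forall>n. norm (a n) \<le> B"
  using bohr_ap_bounded[of of_int a] assms by (simp add: AP_Z_iff_bohr_ap)

lemma AP_R_bounded:
  assumes "f \<in> AP_R"
  shows "\<exists>B\<ge>0. \<forall>t. norm (f t) \<le> B"
  using bohr_ap_bounded[of "\<lambda>x. x" f] assms by (simp add: AP_R_iff_bohr_ap)

text \<open>
  By almost periodicity, block sums of equal length nearly agree wherever the blocks start. Averages
  over different lengths \<open>S\<close> and \<open>T\<close> are compared through the double sum over \<open>S\<close> starting points
  and \<open>T\<close> steps, which is symmetric in \<open>S\<close> and \<open>T\<close>.
\<close>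

lemma AP_Z_block_sums:
  assumes a: "a \<in> AP_Z" and \<epsilon>: "\<epsilon> > 0"
  obtains K where "K \<ge> 0"
    "\<And>x y (S::nat) (T::nat). S > 0 \<Longrightarrow> T > 0 \<Longrightarrow>
      norm ((\<Sum>j<T. a (x + int j)) / of_nat T - (\<Sum>j<S. a (y + int j)) / of_nat S)
        \<le> \<epsilon> + K * (1 / real T + 1 / real S)"
proof -
  obtain B where B: "\<And>n. norm (a n) \<le> B" "B \<ge> 0" using AP_Z_bounded[OF a] by blast
  define e where "e = \<epsilon> / 3"
  have e: "e > 0" using \<epsilon> by (simp add: e_def)
  obtain N :: nat where N: "\<And>m. \<exists>p\<in>{m..<m + int N}. \<forall>n. norm (a (n + p) - a n) \<le> e"
    using a[unfolded AP_Z_def mem_Collect_eq, rule_format, OF e] by auto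
  define I where "I x T = (\<Sum>j<T. a (x + int j))" for x and T :: nat
  define K where "K = 2 * real N * B"
  have step: "norm (I (x + 1) T - I x T) \<le> 2 * B" for x T
  proof -
    have "a x + I (x + 1) T = I x T + a (x + int T)"
      using sum.lessThan_Suc_shift[of "\<lambda>j. a (x + int j)" T]
      by (simp add: I_def algebra_simps)
    then have "I (x + 1) T - I x T = a (x + int T) - a x" by (simp add: algebra_simps)
    then show ?thesis
      using norm_triangle_ineq4[of "a (x + int T)" "a x"] B(1)[of x] B(1)[of "x + int T"] by simp
  qed
  have shift: "norm (I (x + int d) T - I x T) \<le> 2 * real d * B" for x T d
  proof (induction d)
    case (Suc d)
    then show ?case
      using step[of "x + int d" T]
        norm_triangle_ineq[of "I (x + int d + 1) T - I (x + int d) T" "I (x + int d) T - I x T"]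
      by (simp add: algebra_simps)
  qed simp
  have vary: "norm (I x T - I y T) \<le> e * real T + K" for x y T
  proof -
    obtain p where p: "p \<in> {x - y..<x - y + int N}" "\<And>n. norm (a (n + p) - a n) \<le> e"
      using N[of "x - y"] by blast
    have "norm (I (y + p) T - I y T) = norm (\<Sum>j<T. a (y + int j + p) - a (y + int j))"
      by (simp add: I_def sum_subtractf algebra_simps)
    also have "\<dots> \<le> (\<Sum>j<T. e)" by (intro sum_norm_le p(2))
    finally have 1: "norm (I (y + p) T - I y T) \<le> e * real T" by (simp add: mult.commute)
    have "norm (I (x + int (nat (y + p - x))) T - I x T) \<le> 2 * real (nat (y + p - x)) * B"
      by (rule shift)
    also have "\<dots> \<le> K" unfolding K_def using p(1) B(2) by (intro mult_right_mono mult_left_mono) auto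
    finally have 2: "norm (I (y + p) T - I x T) \<le> K" using p(1) by simp
    show ?thesis using 1 2 norm_triangle_ineq4[of "I (y + p) T - I y T" "I (y + p) T - I x T"] by simp
  qed
  \<comment> \<open>summing blocks of length \<open>T\<close> over \<open>S\<close> starting points, and vice versa, gives the same double sum\<close>
  have double: "norm ((\<Sum>i<S. I (x + int i) T) - of_nat S * I x T) \<le> real S * (e * real T + K)" for x S T
  proof -
    have "(\<Sum>i<S. I (x + int i) T) - of_nat S * I x T = (\<Sum>i<S. I (x + int i) T - I x T)"
      by (simp add: sum_subtractf)
    also have "norm \<dots> \<le> (\<Sum>i<S. e * real T + K)" by (intro sum_norm_le vary)
    finally show ?thesis by simp
  qed
  have swap: "(\<Sum>i<S. I (x + int i) T) = (\<Sum>i<T. I (x + int i) S)" for x S T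
    unfolding I_def by (subst sum.swap) (simp add: algebra_simps)
  have main: "norm (I x T / of_nat T - I y S / of_nat S) \<le> \<epsilon> + 2 * K * (1 / real T + 1 / real S)"
    if "S > 0" "T > 0" for x y S T
  proof -
    have "norm (of_nat S * I x T - of_nat T * I x S) \<le> real S * (e * real T + K) + real T * (e * real S + K)"
      using double[of x S T] double[of x T S] swap[of x S T]
        norm_triangle_ineq4[of "(\<Sum>i<S. I (x + int i) T) - of_nat T * I x S" "(\<Sum>i<S. I (x + int i) T) - of_nat S * I x T"]
      by simp
    moreover have "norm (of_nat T * (I x S - I y S)) \<le> real T * (e * real S + K)"
      using vary[of x S y] by (simp add: norm_mult mult_left_mono)
    ultimately have "norm (of_nat S * I x T - of_nat T * I y S)
        \<le> real S * (e * real T + K) + real T * (e * real S + K) + real T * (e * real S + K)"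
      using norm_triangle_ineq[of "of_nat S * I x T - of_nat T * I x S" "of_nat T * (I x S - I y S)"]
      by (simp add: algebra_simps)
    also have "\<dots> \<le> real S * real T * (\<epsilon> + 2 * K * (1 / real T + 1 / real S))"
      using that B(2) by (simp add: e_def K_def field_simps)
    finally have "norm (of_nat S * I x T - of_nat T * I y S) / (real S * real T)
        \<le> \<epsilon> + 2 * K * (1 / real T + 1 / real S)"
      using that by (subst pos_divide_le_eq) (simp_all only: mult.commute mult_pos_pos of_nat_0_less_iff)
    moreover have "I x T / of_nat T - I y S / of_nat S = (of_nat S * I x T - of_nat T * I y S) / (of_nat S * of_nat T)"
      using that by (simp add: field_simps)
    ultimately show ?thesis by (simp add: norm_divide norm_mult)
  qed
  show ?thesis
    using main B(2) by (intro that[of "2 * K"]) (auto simp: I_def K_def)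
qed

definition mean_Z :: "(int \<Rightarrow> complex) \<Rightarrow> complex" where
  "mean_Z a = lim (\<lambda>p::nat. (\<Sum>n=-int p..int p. a n) / of_nat (2 * p))"

lemma symmetric_sum_eq_block: "(\<Sum>n=-int p..int p. a n) = (\<Sum>j<2 * p + 1. a (- int p + int j))"
  by (rule sum.reindex_bij_witness[where i = "\<lambda>j. - int p + int j" and j = "\<lambda>n. nat (n + int p)"]) auto

lemma mean_Z_tendsto:
  assumes a: "a \<in> AP_Z"
  shows "(\<lambda>p::nat. (\<Sum>n=-int p..int p. a n) / of_nat (2 * p)) \<longlonglongrightarrow> mean_Z a"
proof -
  define u where "u p = (\<Sum>n=-int p..int p. a n) / of_nat (2 * p + 1)" for p :: nat
  have "Cauchy u"
  proof (rule metric_CauchyI)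
    fix \<epsilon> :: real assume \<epsilon>: "\<epsilon> > 0"
    obtain K where K: "K \<ge> 0" "\<And>x y (S::nat) (T::nat). S > 0 \<Longrightarrow> T > 0 \<Longrightarrow>
      norm ((\<Sum>j<T. a (x + int j)) / of_nat T - (\<Sum>j<S. a (y + int j)) / of_nat S)
        \<le> \<epsilon> / 2 + K * (1 / real T + 1 / real S)"
      using AP_Z_block_sums[OF a, of "\<epsilon> / 2"] \<epsilon> by auto
    obtain P :: nat where P: "real P > 2 * K / \<epsilon>" using reals_Archimedean2 by blast
    have P0: "real P * \<epsilon> > 2 * K" using P \<epsilon> by (simp add: field_simps)
    have small: "K * (1 / real (2 * p + 1)) < \<epsilon> / 4" if "p \<ge> P" for p
    proof -
      have "4 * K < \<epsilon> * real (2 * P + 1)" using P0 \<epsilon> by (simp add: algebra_simps)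
      also have "\<dots> \<le> \<epsilon> * real (2 * p + 1)" using that \<epsilon> by (intro mult_left_mono) auto
      finally show ?thesis by (simp add: field_simps)
    qed
    have "dist (u m) (u n) < \<epsilon>" if "m \<ge> P" "n \<ge> P" for m n
    proof -
      have "dist (u m) (u n) \<le> \<epsilon> / 2 + K * (1 / real (2 * m + 1) + 1 / real (2 * n + 1))"
        unfolding u_def dist_norm symmetric_sum_eq_block by (rule K(2)) auto
      also have "\<dots> = \<epsilon> / 2 + K * (1 / real (2 * m + 1)) + K * (1 / real (2 * n + 1))"
        by (simp only: distrib_left add.assoc)
      also have "\<dots> < \<epsilon>" using small[OF that(1)] small[OF that(2)] by linarith
      finally show ?thesis .
    qed
    then show "\<exists>M. \<forall>m\<ge>M. \<forall>n\<ge>M. dist (u m) (u n) < \<epsilon>" by blast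
  qed
  then obtain m where m: "u \<longlonglongrightarrow> m" using Cauchy_convergent convergent_def by blast
  have "(\<lambda>p. 1 + inverse (of_nat p :: complex) / 2) \<longlonglongrightarrow> 1 + 0 / 2"
    by (intro tendsto_intros lim_inverse_n) auto
  with m have "(\<lambda>p. u p * (1 + inverse (of_nat p :: complex) / 2)) \<longlonglongrightarrow> m * (1 + 0 / 2)"
    by (intro tendsto_mult)
  moreover have "\<forall>\<^sub>F p in sequentially. u p * (1 + inverse (of_nat p :: complex) / 2)
      = (\<Sum>n=-int p..int p. a n) / of_nat (2 * p)"
    using eventually_gt_at_top[of 0]
  proof eventually_elim
    case (elim p)
    have "of_nat (2 * p + 1) \<noteq> (0::complex)" by (simp only: of_nat_eq_0_iff)
    moreover have "1 + inverse (of_nat p :: complex) / 2 = of_nat (2 * p + 1) / of_nat (2 * p)"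
      using elim by (simp add: field_simps)
    ultimately show ?case unfolding u_def by simp
  qed
  ultimately have "(\<lambda>p::nat. (\<Sum>n=-int p..int p. a n) / of_nat (2 * p)) \<longlonglongrightarrow> m"
    by (simp add: filterlim_cong)
  then show ?thesis unfolding mean_Z_def by (simp add: limI)
qed

lemma mean_Z_eqI:
  assumes "(\<lambda>p::nat. (\<Sum>n=-int p..int p. a n) / of_nat (2 * p)) \<longlonglongrightarrow> m"
  shows "mean_Z a = m"
  using assms unfolding mean_Z_def by (rule limI)

definition mean_R :: "(real \<Rightarrow> complex) \<Rightarrow> complex" where
  "mean_R f = Lim at_top (\<lambda>T::real. integral {-T..T} f / of_real (2 * T))"

lemma mean_R_eqI:
  assumes "((\<lambda>T::real. integral {-T..T} f / of_real (2 * T)) \<longlongrightarrow> m) at_top"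
  shows "mean_R f = m"
  using assms unfolding mean_R_def by (intro tendsto_Lim) auto

lemma norm_integral_diff_le:
  fixes f :: "real \<Rightarrow> complex"
  assumes f: "continuous_on UNIV f" and B: "\<And>t. norm (f t) \<le> B" and "a \<le> b" "c \<le> d"
  shows "norm (integral {a..b} f - integral {c..d} f) \<le> B * (\<bar>b - d\<bar> + \<bar>a - c\<bar>)"
proof -
  define G where "G x = (if x \<ge> 0 then integral {0..x} f else - integral {x..0} f)" for x
  have int: "f integrable_on {x..y}" for x y
    by (rule integrable_continuous_real[OF continuous_on_subset[OF f]]) auto
  have G: "integral {x..y} f = G y - G x" if "x \<le> y" for x y
  proof -
    consider "0 \<le> x" | "x < 0" "0 \<le> y" | "y < 0" by linarith
    then show ?thesis
    proof cases
      case 1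
      then show ?thesis using Henstock_Kurzweil_Integration.integral_combine[OF _ that int, of 0] that
        by (simp add: G_def algebra_simps)
    next
      case 2
      then show ?thesis using Henstock_Kurzweil_Integration.integral_combine[OF _ _ int, of x 0 y]
        by (simp add: G_def algebra_simps)
    next
      case 3
      then show ?thesis using Henstock_Kurzweil_Integration.integral_combine[OF that _ int, of 0] that
        by (simp add: G_def algebra_simps)
    qed
  qed
  have lip: "norm (G y - G x) \<le> B * \<bar>y - x\<bar>" for x y
  proof -
    have *: "norm (G y - G x) \<le> B * (y - x)" if "x \<le> y" for x y
      using integral_bound[OF that continuous_on_subset[OF f], of B] B G[OF that] by auto
    show ?thesis using *[of x y] *[of y x] by (cases "x \<le> y") (auto simp: norm_minus_commute)
  qed
  have "integral {a..b} f - integral {c..d} f = (G b - G d) - (G a - G c)"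
    using G[OF assms(3)] G[OF assms(4)] by simp
  also have "norm \<dots> \<le> norm (G b - G d) + norm (G a - G c)" by (rule norm_triangle_ineq4)
  also have "\<dots> \<le> B * \<bar>b - d\<bar> + B * \<bar>a - c\<bar>" using lip by (intro add_mono)
  finally show ?thesis by (simp add: distrib_left)
qed

lemma AP_R_continuous: "f \<in> AP_R \<Longrightarrow> continuous_on A f"
  using continuous_on_subset by (auto simp: AP_R_def)

lemma AP_R_integrable: "f \<in> AP_R \<Longrightarrow> f integrable_on {a..b}"
  by (rule integrable_continuous_real[OF AP_R_continuous])

text \<open>
  This reduces means on the line to means on the integers.
\<close>

lemma unit_integrals_AP_Z:
  assumes f: "f \<in> AP_R"
  shows "(\<lambda>n::int. integral {of_int n..of_int n + 1} f) \<in> AP_Z"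
  unfolding AP_Z_iff_bohr_ap bohr_ap_def
proof (intro allI impI)
  fix \<epsilon> :: real assume \<epsilon>: "\<epsilon> > 0"
  have ap: "bohr_ap (\<lambda>x. x) f" using f by (simp add: AP_R_iff_bohr_ap)
  obtain \<Lambda> \<delta> where L: "finite \<Lambda>" "\<delta> > 0" "\<And>p t. p \<in> bohr_set \<Lambda> \<delta> \<Longrightarrow> norm (f (t + p) - f t) \<le> \<epsilon>"
    using bohr_apE[OF ap \<epsilon>] by blast
  have "norm (integral {real_of_int (n + p)..of_int (n + p) + 1} f - integral {of_int n..of_int n + 1} f) \<le> \<epsilon>"
    if p: "real_of_int p \<in> bohr_set \<Lambda> \<delta>" for n p
  proof -
    have c: "continuous_on A (\<lambda>t. f (t + of_int p))" for A
      using f by (intro continuous_on_compose2[OF AP_R_continuous[of f UNIV]] continuous_intros) auto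
    have "integral {real_of_int (n + p)..of_int (n + p) + 1} f = integral {of_int n..of_int n + 1} (\<lambda>t. f (t + of_int p))"
      using integral_shift[OF AP_R_continuous[OF f], of "of_int n" "of_int n + 1" "of_int p"]
      by (simp add: o_def add_ac)
    then have "integral {real_of_int (n + p)..of_int (n + p) + 1} f - integral {of_int n..of_int n + 1} f
        = integral {of_int n..of_int n + 1} (\<lambda>t. f (t + of_int p) - f t)"
      by (simp add: integral_diff integrable_continuous_real c AP_R_integrable f)
    also have "norm \<dots> \<le> \<epsilon> * (of_int n + 1 - of_int n)"
      using L(3)[OF p] by (intro integral_bound continuous_intros c AP_R_continuous f) auto
    finally show ?thesis by simp
  qed
  then show "\<exists>\<Lambda> \<delta>. finite \<Lambda> \<and> 0 < \<delta> \<and> (\<forall>p. real_of_int p \<in> bohr_set \<Lambda> \<delta> \<longrightarrow>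
      (\<forall>t. norm (integral {real_of_int (t + p)..of_int (t + p) + 1} f - integral {of_int t..of_int t + 1} f) \<le> \<epsilon>))"
    using L by blast
qed

lemma sum_unit_integrals:
  assumes f: "f \<in> AP_R"
  shows "(\<Sum>n=-int p..int p. integral {of_int n..of_int n + 1} f) = integral {- real p..real p + 1} f"
proof (induction p)
  case (Suc p)
  have eq: "{- int (Suc p)..int (Suc p)} = insert (- int p - 1) (insert (int p + 1) {- int p..int p})" by auto
  have 1: "integral {- real p - 1..- real p} f + integral {- real p..real p + 1} f = integral {- real p - 1..real p + 1} f"
    by (intro Henstock_Kurzweil_Integration.integral_combine AP_R_integrable f) auto
  have 2: "integral {- real p - 1..real p + 1} f + integral {real p + 1..real p + 2} f = integral {- real p - 1..real p + 2} f"
    by (intro Henstock_Kurzweil_Integration.integral_combine AP_R_integrable f) auto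
  have ends: "- real (Suc p) = - real p - 1" "real (Suc p) + 1 = real p + 2" by simp_all
  have "(\<Sum>n=-int (Suc p)..int (Suc p). integral {of_int n..of_int n + 1} f)
      = integral {- real p - 1..- real p} f + (integral {real p + 1..real p + 2} f + integral {- real p..real p + 1} f)"
    unfolding eq using Suc.IH by (simp add: add.commute[of 1] add.commute[of 2])
  also have "\<dots> = integral {- real p - 1..real p + 2} f"
    unfolding 2[symmetric] 1[symmetric] by (simp only: add_ac)
  finally show ?case unfolding ends .
qed simp

lemma mean_R_tendsto:
  assumes f: "f \<in> AP_R"
  shows "((\<lambda>T::real. integral {-T..T} f / of_real (2 * T)) \<longlongrightarrow> mean_R f) at_top"
proof -
  let ?J = "\<lambda>T. integral {-T..T} f / complex_of_real (2 * T)"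
  obtain B where B: "\<And>t. norm (f t) \<le> B" "B \<ge> 0" using AP_R_bounded[OF f] by blast
  define v where "v p = integral {- real p..real p + 1} f / of_nat (2 * p)" for p
  obtain m where m: "v \<longlonglongrightarrow> m"
    using mean_Z_tendsto[OF unit_integrals_AP_Z[OF f]] unfolding sum_unit_integrals[OF f] v_def by blast
  let ?V = "\<lambda>T. v (nat \<lfloor>T\<rfloor>) * of_real (real (nat \<lfloor>T\<rfloor>) / T)"
  have fl: "filterlim (\<lambda>T::real. nat \<lfloor>T\<rfloor>) sequentially at_top"
    by (rule filterlim_compose[OF filterlim_nat_sequentially filterlim_floor_sequentially])
  have ratio: "((\<lambda>T. real (nat \<lfloor>T\<rfloor>) / T) \<longlongrightarrow> 1) at_top"
  proof (rule tendsto_sandwich)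
    show "\<forall>\<^sub>F T::real in at_top. 1 - 1 / T \<le> real (nat \<lfloor>T\<rfloor>) / T"
      using eventually_gt_at_top[of 1]
    proof eventually_elim
      case (elim T)
      then have "(T - 1) / T \<le> real (nat \<lfloor>T\<rfloor>) / T" by (intro divide_right_mono) linarith+
      then show ?case using elim by (simp add: diff_divide_distrib)
    qed
    show "\<forall>\<^sub>F T::real in at_top. real (nat \<lfloor>T\<rfloor>) / T \<le> 1"
      using eventually_gt_at_top[of 1] by eventually_elim simp
    have "((\<lambda>T::real. 1 - 1 / T) \<longlongrightarrow> 1 - 0) at_top"
      by (intro tendsto_intros tendsto_divide_0[OF tendsto_const] filterlim_at_top_imp_at_infinity filterlim_ident)
    then show "((\<lambda>T::real. 1 - 1 / T) \<longlongrightarrow> 1) at_top" by simp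
  qed auto
  have "((\<lambda>T. ?V T) \<longlongrightarrow> m * of_real 1) at_top"
    by (intro tendsto_mult filterlim_compose[OF m fl] tendsto_of_real ratio)
  moreover have "((\<lambda>T. ?J T - ?V T) \<longlongrightarrow> 0) at_top"
  proof (rule Lim_null_comparison)
    show "((\<lambda>T. B / T) \<longlongrightarrow> 0) at_top"
      by (intro tendsto_divide_0[OF tendsto_const] filterlim_at_top_imp_at_infinity filterlim_ident)
    show "\<forall>\<^sub>F T in at_top. norm (?J T - ?V T) \<le> B / T"
      using eventually_ge_at_top[of 1]
    proof eventually_elim
      case (elim T)
      define p where "p = nat \<lfloor>T\<rfloor>"
      have p: "real p \<le> T" "T \<le> real p + 1" "p > 0" using elim unfolding p_def by linarith+
      have "v p * of_real (real p / T) = integral {- real p..real p + 1} f / of_real (2 * T)"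
        using p elim by (simp add: v_def field_simps)
      then have "norm (?J T - v p * of_real (real p / T))
          = norm (integral {-T..T} f - integral {- real p..real p + 1} f) / (2 * T)"
        using elim by (simp add: norm_divide norm_mult flip: diff_divide_distrib)
      also have "\<dots> \<le> (B * (\<bar>T - (real p + 1)\<bar> + \<bar>- T - - real p\<bar>)) / (2 * T)"
        using elim by (intro divide_right_mono norm_integral_diff_le AP_R_continuous f B) auto
      also have "\<dots> \<le> (B * 2) / (2 * T)"
        using p elim B by (intro divide_right_mono mult_left_mono) auto
      finally show ?case by (simp add: p_def)
    qed
  qed
  ultimately have "((\<lambda>T. (?J T - ?V T)
      + ?V T) \<longlongrightarrow> 0 + m * of_real 1) at_top"
    by (intro tendsto_add)
  then have "((\<lambda>T. ?J T) \<longlongrightarrow> m) at_top" by simp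
  then show ?thesis using mean_R_eqI by metis
qed

lemma AP_R_translate: "f \<in> AP_R \<Longrightarrow> (\<lambda>t. f (t + s)) \<in> AP_R"
  unfolding AP_R_iff_bohr_ap
  by (auto intro!: bohr_ap_translate continuous_on_compose2[of UNIV f] continuous_intros)

lemma AP_R_reflect: "f \<in> AP_R \<Longrightarrow> (\<lambda>t. f (- t)) \<in> AP_R"
  unfolding AP_R_iff_bohr_ap
  by (auto intro!: bohr_ap_reflect continuous_on_compose2[of UNIV f] continuous_intros)

lemma mean_R_translate:
  assumes f: "f \<in> AP_R"
  shows "mean_R (\<lambda>t. f (t + s)) = mean_R f"
proof (rule mean_R_eqI)
  let ?J = "\<lambda>f T. integral {-T..T} f / complex_of_real (2 * T)"
  obtain B where B: "\<And>t. norm (f t) \<le> B" "B \<ge> 0" using AP_R_bounded[OF f] by blast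
  have "((\<lambda>T. ?J (\<lambda>t. f (t + s)) T - ?J f T) \<longlongrightarrow> 0) at_top"
  proof (rule Lim_null_comparison)
    show "((\<lambda>T. B * \<bar>s\<bar> / T) \<longlongrightarrow> 0) at_top"
      by (intro tendsto_divide_0[OF tendsto_const] filterlim_at_top_imp_at_infinity filterlim_ident)
    show "\<forall>\<^sub>F T in at_top. norm (?J (\<lambda>t. f (t + s)) T - ?J f T) \<le> B * \<bar>s\<bar> / T"
      using eventually_gt_at_top[of 0]
    proof eventually_elim
      case (elim T)
      have "integral {-T..T} (\<lambda>t. f (t + s)) = integral {-T + s..T + s} f"
        using integral_shift[OF AP_R_continuous[OF f], of "-T" T s] by (simp add: o_def)
      then have "norm (integral {-T..T} (\<lambda>t. f (t + s)) - integral {-T..T} f) \<le> B * (\<bar>T + s - T\<bar> + \<bar>- T + s - - T\<bar>)"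
        using norm_integral_diff_le[OF AP_R_continuous[OF f] B(1), of "-T + s" "T + s" "-T" T] elim by simp
      then show ?case using elim
        by (simp add: norm_divide norm_mult field_simps flip: diff_divide_distrib)
    qed
  qed
  from tendsto_add[OF this mean_R_tendsto[OF f]]
  show "((\<lambda>T. integral {-T..T} (\<lambda>t. f (t + s)) / of_real (2 * T)) \<longlongrightarrow> mean_R f) at_top" by simp
qed

lemma mean_R_reflect:
  assumes f: "f \<in> AP_R"
  shows "mean_R (\<lambda>t. f (- t)) = mean_R f"
proof (rule mean_R_eqI)
  have "integral {-T..T} (\<lambda>t. f (- t)) = integral {-T..T} f" for T :: real
    using Henstock_Kurzweil_Integration.integral_reflect_real[of T "-T" f] by simp
  then show "((\<lambda>T. integral {-T..T} (\<lambda>t. f (- t)) / of_real (2 * T)) \<longlongrightarrow> mean_R f) at_top"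
    using mean_R_tendsto[OF f] by simp
qed


lemma mean_Z_cis: "mean_Z (\<lambda>n. cis (\<theta> * of_int n)) = (if cis \<theta> = 1 then 1 else 0)"
proof (cases "cis \<theta> = 1")
  case True
  have "cis (\<theta> * of_int n) = cis \<theta> powi n" for n :: int by (simp add: cis_power_int mult.commute)
  then have one: "(\<lambda>n::int. cis (\<theta> * of_int n)) = (\<lambda>n. 1)" using True by simp
  have "(\<lambda>p. 1 + inverse (of_nat p :: complex) / 2) \<longlonglongrightarrow> 1 + 0 / 2"
    by (intro tendsto_intros lim_inverse_n) auto
  moreover have "\<forall>\<^sub>F p in sequentially. 1 + inverse (of_nat p :: complex) / 2
      = (\<Sum>n=-int p..int p. 1) / of_nat (2 * p)"
    using eventually_gt_at_top[of 0]
    by eventually_elim (simp add: field_simps)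
  ultimately have "(\<lambda>p. (\<Sum>n=-int p..int p. 1::complex) / of_nat (2 * p)) \<longlonglongrightarrow> 1"
    by (simp add: filterlim_cong)
  then show ?thesis unfolding one using True by (simp add: mean_Z_eqI)
next
  case False
  define c where "c = norm (cis \<theta> - 1)"
  have c: "c > 0" using False by (simp add: c_def)
  have bound: "norm (\<Sum>n=-int p..int p. cis (\<theta> * of_int n)) \<le> 2 / c" for p
  proof -
    have "(\<Sum>n=-int p..int p. cis (\<theta> * of_int n)) = (\<Sum>j<2 * p + 1. cis (- \<theta> * real p) * cis \<theta> ^ j)"
      unfolding symmetric_sum_eq_block
      by (intro sum.cong refl) (simp add: Complex.DeMoivre cis_mult algebra_simps)
    also have "\<dots> = cis (- \<theta> * real p) * ((1 - cis \<theta> ^ (2 * p + 1)) / (1 - cis \<theta>))"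
      using False by (simp only: sum_distrib_left[symmetric] sum_gp_strict) simp
    also have "norm \<dots> = norm (1 - cis \<theta> ^ (2 * p + 1)) / c"
      by (simp add: norm_mult norm_divide c_def norm_minus_commute)
    also have "\<dots> \<le> 2 / c"
      using c norm_triangle_ineq4[of 1 "cis \<theta> ^ (2 * p + 1)"]
      by (intro divide_right_mono) (simp_all add: norm_power norm_mult)
    finally show ?thesis .
  qed
  have "(\<lambda>p::nat. (\<Sum>n=-int p..int p. cis (\<theta> * of_int n)) / of_nat (2 * p)) \<longlonglongrightarrow> 0"
  proof (rule Lim_null_comparison[OF always_eventually[OF allI]])
    show "(\<lambda>p. (1 / c) * inverse (real p)) \<longlonglongrightarrow> 0"
      by (intro tendsto_mult_right_zero lim_inverse_n)
    show "norm ((\<Sum>n=-int p..int p. cis (\<theta> * of_int n)) / of_nat (2 * p)) \<le> (1 / c) * inverse (real p)" for p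
      using divide_right_mono[OF bound[of p], of "2 * real p"]
      by (simp add: norm_divide norm_mult field_simps)
  qed
  then show ?thesis using False by (simp add: mean_Z_eqI)
qed

lemma AP_R_cis: "(\<lambda>t. cis (\<nu> * t)) \<in> AP_R"
  unfolding AP_R_iff_bohr_ap
  by (rule conjI, intro continuous_intros, rule bohr_ap_cis, simp)

lemma AP_Z_cis: "(\<lambda>n. cis (\<nu> * of_int n)) \<in> AP_Z"
  unfolding AP_Z_iff_bohr_ap by (intro bohr_ap_cis) simp

lemma mean_R_const: "mean_R (\<lambda>t. c) = c"
proof (rule mean_R_eqI)
  have "\<forall>\<^sub>F T::real in at_top. c = integral {-T..T} (\<lambda>t. c) / of_real (2 * T)"
    using eventually_gt_at_top[of 0]
    by eventually_elim (simp add: scaleR_conv_of_real)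
  then show "((\<lambda>T::real. integral {-T..T} (\<lambda>t. c) / of_real (2 * T)) \<longlongrightarrow> c) at_top"
    by (rule Lim_transform_eventually[OF tendsto_const])
qed

interpretation Z: mean_functional AP_Z mean_Z
  rewrites "mean_functional.ip mean_Z = apz_inner" and "mean_functional.nrm mean_Z = apz_norm"
proof -
  show m: "mean_functional AP_Z mean_Z"
  proof
    fix c and f g :: "int \<Rightarrow> complex"
    show "(\<lambda>t. c) \<in> AP_Z" by (simp add: AP_Z_iff_bohr_ap bohr_ap_const)
    show "mean_Z (\<lambda>t. 1) = 1" using mean_Z_cis[of 0] by simp
    assume f: "f \<in> AP_Z"
    then show "(\<lambda>t. cnj (f t)) \<in> AP_Z" by (simp add: AP_Z_iff_bohr_ap bohr_ap_cnj)
    show "mean_Z (\<lambda>t. c * f t) = c * mean_Z f"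
      using tendsto_mult_left[OF mean_Z_tendsto[OF f], of c]
      by (intro mean_Z_eqI) (simp add: sum_distrib_left)
    show "mean_Z (\<lambda>t. cnj (f t)) = cnj (mean_Z f)"
      using tendsto_cnj[OF mean_Z_tendsto[OF f]] by (intro mean_Z_eqI) simp
    show "Re (mean_Z f) \<ge> 0" if "\<And>t. Re (f t) \<ge> 0"
    proof (rule tendsto_lowerbound[OF tendsto_Re[OF mean_Z_tendsto[OF f]]])
      have "0 \<le> Re ((\<Sum>n=-int p..int p. f n) / of_real (real (2 * p)))" for p :: nat
        unfolding Re_divide_of_real Re_sum using that by (intro divide_nonneg_nonneg sum_nonneg) auto
      then show "\<forall>\<^sub>F p in sequentially. 0 \<le> Re ((\<Sum>n=-int p..int p. f n) / of_nat (2 * p))"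
        by simp
    qed simp
    assume g: "g \<in> AP_Z"
    show "(\<lambda>t. f t + g t) \<in> AP_Z" "(\<lambda>t. f t * g t) \<in> AP_Z"
      using f g by (auto simp: AP_Z_iff_bohr_ap intro!: bohr_ap_add bohr_ap_mult)
    show "mean_Z (\<lambda>t. f t + g t) = mean_Z f + mean_Z g"
      using tendsto_add[OF mean_Z_tendsto[OF f] mean_Z_tendsto[OF g]]
      by (intro mean_Z_eqI) (simp add: sum.distrib add_divide_distrib)
  qed
  show ip: "mean_functional.ip mean_Z = apz_inner"
    by (intro ext) (simp add: mean_functional.ip_def[OF m] apz_inner_def mean_Z_def)
  show "mean_functional.nrm mean_Z = apz_norm"
    by (intro ext) (simp add: mean_functional.nrm_def[OF m] apz_norm_def ip)
qed

interpretation R: mean_functional AP_R mean_R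
  rewrites "mean_functional.ip mean_R = ap_inner" and "mean_functional.nrm mean_R = ap_norm"
proof -
  show m: "mean_functional AP_R mean_R"
  proof
    fix c and f g :: "real \<Rightarrow> complex"
    show "(\<lambda>t. c) \<in> AP_R" by (simp add: AP_R_iff_bohr_ap bohr_ap_const)
    show "mean_R (\<lambda>t. 1) = 1" by (rule mean_R_const)
    assume f: "f \<in> AP_R"
    then show "(\<lambda>t. cnj (f t)) \<in> AP_R"
      by (auto simp: AP_R_iff_bohr_ap bohr_ap_cnj intro: continuous_intros)
    show "mean_R (\<lambda>t. c * f t) = c * mean_R f"
      using tendsto_mult_left[OF mean_R_tendsto[OF f], of c]
      by (intro mean_R_eqI) simp
    show "mean_R (\<lambda>t. cnj (f t)) = cnj (mean_R f)"
      using tendsto_cnj[OF mean_R_tendsto[OF f]] by (intro mean_R_eqI) (simp add: integral_cnj)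
    show "Re (mean_R f) \<ge> 0" if "\<And>t. Re (f t) \<ge> 0"
    proof (rule tendsto_lowerbound[OF tendsto_Re[OF mean_R_tendsto[OF f]]])
      show "\<forall>\<^sub>F T in at_top. 0 \<le> Re (integral {-T..T} f / of_real (2 * T))"
        using eventually_gt_at_top[of 0]
      proof eventually_elim
        case (elim T)
        have "Re (integral {-T..T} f) = integral {-T..T} (\<lambda>t. Re (f t))"
          using integral_linear[OF AP_R_integrable[OF f] bounded_linear_Re, of "-T" T] by (simp add: o_def)
        also have "\<dots> \<ge> 0"
          using that integrable_linear[OF AP_R_integrable[OF f] bounded_linear_Re]
          by (intro Henstock_Kurzweil_Integration.integral_nonneg) (auto simp: o_def)
        finally show ?case using elim unfolding Re_divide_of_real by simp
      qed
    qed simp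
    assume g: "g \<in> AP_R"
    show "(\<lambda>t. f t + g t) \<in> AP_R" "(\<lambda>t. f t * g t) \<in> AP_R"
      using f g by (auto simp: AP_R_iff_bohr_ap intro!: bohr_ap_add bohr_ap_mult continuous_intros)
    show "mean_R (\<lambda>t. f t + g t) = mean_R f + mean_R g"
      using tendsto_add[OF mean_R_tendsto[OF f] mean_R_tendsto[OF g]]
      by (intro mean_R_eqI) (simp add: Henstock_Kurzweil_Integration.integral_add AP_R_integrable f g add_divide_distrib)
  qed
  show ip: "mean_functional.ip mean_R = ap_inner"
    by (intro ext) (simp add: mean_functional.ip_def[OF m] ap_inner_def mean_R_def)
  show "mean_functional.nrm mean_R = ap_norm"
    by (intro ext) (simp add: mean_functional.nrm_def[OF m] ap_norm_def ip)
qed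

text \<open>
  Translating by half a period changes the sign of the exponential but not its mean.
\<close>

lemma mean_R_cis: "mean_R (\<lambda>t. cis (\<nu> * t)) = (if \<nu> = 0 then 1 else 0)"
proof (cases "\<nu> = 0")
  case False
  define s where "s = pi / \<nu>"
  have "mean_R (\<lambda>t. cis (\<nu> * t)) = mean_R (\<lambda>t. cis (\<nu> * (t + s)))"
    using mean_R_translate[OF AP_R_cis, of \<nu> s] by simp
  also have "(\<lambda>t. cis (\<nu> * (t + s))) = (\<lambda>t. -1 * cis (\<nu> * t))"
    using False by (auto simp: s_def distrib_left cis_mult[symmetric])
  also have "mean_R \<dots> = -1 * mean_R (\<lambda>t. cis (\<nu> * t))" by (rule R.mean_cmult[OF AP_R_cis])
  finally show ?thesis using False by simp
qed (simp add: mean_R_const)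

lemma ap_exp_cis: "ap_exp \<nu> = (\<lambda>t. cis (\<nu> * t))"
  by (simp add: fun_eq_iff ap_exp_def cis_conv_exp)

lemma apz_exp_cis: "apz_exp \<theta> = (\<lambda>n. cis (\<theta> * of_int n))"
  by (simp add: fun_eq_iff apz_exp_def cis_conv_exp)

lemma ap_exp_mem [simp]: "ap_exp \<nu> \<in> AP_R"
  by (simp add: ap_exp_cis AP_R_cis)

lemma apz_exp_mem [simp]: "apz_exp \<theta> \<in> AP_Z"
  by (simp add: apz_exp_cis AP_Z_cis)

lemma ap_exp_orthonormal: "ap_inner (ap_exp \<mu>) (ap_exp \<nu>) = (if \<mu> = \<nu> then 1 else 0)"
  using mean_R_cis[of "\<mu> - \<nu>"]
  by (simp add: R.ip_def ap_exp_cis cis_cnj cis_mult left_diff_distrib)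

lemma apz_exp_orthonormal: "apz_inner (apz_exp \<theta>) (apz_exp \<eta>) = (if cis \<theta> = cis \<eta> then 1 else 0)"
proof -
  have "cis (\<theta> - \<eta>) = 1 \<longleftrightarrow> cis \<theta> = cis \<eta>" by (simp add: cis_divide[symmetric])
  then show ?thesis
    using mean_Z_cis[of "\<theta> - \<eta>"]
    by (simp add: Z.ip_def apz_exp_cis cis_cnj cis_mult left_diff_distrib)
qed

lemma apz_exp_cong: "cis \<theta> = cis \<eta> \<Longrightarrow> apz_exp \<theta> = apz_exp \<eta>"
proof -
  have "apz_exp x n = cis x powi n" for x n by (simp add: apz_exp_cis cis_power_int mult.commute)
  then show "cis \<theta> = cis \<eta> \<Longrightarrow> ?thesis" by (simp add: fun_eq_iff)
qed

section \<open>Bohr's approximation theorem\<close>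

inductive_set trigpoly :: "(real \<Rightarrow> complex) set" where
  zero: "(\<lambda>t. 0) \<in> trigpoly"
| step: "p \<in> trigpoly \<Longrightarrow> (\<lambda>t. c * ap_exp \<nu> t + p t) \<in> trigpoly"

lemma trigpoly_AP_R: "p \<in> trigpoly \<Longrightarrow> p \<in> AP_R"
proof (induction rule: trigpoly.induct)
  case (step p c \<nu>)
  then show ?case by (intro R.add_mem R.cmult_mem ap_exp_mem)
qed (rule R.const_mem)

lemma trigpoly_add: "p \<in> trigpoly \<Longrightarrow> q \<in> trigpoly \<Longrightarrow> (\<lambda>t. p t + q t) \<in> trigpoly"
proof (induction rule: trigpoly.induct)
  case (step p c \<nu>)
  then show ?case using trigpoly.step[of "\<lambda>t. p t + q t" c \<nu>] by (simp add: add.assoc)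
qed simp

lemma trigpoly_exp_mult: "q \<in> trigpoly \<Longrightarrow> (\<lambda>t. c * ap_exp \<nu> t * q t) \<in> trigpoly"
proof (induction rule: trigpoly.induct)
  case zero
  then show ?case by (simp add: trigpoly.zero)
next
  case (step p d \<mu>)
  have "c * ap_exp \<nu> t * (d * ap_exp \<mu> t + p t) = (c * d) * ap_exp (\<nu> + \<mu>) t + c * ap_exp \<nu> t * p t" for t
    by (simp add: ap_exp_cis distrib_right distrib_left flip: cis_mult)
  then show ?case using trigpoly.step[OF step.IH] by presburger
qed

lemma trigpoly_mult: "p \<in> trigpoly \<Longrightarrow> q \<in> trigpoly \<Longrightarrow> (\<lambda>t. p t * q t) \<in> trigpoly"
proof (induction rule: trigpoly.induct)
  case zero
  then show ?case by (simp add: trigpoly.zero)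
next
  case (step p c \<nu>)
  then show ?case
    unfolding distrib_right by (intro trigpoly_add trigpoly_exp_mult) auto
qed

lemma trigpoly_exp: "(\<lambda>t. c * ap_exp \<nu> t) \<in> trigpoly"
  using trigpoly.step[OF trigpoly.zero] by simp

lemma trigpoly_const: "(\<lambda>t. c) \<in> trigpoly"
  using trigpoly_exp[of c 0] by (simp add: ap_exp_cis)

lemma trigpoly_prod: "finite I \<Longrightarrow> (\<And>i. i \<in> I \<Longrightarrow> p i \<in> trigpoly) \<Longrightarrow> (\<lambda>t. \<Prod>i\<in>I. p i t) \<in> trigpoly"
  by (induction I rule: finite_induct) (auto intro: trigpoly_const trigpoly_mult)

lemma trigpoly_power: "p \<in> trigpoly \<Longrightarrow> (\<lambda>t. p t ^ n) \<in> trigpoly"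
  by (induction n) (auto intro: trigpoly_const trigpoly_mult)

lemma trigpoly_raised_cosine: "(\<lambda>t. of_real ((1 + cos (\<nu> * t)) / 2)) \<in> trigpoly"
proof -
  have "(\<lambda>t. 1 / 2 + (1 / 4 * ap_exp \<nu> t + 1 / 4 * ap_exp (- \<nu>) t)) \<in> trigpoly"
    by (intro trigpoly_add trigpoly_exp trigpoly_const)
  also have "(\<lambda>t. 1 / 2 + (1 / 4 * ap_exp \<nu> t + 1 / 4 * ap_exp (- \<nu>) t))
      = (\<lambda>t. of_real ((1 + cos (\<nu> * t)) / 2))"
    by (auto simp: ap_exp_cis complex_eq_iff fun_eq_iff)
  finally show ?thesis .
qed

lemma trigpoly_finite_sum:
  assumes "p \<in> trigpoly"
  obtains V c where "finite V" "p = (\<lambda>t. \<Sum>\<nu>\<in>V. c \<nu> * ap_exp \<nu> t)"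
proof -
  from assms have "\<exists>V c. finite V \<and> p = (\<lambda>t. \<Sum>\<nu>\<in>V. c \<nu> * ap_exp \<nu> t)"
  proof (induction rule: trigpoly.induct)
    case zero
    then show ?case by (intro exI[of _ "{}"]) simp
  next
    case (step p a \<mu>)
    then obtain V c where V: "finite V" "p = (\<lambda>t. \<Sum>\<nu>\<in>V. c \<nu> * ap_exp \<nu> t)" by blast
    define d where "d \<nu> = (if \<nu> \<in> V then c \<nu> else 0) + (if \<nu> = \<mu> then a else 0)" for \<nu>
    have "a * ap_exp \<mu> t + p t = (\<Sum>\<nu>\<in>insert \<mu> V. d \<nu> * ap_exp \<nu> t)" for t
    proof -
      have "(\<Sum>\<nu>\<in>insert \<mu> V. d \<nu> * ap_exp \<nu> t)
          = (\<Sum>\<nu>\<in>insert \<mu> V. if \<nu> \<in> V then c \<nu> * ap_exp \<nu> t else 0)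
          + (\<Sum>\<nu>\<in>insert \<mu> V. if \<nu> = \<mu> then a * ap_exp \<nu> t else 0)"
        unfolding sum.distrib[symmetric] by (intro sum.cong refl) (simp add: d_def distrib_right)
      also have "(\<Sum>\<nu>\<in>insert \<mu> V. if \<nu> \<in> V then c \<nu> * ap_exp \<nu> t else 0) = p t"
        using V by (simp add: sum.inter_restrict[symmetric] Int_insert_left) (auto intro!: sum.cong)
      also have "(\<Sum>\<nu>\<in>insert \<mu> V. if \<nu> = \<mu> then a * ap_exp \<nu> t else 0) = a * ap_exp \<mu> t"
        using V(1) by simp
      finally show ?thesis by simp
    qed
    then show ?case using V(1) by (intro exI[of _ "insert \<mu> V"] exI[of _ d]) auto
  qed
  then show ?thesis using that by blast
qed

lemma AP_R_flip: "f \<in> AP_R \<Longrightarrow> (\<lambda>s. f (t - s)) \<in> AP_R"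
  using AP_R_reflect[OF AP_R_translate[of f t]] by simp

lemma mean_R_flip: "f \<in> AP_R \<Longrightarrow> mean_R (\<lambda>s. f (t - s)) = mean_R f"
  using mean_R_reflect[OF AP_R_translate[of f t]] mean_R_translate[of f t] by simp

text \<open>
  Convolving with an exponential \<open>e\<^sub>\<nu>\<close> in the sense of means gives a multiple of \<open>e\<^sub>\<nu>\<close>; the frequencies
  of the convolution are among those of \<open>q\<close>.
\<close>

lemma mean_convolution_trigpoly:
  assumes f: "f \<in> AP_R" and "q \<in> trigpoly"
  shows "(\<lambda>t. mean_R (\<lambda>s. f (t - s) * q s)) \<in> trigpoly"
  using assms(2)
proof (induction rule: trigpoly.induct)
  case zero
  then show ?case by (simp add: mean_R_const trigpoly.zero)
next
  case (step p c \<nu>)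
  define h where "h u = f u * ap_exp (- \<nu>) u" for u
  have h: "h \<in> AP_R" unfolding h_def using f by (intro R.mult_mem ap_exp_mem)
  have "mean_R (\<lambda>s. f (t - s) * (c * ap_exp \<nu> s + p s))
      = (c * mean_R h) * ap_exp \<nu> t + mean_R (\<lambda>s. f (t - s) * p s)" for t
  proof -
    have "(\<lambda>s. f (t - s) * (c * ap_exp \<nu> s + p s))
        = (\<lambda>s. (c * ap_exp \<nu> t) * h (t - s) + f (t - s) * p s)"
      by (simp add: fun_eq_iff h_def ap_exp_cis cis_mult algebra_simps)
    then have "mean_R (\<lambda>s. f (t - s) * (c * ap_exp \<nu> s + p s))
        = mean_R (\<lambda>s. (c * ap_exp \<nu> t) * h (t - s) + f (t - s) * p s)" by (rule arg_cong)
    also have "\<dots> = (c * ap_exp \<nu> t) * mean_R h + mean_R (\<lambda>s. f (t - s) * p s)"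
      using h f trigpoly_AP_R[OF step.hyps]
      by (simp add: R.mean_add R.mean_cmult R.cmult_mem R.mult_mem AP_R_flip mean_R_flip)
    finally show ?thesis by simp
  qed
  then show ?case using trigpoly.step[OF step.IH] by presburger
qed

text \<open>
  Finitely many translates of a Bohr set of almost periods cover the line, so the sum of finitely many
  translates of \<open>f\<close> is bounded below by a positive constant. Its mean is a multiple of the mean of \<open>f\<close>.
\<close>

lemma mean_R_pos:
  assumes f: "f \<in> AP_R" and real: "\<And>t. f t \<in> \<real>" and nonneg: "\<And>t. Re (f t) \<ge> 0" and pos: "Re (f 0) > 0"
  shows "Re (mean_R f) > 0"
proof -
  define \<eta> where "\<eta> = Re (f 0) / 2"
  have \<eta>: "\<eta> > 0" using pos by (simp add: \<eta>_def)
  have ap: "bohr_ap (\<lambda>x. x) f" using f by (simp add: AP_R_iff_bohr_ap)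
  obtain \<Lambda> \<delta> where L: "finite \<Lambda>" "\<delta> > 0" "\<And>p t. p \<in> bohr_set \<Lambda> \<delta> \<Longrightarrow> norm (f (t + p) - f t) \<le> \<eta>"
    using bohr_apE[OF ap \<eta>] by blast
  obtain S where S: "finite S" "\<And>x. \<exists>s\<in>S. x - s \<in> bohr_set \<Lambda> \<delta>"
    using bohr_set_syndetic[OF L(1,2), of UNIV] by auto
  have mem: "(\<lambda>t. f (t + - s)) \<in> AP_R" for s by (rule AP_R_translate[OF f])
  have "Re (mean_R (\<lambda>t. of_real \<eta>)) \<le> Re (mean_R (\<lambda>t. \<Sum>s\<in>S. f (t + - s)))"
  proof (rule R.mean_mono)
    fix t
    obtain s where s: "s \<in> S" "t - s \<in> bohr_set \<Lambda> \<delta>" using S(2) by blast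
    have "\<bar>Re (f (t - s) - f 0)\<bar> \<le> \<eta>"
      using L(3)[OF s(2), of 0] abs_Re_le_cmod[of "f (t - s) - f 0"] by simp
    then have "\<eta> \<le> Re (f (t + - s))" by (simp add: \<eta>_def abs_if split: if_splits)
    also have "\<dots> \<le> (\<Sum>s\<in>S. Re (f (t + - s)))"
      using s S(1) nonneg by (intro member_le_sum) auto
    finally show "Re (of_real \<eta>) \<le> Re (\<Sum>s\<in>S. f (t + - s))" by simp
  qed (use S(1) mem in \<open>auto intro: R.const_mem R.sum_mem\<close>)
  also have "mean_R (\<lambda>t. \<Sum>s\<in>S. f (t + - s)) = of_nat (card S) * mean_R f"
    using R.mean_sum[OF S(1), of "\<lambda>s t. f (t + - s)"] mem mean_R_translate[OF f, of "- _"] by simp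
  finally have "\<eta> \<le> real (card S) * Re (mean_R f)" by (simp add: mean_R_const)
  then show ?thesis using \<eta> by (smt (verit) mult_nonneg_nonpos of_nat_0_le_iff)
qed

text \<open>
  The kernel \<open>k\<close> is a product of raised cosines, one for each frequency
  of a Bohr set of \<open>\<epsilon>/2\<close>-almost periods. Its powers, divided by their means, act as an approximate identity
  concentrated on this Bohr set: off the set \<open>k\<^sup>n \<le> (1 - c)\<^sup>n\<close>, while the mean of \<open>k\<^sup>n\<close> is at least
  a constant multiple of \<open>(1 - c/2)\<^sup>n\<close>.
\<close>

theorem trigpoly_dense:
  assumes f: "f \<in> AP_R" and \<epsilon>: "\<epsilon> > 0"
  obtains p where "p \<in> trigpoly" "\<And>t. norm (f t - p t) \<le> \<epsilon>"
proof -
  obtain B where B: "\<And>t. norm (f t) \<le> B" "B \<ge> 0" using AP_R_bounded[OF f] by blast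
  have ap: "bohr_ap (\<lambda>x. x) f" using f by (simp add: AP_R_iff_bohr_ap)
  have \<epsilon>2: "\<epsilon> / 2 > 0" using \<epsilon> by simp
  obtain \<Lambda> \<delta> where L: "finite \<Lambda>" "\<delta> > 0" "\<And>p t. p \<in> bohr_set \<Lambda> \<delta> \<Longrightarrow> norm (f (t + p) - f t) \<le> \<epsilon> / 2"
    using bohr_apE[OF ap \<epsilon>2] by blast
  define k where "k s = (\<Prod>\<nu>\<in>\<Lambda>. (1 + cos (\<nu> * s)) / 2)" for s
  define K where "K s = complex_of_real (k s)" for s
  have factor: "0 \<le> (1 + cos x) / 2 \<and> (1 + cos x) / 2 \<le> 1" for x :: real
    using cos_ge_minus_one[of x] cos_le_one[of x] by (auto simp del: cos_ge_minus_one cos_le_one)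
  have k: "0 \<le> k s" "k s \<le> 1" for s
    unfolding k_def using factor by (auto intro!: prod_nonneg prod_le_1)
  have k0: "k 0 = 1" by (simp add: k_def)
  have K: "K \<in> trigpoly"
    unfolding K_def k_def of_real_prod by (intro trigpoly_prod L(1) trigpoly_raised_cosine)
  define c where "c = min (\<delta>\<^sup>2 / 4) (1 / 2)"
  have c: "c > 0" "c < 1" using L(2) by (auto simp: c_def)
  \<comment> \<open>away from the Bohr set one factor of the kernel stays below \<open>1 - c\<close>\<close>
  have off: "k s \<le> 1 - c" if "s \<notin> bohr_set \<Lambda> \<delta>" for s
  proof -
    have "\<exists>\<nu>\<in>\<Lambda>. norm (cis (\<nu> * s) - 1) \<ge> \<delta>"
      using that by (simp add: bohr_set_def not_less)
    then obtain \<nu> where \<nu>: "\<nu> \<in> \<Lambda>" "norm (cis (\<nu> * s) - 1) \<ge> \<delta>" by blast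
    have "\<delta>\<^sup>2 \<le> (norm (cis (\<nu> * s) - 1))\<^sup>2" using \<nu>(2) L(2) by (intro power_mono) auto
    also have "\<dots> = (cos (\<nu> * s) - 1)\<^sup>2 + (sin (\<nu> * s))\<^sup>2" by (simp add: cmod_power2)
    also have "\<dots> = 2 - 2 * cos (\<nu> * s)"
      using sin_cos_squared_add[of "\<nu> * s"] by (simp add: power2_diff)
    finally have "(1 + cos (\<nu> * s)) / 2 \<le> 1 - c" by (simp add: c_def min_def)
    moreover have "k s = (1 + cos (\<nu> * s)) / 2 * (\<Prod>\<nu>\<in>\<Lambda> - {\<nu>}. (1 + cos (\<nu> * s)) / 2)"
      unfolding k_def by (rule prod.remove[OF L(1) \<nu>(1)])
    moreover have "\<dots> \<le> (1 + cos (\<nu> * s)) / 2 * 1"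
      using factor by (intro mult_left_mono prod_le_1) auto
    ultimately show ?thesis by linarith
  qed
  \<comment> \<open>\<open>F\<close> is almost periodic and vanishes where \<open>k \<le> 1 - c / 2\<close>, so its mean yields a lower bound for
    the means of all powers of \<open>k\<close>\<close>
  define F where "F s = complex_of_real (max 0 (k s - (1 - c / 2)))" for s
  have F: "F \<in> AP_R"
    unfolding AP_R_iff_bohr_ap
  proof
    have "K \<in> AP_R" by (rule trigpoly_AP_R[OF K])
    then have bK: "bohr_ap (\<lambda>x. x) K" by (simp add: AP_R_iff_bohr_ap)
    show "bohr_ap (\<lambda>x. x) F"
    proof (rule bohr_ap_lipschitz[OF bK, where C = 1])
      fix s t
      have "norm (F s - F t) = \<bar>max 0 (k s - (1 - c / 2)) - max 0 (k t - (1 - c / 2))\<bar>"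
        unfolding F_def by (simp only: of_real_diff[symmetric] norm_of_real)
      also have "\<dots> \<le> \<bar>k s - k t\<bar>" by linarith
      also have "\<dots> = 1 * norm (K s - K t)"
        unfolding K_def by (simp only: of_real_diff[symmetric] norm_of_real mult_1)
      finally show "norm (F s - F t) \<le> 1 * norm (K s - K t)" .
    qed
    show "continuous_on UNIV F"
      unfolding F_def k_def by (intro continuous_intros) auto
  qed
  define \<mu> where "\<mu> = Re (mean_R F)"
  have \<mu>: "\<mu> > 0"
    unfolding \<mu>_def using F c by (intro mean_R_pos) (auto simp: F_def k0)
  obtain n where n: "((1 - c) / (1 - c / 2)) ^ n < \<epsilon> / 2 * \<mu> / (2 * B + 1)"
    using real_arch_pow_inv[of "\<epsilon> / 2 * \<mu> / (2 * B + 1)" "(1 - c) / (1 - c / 2)"] c \<mu> \<epsilon> B(2)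
    by (auto simp: field_simps)
  have n': "2 * B * (1 - c) ^ n \<le> \<epsilon> / 2 * ((1 - c / 2) ^ n * \<mu>)"
  proof -
    have "(1 - c) ^ n * (2 * B + 1) \<le> \<epsilon> / 2 * \<mu> * (1 - c / 2) ^ n"
    proof -
      have cross: "x * d \<le> y * z" if "x / z < y / d" "z > 0" "d > 0" for x y z d :: real
        using that by (simp add: field_simps)
      show ?thesis
        using n c B(2) by (intro cross) (simp_all only: power_divide, simp_all)
    qed
    moreover have "2 * B * (1 - c) ^ n \<le> (1 - c) ^ n * (2 * B + 1)"
      using c by (simp add: algebra_simps)
    ultimately show ?thesis by (simp add: mult_ac)
  qed
  define Kn where "Kn s = K s ^ n" for s
  have Kn: "Kn \<in> trigpoly" unfolding Kn_def by (intro trigpoly_power K)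
  have KnA: "Kn \<in> AP_R" by (rule trigpoly_AP_R[OF Kn])
  have Kn_real: "Kn s = of_real (k s ^ n)" for s by (simp add: Kn_def K_def)
  define m where "m = Re (mean_R Kn)"
  have "(\<lambda>s. cnj (Kn s)) = Kn" by (simp add: fun_eq_iff Kn_real)
  then have m_eq: "mean_R Kn = of_real m"
    using R.mean_cnj[OF KnA] by (simp add: m_def complex_eq_iff)
  have m_ge: "(1 - c / 2) ^ n * \<mu> \<le> m"
  proof -
    have "Re (mean_R (\<lambda>s. of_real ((1 - c / 2) ^ n) * F s)) \<le> Re (mean_R Kn)"
    proof (rule R.mean_mono[OF R.cmult_mem[OF F] KnA])
      fix s
      show "Re (of_real ((1 - c / 2) ^ n) * F s) \<le> Re (Kn s)"
      proof (cases "k s \<le> 1 - c / 2")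
        case True
        then show ?thesis using k by (simp add: F_def Kn_real)
      next
        case False
        then have "(1 - c / 2) ^ n * (k s - (1 - c / 2)) \<le> k s ^ n * 1"
          using k[of s] c by (intro mult_mono power_mono) auto
        then show ?thesis using False by (simp add: F_def Kn_real flip: of_real_mult of_real_power)
      qed
    qed
    also have "mean_R (\<lambda>s. of_real ((1 - c / 2) ^ n) * F s) = of_real ((1 - c / 2) ^ n) * mean_R F"
      by (rule R.mean_cmult[OF F])
    finally show ?thesis by (simp add: m_def \<mu>_def flip: of_real_power)
  qed
  have "(1 - c / 2) ^ n > 0" using c by simp
  then have m: "m > 0" using m_ge \<mu> by (smt (verit) mult_pos_pos)
  define P where "P t = mean_R (\<lambda>s. f (t - s) * ((1 / of_real m) * ap_exp 0 s * Kn s))" for t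
  show ?thesis
  proof (rule that)
    show "P \<in> trigpoly"
      unfolding P_def by (intro mean_convolution_trigpoly f trigpoly_exp_mult Kn)
    fix t
    have fm: "(\<lambda>s. f (t - s) * Kn s) \<in> AP_R" by (intro R.mult_mem AP_R_flip f KnA)
    have Pt: "P t = (1 / of_real m) * mean_R (\<lambda>s. f (t - s) * Kn s)"
      using R.mean_cmult[OF fm, of "1 / of_real m"]
      by (simp add: P_def ap_exp_cis mult_ac)
    have "of_real m * (f t - P t) = mean_R (\<lambda>s. f t * Kn s - f (t - s) * Kn s)"
      unfolding R.mean_diff[OF R.cmult_mem[OF KnA] fm] R.mean_cmult[OF KnA] m_eq Pt
      using m by (simp add: right_diff_distrib mult.commute)
    also have "norm \<dots> \<le> Re (mean_R (\<lambda>s. of_real (\<epsilon> / 2) * Kn s + of_real (2 * B * (1 - c) ^ n)))"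
    proof (rule R.norm_mean_le)
      fix s
      have "norm (f t * Kn s - f (t - s) * Kn s) = norm (f (t + - s) - f t) * k s ^ n"
        using k by (simp add: norm_mult Kn_real norm_minus_commute flip: left_diff_distrib)
           (simp add: norm_power)
      also have "\<dots> \<le> \<epsilon> / 2 * k s ^ n + 2 * B * (1 - c) ^ n"
      proof (cases "s \<in> bohr_set \<Lambda> \<delta>")
        case True
        then have "norm (f (t + - s) - f t) * k s ^ n \<le> \<epsilon> / 2 * k s ^ n"
          using k by (intro mult_right_mono L(3)) (auto simp: bohr_set_uminus)
        moreover have "0 \<le> 2 * B * (1 - c) ^ n" using B(2) c by simp
        ultimately show ?thesis by linarith
      next
        case False
        have "norm (f (t + - s) - f t) \<le> 2 * B"
          using norm_triangle_ineq4[of "f (t + - s)" "f t"] B(1)[of t] B(1)[of "t + - s"] by linarith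
        moreover have "k s ^ n \<le> (1 - c) ^ n" using k off[OF False] by (intro power_mono)
        ultimately have "norm (f (t + - s) - f t) * k s ^ n \<le> 2 * B * (1 - c) ^ n"
          using k B(2) by (intro mult_mono) auto
        moreover have "0 \<le> \<epsilon> / 2 * k s ^ n" using \<epsilon> k by simp
        ultimately show ?thesis by linarith
      qed
      finally show "norm (f t * Kn s - f (t - s) * Kn s) \<le> Re (of_real (\<epsilon> / 2) * Kn s + of_real (2 * B * (1 - c) ^ n))"
        unfolding Kn_real by (simp flip: of_real_mult of_real_power of_real_add)
    qed (rule R.diff_mem[OF R.cmult_mem[OF KnA] fm], rule R.add_mem[OF R.cmult_mem[OF KnA] R.const_mem])
    also have "\<dots> = \<epsilon> / 2 * m + 2 * B * (1 - c) ^ n"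
      using KnA by (simp only: R.mean_add R.cmult_mem R.const_mem R.mean_cmult mean_R_const m_eq) simp
    also have "\<dots> \<le> \<epsilon> / 2 * m + \<epsilon> / 2 * m"
      using n' m_ge \<epsilon> by (smt (verit) mult_left_mono divide_pos_pos)
    finally have "m * norm (f t - P t) \<le> m * \<epsilon>" using m by (simp add: norm_mult mult.commute)
    then show "norm (f t - P t) \<le> \<epsilon>" using m by simp
  qed
qed

section \<open>The completion\<close>

lemma AP_cauchy_mem: "X \<in> AP_cauchy \<Longrightarrow> X n \<in> AP_R"
  by (simp add: AP_cauchy_def)

lemma AP_cauchyD:
  "X \<in> AP_cauchy \<Longrightarrow> \<epsilon> > 0 \<Longrightarrow> \<exists>N. \<forall>m\<ge>N. \<forall>n\<ge>N. ap_norm (\<lambda>t. X m t - X n t) < \<epsilon>"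
  by (simp add: AP_cauchy_def)

lemma AP_relI:
  "X \<in> AP_cauchy \<Longrightarrow> Y \<in> AP_cauchy \<Longrightarrow> (\<lambda>n. ap_norm (\<lambda>t. X n t - Y n t)) \<longlonglongrightarrow> 0 \<Longrightarrow> (X, Y) \<in> AP_rel"
  by (simp add: AP_rel_def)

lemma AP_relD:
  assumes "(X, Y) \<in> AP_rel"
  shows "X \<in> AP_cauchy" "Y \<in> AP_cauchy" "(\<lambda>n. ap_norm (\<lambda>t. X n t - Y n t)) \<longlonglongrightarrow> 0"
  using assms by (simp_all add: AP_rel_def)

lemma equiv_AP_rel: "equiv AP_cauchy AP_rel"
proof (rule equivI)
  show "AP_rel \<subseteq> AP_cauchy \<times> AP_cauchy" by (auto dest: AP_relD)
  show "refl_on AP_cauchy AP_rel"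
    by (rule refl_onI) (auto simp: AP_rel_def)
  show "sym AP_rel"
  proof (rule symI)
    fix X Y assume "(X, Y) \<in> AP_rel"
    moreover have "ap_norm (\<lambda>t. Y n t - X n t) = ap_norm (\<lambda>t. X n t - Y n t)" for n
      by (rule R.nrm_minus_commute)
    ultimately show "(Y, X) \<in> AP_rel" by (simp add: AP_rel_def)
  qed
  show "trans AP_rel"
  proof (rule transI)
    fix X Y Z assume XY: "(X, Y) \<in> AP_rel" and YZ: "(Y, Z) \<in> AP_rel"
    have "(\<lambda>n. ap_norm (\<lambda>t. X n t - Z n t)) \<longlonglongrightarrow> 0"
    proof (rule Lim_null_comparison[OF always_eventually[OF allI]])
      show "(\<lambda>n. ap_norm (\<lambda>t. X n t - Y n t) + ap_norm (\<lambda>t. Y n t - Z n t)) \<longlonglongrightarrow> 0"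
        using tendsto_add[OF AP_relD(3)[OF XY] AP_relD(3)[OF YZ]] by simp
      show "norm (ap_norm (\<lambda>t. X n t - Z n t)) \<le> ap_norm (\<lambda>t. X n t - Y n t) + ap_norm (\<lambda>t. Y n t - Z n t)" for n
      proof -
        have mem: "X n \<in> AP_R" "Y n \<in> AP_R" "Z n \<in> AP_R"
          using AP_relD(1,2)[OF XY] AP_relD(2)[OF YZ] by (auto intro: AP_cauchy_mem)
        then show ?thesis
          using R.nrm_triangle3[OF mem] R.nrm_minus_commute[of "Z n" "Y n"] R.nrm_nonneg[OF R.diff_mem[OF mem(1,3)]]
          by simp
      qed
    qed
    then show "(X, Z) \<in> AP_rel" using XY YZ by (intro AP_relI) (auto dest: AP_relD)
  qed
qed

lemma AP_cauchy_bounded: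
  assumes X: "X \<in> AP_cauchy"
  shows "\<exists>B\<ge>0. \<forall>n. ap_norm (X n) \<le> B"
proof -
  obtain N where N: "\<And>m n. m \<ge> N \<Longrightarrow> n \<ge> N \<Longrightarrow> ap_norm (\<lambda>t. X m t - X n t) < 1"
    using AP_cauchyD[OF X, of 1] by auto
  define B where "B = (\<Sum>n\<le>N. ap_norm (X n)) + 1"
  have nn: "ap_norm (X n) \<ge> 0" for n using X by (simp add: AP_cauchy_mem)
  have le: "ap_norm (X n) \<le> (\<Sum>n\<le>N. ap_norm (X n))" if "n \<le> N" for n
    using nn that by (intro member_le_sum) auto
  have "ap_norm (X n) \<le> B" for n
  proof (cases "n \<le> N")
    case True
    then show ?thesis using le[of n] by (simp add: B_def)
  next
    case False
    have "ap_norm (X n) \<le> ap_norm (X N) + ap_norm (\<lambda>t. X n t - X N t)"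
      using X by (intro R.nrm_triangle2 AP_cauchy_mem)
    then show ?thesis using N[of n N] False le[of N] by (simp add: B_def)
  qed
  moreover have "B \<ge> 0" unfolding B_def using nn by (intro add_nonneg_nonneg sum_nonneg) auto
  ultimately show ?thesis by blast
qed

lemma AP_cauchy_inner_convergent:
  assumes X: "X \<in> AP_cauchy" and Y: "Y \<in> AP_cauchy"
  shows "convergent (\<lambda>n. ap_inner (X n) (Y n))"
proof (rule Cauchy_convergent, rule metric_CauchyI)
  obtain B where B: "B \<ge> 0" "\<And>n. ap_norm (X n) \<le> B" using AP_cauchy_bounded[OF X] by blast
  obtain D where D: "D \<ge> 0" "\<And>n. ap_norm (Y n) \<le> D" using AP_cauchy_bounded[OF Y] by blast
  define c where "c = B + D + 1"
  have c: "c > 0" using B D by (simp add: c_def)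
  fix \<epsilon> :: real assume "\<epsilon> > 0"
  then have \<epsilon>: "\<epsilon> / c > 0" using c by simp
  obtain N where N: "\<And>m n. m \<ge> N \<Longrightarrow> n \<ge> N \<Longrightarrow> ap_norm (\<lambda>t. X m t - X n t) < \<epsilon> / c"
    using AP_cauchyD[OF X \<epsilon>] by blast
  obtain N' where N': "\<And>m n. m \<ge> N' \<Longrightarrow> n \<ge> N' \<Longrightarrow> ap_norm (\<lambda>t. Y m t - Y n t) < \<epsilon> / c"
    using AP_cauchyD[OF Y \<epsilon>] by blast
  have "dist (ap_inner (X m) (Y m)) (ap_inner (X n) (Y n)) < \<epsilon>"
    if mn: "m \<ge> max N N'" "n \<ge> max N N'" for m n
  proof -
    have mem: "X k \<in> AP_R" "Y k \<in> AP_R" for k using X Y by (auto intro: AP_cauchy_mem)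
    have "dist (ap_inner (X m) (Y m)) (ap_inner (X n) (Y n))
        \<le> ap_norm (\<lambda>t. X m t - X n t) * ap_norm (Y m) + ap_norm (X n) * ap_norm (\<lambda>t. Y m t - Y n t)"
      unfolding dist_norm by (intro R.ip_diff_le mem)
    also have "\<dots> \<le> \<epsilon> / c * D + B * (\<epsilon> / c)"
      using N[of m n] N'[of m n] mn B D \<epsilon> mem R.nrm_nonneg[OF R.diff_mem[OF mem(2) mem(2)], of m n]
      by (intro add_mono mult_mono) auto
    also have "\<dots> = \<epsilon> / c * (D + B)" by (simp only: distrib_left mult.commute[of B])
    also have "\<dots> < \<epsilon> / c * c" using \<epsilon> by (intro mult_strict_left_mono) (simp_all add: c_def)
    finally show ?thesis using c by simp
  qed
  then show "\<exists>M. \<forall>m\<ge>M. \<forall>n\<ge>M. dist (ap_inner (X m) (Y m)) (ap_inner (X n) (Y n)) < \<epsilon>" by blast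
qed

lemma AP_rel_inner_tendsto:
  assumes X: "(X, X') \<in> AP_rel" and Y: "(Y, Y') \<in> AP_rel"
    and z: "(\<lambda>n. ap_inner (X n) (Y n)) \<longlonglongrightarrow> z"
  shows "(\<lambda>n. ap_inner (X' n) (Y' n)) \<longlonglongrightarrow> z"
proof -
  note C = AP_relD(1,2)[OF X] AP_relD(1,2)[OF Y]
  obtain B where B: "B \<ge> 0" "\<And>n. ap_norm (X' n) \<le> B" using AP_cauchy_bounded[OF C(2)] by blast
  obtain D where D: "D \<ge> 0" "\<And>n. ap_norm (Y n) \<le> D" using AP_cauchy_bounded[OF C(3)] by blast
  have mem: "X n \<in> AP_R" "X' n \<in> AP_R" "Y n \<in> AP_R" "Y' n \<in> AP_R" for n
    using C by (auto intro: AP_cauchy_mem)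
  have "(\<lambda>n. ap_inner (X n) (Y n) - ap_inner (X' n) (Y' n)) \<longlonglongrightarrow> 0"
  proof (rule Lim_null_comparison[OF always_eventually[OF allI]])
    show "(\<lambda>n. ap_norm (\<lambda>t. X n t - X' n t) * D + B * ap_norm (\<lambda>t. Y n t - Y' n t)) \<longlonglongrightarrow> 0"
      by (intro tendsto_add_zero tendsto_mult_left_zero tendsto_mult_right_zero AP_relD(3) X Y)
    show "norm (ap_inner (X n) (Y n) - ap_inner (X' n) (Y' n))
        \<le> ap_norm (\<lambda>t. X n t - X' n t) * D + B * ap_norm (\<lambda>t. Y n t - Y' n t)" for n
      by (rule order_trans[OF R.ip_diff_le[OF mem]])
         (intro add_mono mult_left_mono mult_right_mono B D R.nrm_nonneg R.diff_mem mem)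
  qed
  from tendsto_diff[OF z this] show ?thesis by simp
qed

lemma AP2_inner_class:
  assumes X: "X \<in> AP_cauchy" and Y: "Y \<in> AP_cauchy" and z: "(\<lambda>n. ap_inner (X n) (Y n)) \<longlonglongrightarrow> z"
  shows "AP2_inner (AP_rel `` {X}) (AP_rel `` {Y}) = z"
  unfolding AP2_inner_def
proof (rule the_equality)
  show "\<forall>X'\<in>AP_rel `` {X}. \<forall>Y'\<in>AP_rel `` {Y}. (\<lambda>n. ap_inner (X' n) (Y' n)) \<longlonglongrightarrow> z"
    using AP_rel_inner_tendsto[OF _ _ z] by blast
  fix w assume w: "\<forall>X'\<in>AP_rel `` {X}. \<forall>Y'\<in>AP_rel `` {Y}. (\<lambda>n. ap_inner (X' n) (Y' n)) \<longlonglongrightarrow> w"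
  have "X \<in> AP_rel `` {X}" "Y \<in> AP_rel `` {Y}" using equiv_class_self[OF equiv_AP_rel] X Y by auto
  with w have "(\<lambda>n. ap_inner (X n) (Y n)) \<longlonglongrightarrow> w" by blast
  then show "w = z" using z by (rule LIMSEQ_unique)
qed

lemma AP2_inner_class_tendsto:
  assumes "X \<in> AP_cauchy" "Y \<in> AP_cauchy"
  shows "(\<lambda>n. ap_inner (X n) (Y n)) \<longlonglongrightarrow> AP2_inner (AP_rel `` {X}) (AP_rel `` {Y})"
  using AP_cauchy_inner_convergent[OF assms] AP2_inner_class[OF assms] unfolding convergent_def by metis

lemma AP_cauchy_const: "f \<in> AP_R \<Longrightarrow> (\<lambda>n. f) \<in> AP_cauchy"
  by (simp add: AP_cauchy_def)

lemma AP2_coefficient_tendsto: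
  assumes "X \<in> AP_cauchy" "f \<in> AP_R"
  shows "(\<lambda>n. ap_inner (X n) f) \<longlonglongrightarrow> AP2_inner (AP_rel `` {X}) (AP2_of f)"
  unfolding AP2_of_def using AP2_inner_class_tendsto[OF assms(1) AP_cauchy_const[OF assms(2)]] .

lemma AP2_norm_le:
  assumes X: "X \<in> AP_cauchy" and c: "\<And>n. ap_norm (X n) \<le> c"
  shows "AP2_norm (AP_rel `` {X}) \<le> c"
proof -
  have mem: "X n \<in> AP_R" for n using X by (rule AP_cauchy_mem)
  have "Re (AP2_inner (AP_rel `` {X}) (AP_rel `` {X})) \<le> c\<^sup>2"
  proof (rule tendsto_upperbound[OF tendsto_Re[OF AP2_inner_class_tendsto[OF X X]]])
    have "Re (ap_inner (X n) (X n)) \<le> c\<^sup>2" for n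
      unfolding R.nrm_sq[OF mem, symmetric] using c mem by (intro power_mono) auto
    then show "\<forall>\<^sub>F n in sequentially. Re (ap_inner (X n) (X n)) \<le> c\<^sup>2" by simp
  qed simp
  moreover have "c \<ge> 0" using c[of 0] R.nrm_nonneg[OF mem, of 0] by linarith
  ultimately show ?thesis unfolding AP2_norm_def by (simp add: real_le_lsqrt)
qed

lemma AP_cauchy_diff:
  assumes X: "X \<in> AP_cauchy" and Y: "Y \<in> AP_cauchy"
  shows "(\<lambda>n t. X n t - Y n t) \<in> AP_cauchy"
  unfolding AP_cauchy_def
proof (intro CollectI conjI allI impI)
  have mem: "X k \<in> AP_R" "Y k \<in> AP_R" for k using X Y by (auto intro: AP_cauchy_mem)
  show "(\<lambda>t. X n t - Y n t) \<in> AP_R" for n by (intro R.diff_mem mem)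
  fix \<epsilon> :: real assume "\<epsilon> > 0"
  then have \<epsilon>: "\<epsilon> / 2 > 0" by simp
  obtain N where N: "\<And>m n. m \<ge> N \<Longrightarrow> n \<ge> N \<Longrightarrow> ap_norm (\<lambda>t. X m t - X n t) < \<epsilon> / 2"
    using AP_cauchyD[OF X \<epsilon>] by blast
  obtain N' where N': "\<And>m n. m \<ge> N' \<Longrightarrow> n \<ge> N' \<Longrightarrow> ap_norm (\<lambda>t. Y m t - Y n t) < \<epsilon> / 2"
    using AP_cauchyD[OF Y \<epsilon>] by blast
  have "ap_norm (\<lambda>t. X m t - Y m t - (X n t - Y n t)) < \<epsilon>" if mn: "m \<ge> max N N'" "n \<ge> max N N'" for m n
    using R.nrm_diff_diff_le[OF mem(1) mem(1) mem(2) mem(2), of m m n n] N[of m n] N'[of m n] mn by simp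
  then show "\<exists>N. \<forall>m\<ge>N. \<forall>n\<ge>N. ap_norm (\<lambda>t. X m t - Y m t - (X n t - Y n t)) < \<epsilon>" by blast
qed

lemma AP2_diff_class:
  assumes X: "X \<in> AP_cauchy" and Y: "Y \<in> AP_cauchy"
  shows "AP2_diff (AP_rel `` {X}) (AP_rel `` {Y}) = AP_rel `` {\<lambda>n t. X n t - Y n t}"
proof -
  have self: "X \<in> AP_rel `` {X}" "Y \<in> AP_rel `` {Y}" using equiv_class_self[OF equiv_AP_rel] X Y by auto
  have same: "AP_rel `` {\<lambda>n t. X' n t - Y' n t} = AP_rel `` {\<lambda>n t. X n t - Y n t}"
    if "X' \<in> AP_rel `` {X}" "Y' \<in> AP_rel `` {Y}" for X' Y'
  proof -
    have r: "(X, X') \<in> AP_rel" "(Y, Y') \<in> AP_rel" using that by auto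
    note C = AP_relD(1,2)[OF r(1)] AP_relD(1,2)[OF r(2)]
    have mem: "X n \<in> AP_R" "X' n \<in> AP_R" "Y n \<in> AP_R" "Y' n \<in> AP_R" for n
      using C by (auto intro: AP_cauchy_mem)
    have "(\<lambda>n. ap_norm (\<lambda>t. X n t - Y n t - (X' n t - Y' n t))) \<longlonglongrightarrow> 0"
    proof (rule Lim_null_comparison[OF always_eventually[OF allI]])
      show "(\<lambda>n. ap_norm (\<lambda>t. X n t - X' n t) + ap_norm (\<lambda>t. Y n t - Y' n t)) \<longlonglongrightarrow> 0"
        by (intro tendsto_add_zero AP_relD(3) r)
      show "norm (ap_norm (\<lambda>t. X n t - Y n t - (X' n t - Y' n t))) \<le> ap_norm (\<lambda>t. X n t - X' n t) + ap_norm (\<lambda>t. Y n t - Y' n t)" for n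
        using R.nrm_diff_diff_le[OF mem, of n n n n]
          R.nrm_nonneg[OF R.diff_mem[OF R.diff_mem[OF mem(1,3)] R.diff_mem[OF mem(2,4)]], of n n] by simp
    qed
    then have "(\<lambda>n t. X n t - Y n t, \<lambda>n t. X' n t - Y' n t) \<in> AP_rel"
      using C by (intro AP_relI AP_cauchy_diff)
    then show ?thesis by (rule equiv_class_eq[OF equiv_AP_rel, symmetric])
  qed
  have "AP2_diff (AP_rel `` {X}) (AP_rel `` {Y})
      = (\<Union>X'\<in>AP_rel `` {X}. \<Union>Y'\<in>AP_rel `` {Y}. AP_rel `` {\<lambda>n t. X' n t - Y' n t})"
    unfolding AP2_diff_def by blast
  also have "\<dots> = (\<Union>X'\<in>AP_rel `` {X}. \<Union>Y'\<in>AP_rel `` {Y}. AP_rel `` {\<lambda>n t. X n t - Y n t})"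
    using same by (intro SUP_cong refl)
  also have "\<dots> = AP_rel `` {\<lambda>n t. X n t - Y n t}" using self by blast
  finally show ?thesis .
qed

lemma ap_inner_trigpoly_tendsto_zero:
  assumes X: "\<And>n. X n \<in> AP_R" and "\<And>\<nu>. (\<lambda>n. ap_inner (X n) (ap_exp \<nu>)) \<longlonglongrightarrow> 0" and "p \<in> trigpoly"
  shows "(\<lambda>n. ap_inner (X n) p) \<longlonglongrightarrow> 0"
proof -
  obtain V c where V: "finite V" "p = (\<lambda>t. \<Sum>\<nu>\<in>V. c \<nu> * ap_exp \<nu> t)"
    using trigpoly_finite_sum[OF assms(3)] by blast
  have "ap_inner (X n) p = (\<Sum>\<nu>\<in>V. cnj (c \<nu>) * ap_inner (X n) (ap_exp \<nu>))" for n
    unfolding V(2) using V(1) X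
    by (simp add: R.ip_sum_right[of V "\<lambda>\<nu> t. c \<nu> * ap_exp \<nu> t"] R.cmult_mem R.ip_cmult_right)
  moreover have "(\<lambda>n. \<Sum>\<nu>\<in>V. cnj (c \<nu>) * ap_inner (X n) (ap_exp \<nu>)) \<longlonglongrightarrow> (\<Sum>\<nu>\<in>V. cnj (c \<nu>) * 0)"
    by (intro tendsto_sum tendsto_mult_left assms(2))
  ultimately show ?thesis by simp
qed

text \<open>
  Fix a late term of the sequence and approximate it by a trigonometric polynomial \<open>p\<close>. All later terms
  are close to \<open>p\<close> in norm, and their inner products with \<open>p\<close> tend to zero.
\<close>

lemma AP_cauchy_null:
  assumes X: "X \<in> AP_cauchy" and coeff: "\<And>\<nu>. (\<lambda>n. ap_inner (X n) (ap_exp \<nu>)) \<longlonglongrightarrow> 0"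
  shows "(\<lambda>n. ap_norm (X n)) \<longlonglongrightarrow> 0"
proof (rule LIMSEQ_I)
  have mem: "X n \<in> AP_R" for n using X by (rule AP_cauchy_mem)
  obtain B where B: "B \<ge> 0" "\<And>n. ap_norm (X n) \<le> B" using AP_cauchy_bounded[OF X] by blast
  fix r :: real assume r: "r > 0"
  define \<epsilon> where "\<epsilon> = r\<^sup>2 / (4 * (B + 1))"
  have \<epsilon>: "\<epsilon> > 0" using r B by (simp add: \<epsilon>_def)
  obtain N where N: "\<And>m n. m \<ge> N \<Longrightarrow> n \<ge> N \<Longrightarrow> ap_norm (\<lambda>t. X m t - X n t) < \<epsilon>"
    using AP_cauchyD[OF X \<epsilon>] by blast
  obtain p where p: "p \<in> trigpoly" "\<And>t. norm (X N t - p t) \<le> \<epsilon>"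
    using trigpoly_dense[OF mem \<epsilon>] by blast
  have pA: "p \<in> AP_R" by (rule trigpoly_AP_R[OF p(1)])
  have "\<forall>\<^sub>F n in sequentially. norm (ap_inner (X n) p) < r\<^sup>2 / 2"
    using ap_inner_trigpoly_tendsto_zero[OF mem coeff p(1)] r
    by (intro order_tendstoD(2)[OF tendsto_norm_zero]) auto
  then obtain N' where N': "\<And>n. n \<ge> N' \<Longrightarrow> norm (ap_inner (X n) p) < r\<^sup>2 / 2"
    unfolding eventually_sequentially by blast
  have "norm (ap_norm (X n) - 0) < r" if n: "n \<ge> max N N'" for n
  proof -
    have "ap_norm (\<lambda>t. X N t - p t) \<le> \<epsilon>"
      using p \<epsilon> mem pA by (intro R.nrm_le_bound R.diff_mem) auto
    then have close: "ap_norm (\<lambda>t. X n t - p t) \<le> 2 * \<epsilon>"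
      using R.nrm_triangle3[OF mem mem pA, of n N] R.nrm_minus_commute[of p "X N"] N[of n N] n by simp
    have "(ap_norm (X n))\<^sup>2 = Re (ap_inner (X n) (\<lambda>t. X n t - p t)) + Re (ap_inner (X n) p)"
      using mem pA by (simp add: R.nrm_sq R.ip_diff_right)
    also have "\<dots> \<le> norm (ap_inner (X n) (\<lambda>t. X n t - p t)) + norm (ap_inner (X n) p)"
      by (intro add_mono complex_Re_le_cmod)
    also have "norm (ap_inner (X n) (\<lambda>t. X n t - p t)) \<le> ap_norm (X n) * ap_norm (\<lambda>t. X n t - p t)"
      using mem pA by (intro R.cauchy_schwarz R.diff_mem)
    also have "\<dots> \<le> B * (2 * \<epsilon>)" using B close R.nrm_nonneg[OF R.diff_mem[OF mem pA]] by (intro mult_mono) auto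
    also have "\<dots> \<le> (B + 1) * (2 * \<epsilon>)" using \<epsilon> by (intro mult_right_mono) auto
    also have "\<dots> = r\<^sup>2 / 2" using B by (simp add: \<epsilon>_def field_simps)
    finally have "(ap_norm (X n))\<^sup>2 < r\<^sup>2" using N'[of n] n by simp
    then show ?thesis using r mem by (simp add: power2_less_imp_less)
  qed
  then show "\<exists>no. \<forall>n\<ge>no. norm (ap_norm (X n) - 0) < r" by blast
qed

text \<open>
  The difference of two representatives is a Cauchy sequence whose Fourier coefficients tend to zero.
\<close>

lemma AP2_eqI:
  assumes F: "F \<in> AP2" and G: "G \<in> AP2"
    and eq: "\<And>\<nu>. AP2_inner F (AP2_of (ap_exp \<nu>)) = AP2_inner G (AP2_of (ap_exp \<nu>))"
  shows "F = G"
proof -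
  obtain X where X: "X \<in> AP_cauchy" "F = AP_rel `` {X}" using F unfolding AP2_def by (rule quotientE)
  obtain Y where Y: "Y \<in> AP_cauchy" "G = AP_rel `` {Y}" using G unfolding AP2_def by (rule quotientE)
  have mem: "X n \<in> AP_R" "Y n \<in> AP_R" for n using X(1) Y(1) by (auto intro: AP_cauchy_mem)
  have "(\<lambda>n. ap_norm (\<lambda>t. X n t - Y n t)) \<longlonglongrightarrow> 0"
  proof (rule AP_cauchy_null[OF AP_cauchy_diff[OF X(1) Y(1)]])
    fix \<nu>
    show "(\<lambda>n. ap_inner (\<lambda>t. X n t - Y n t) (ap_exp \<nu>)) \<longlonglongrightarrow> 0"
      using tendsto_diff[OF AP2_coefficient_tendsto[OF X(1), of "ap_exp \<nu>"] AP2_coefficient_tendsto[OF Y(1), of "ap_exp \<nu>"]]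
        eq[of \<nu>] X(2) Y(2) mem by (simp add: R.ip_diff_left)
  qed
  then have "(X, Y) \<in> AP_rel" using X Y by (intro AP_relI)
  then show ?thesis unfolding X(2) Y(2) by (rule equiv_class_eq[OF equiv_AP_rel])
qed

lemma ap_exp_sum_inner:
  "finite A \<Longrightarrow> ap_inner (\<lambda>t. \<Sum>\<nu>\<in>A. c \<nu> * ap_exp \<nu> t) (ap_exp \<mu>) = (if \<mu> \<in> A then c \<mu> else 0)"
  by (simp add: R.ip_sum_left[of A "\<lambda>\<nu> t. c \<nu> * ap_exp \<nu> t"] R.cmult_mem R.ip_cmult_left ap_exp_orthonormal
      if_distrib[of "\<lambda>x. _ * x"] cong: if_cong)

lemma ap_exp_sum_norm:
  "finite A \<Longrightarrow> (ap_norm (\<lambda>t. \<Sum>\<nu>\<in>A. c \<nu> * ap_exp \<nu> t))\<^sup>2 = (\<Sum>\<nu>\<in>A. (norm (c \<nu>))\<^sup>2)"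
  by (rule R.nrm_orthonormal_sum) (auto simp: ap_exp_orthonormal)

text \<open>
  The partial sums are taken over finite sets \<open>A n\<close> that exhaust the square sum up to \<open>1 / (n + 1)\<close>. Any
  two of them then differ by little, without being nested, and a frequency with a nonzero coefficient
  belongs to \<open>A n\<close> from some \<open>n\<close> on.
\<close>

theorem riesz_fischer:
  fixes c :: "real \<Rightarrow> complex"
  assumes bound: "\<And>A. finite A \<Longrightarrow> (\<Sum>\<nu>\<in>A. (norm (c \<nu>))\<^sup>2) \<le> S"
  shows "\<exists>F\<in>AP2. (\<forall>\<nu>. AP2_inner F (AP2_of (ap_exp \<nu>)) = c \<nu>) \<and> AP2_norm F \<le> sqrt S"
proof -
  define s where "s A = (\<Sum>\<nu>\<in>A. (norm (c \<nu>))\<^sup>2)" for A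
  define L where "L = (SUP A\<in>{A. finite A}. s A)"
  have bdd: "bdd_above (s ` {A. finite A})" using bound by (auto simp: s_def intro!: bdd_aboveI2)
  have sL: "s A \<le> L" if "finite A" for A unfolding L_def using that by (intro cSUP_upper bdd) auto
  have "\<exists>A. finite A \<and> L - 1 / real (Suc n) < s A" for n
    using less_cSUP_iff[of "{A::real set. finite A}" s "L - 1 / real (Suc n)"] bdd
    unfolding L_def by auto
  then obtain A where A: "\<And>n. finite (A n)" "\<And>n. L - 1 / real (Suc n) < s (A n)" by metis
  have tail: "s (B - A n) \<le> 1 / real (Suc n)" if "finite B" for B n
  proof -
    have "s (B - A n) + s (A n) = s (B \<union> A n)"
      unfolding s_def using that A(1) by (subst sum.union_disjoint[symmetric]) (auto intro!: sum.cong)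
    then show ?thesis using sL[of "B \<union> A n"] A(2)[of n] that A(1) by simp
  qed
  define X where "X n = (\<lambda>t. \<Sum>\<nu>\<in>A n. c \<nu> * ap_exp \<nu> t)" for n
  have mem: "X n \<in> AP_R" for n unfolding X_def by (intro R.sum_mem R.cmult_mem A ap_exp_mem)
  have dist: "(ap_norm (\<lambda>t. X m t - X n t))\<^sup>2 \<le> 1 / real (Suc m) + 1 / real (Suc n)" for m n
  proof -
    define d where "d \<nu> = (if \<nu> \<in> A m then c \<nu> else 0) - (if \<nu> \<in> A n then c \<nu> else 0)" for \<nu>
    let ?U = "A m \<union> A n"
    have fin: "finite ?U" using A(1) by simp
    have part: "(\<Sum>\<nu>\<in>?U. (if \<nu> \<in> A k then c \<nu> else 0) * ap_exp \<nu> t) = X k t" if "k = m \<or> k = n" for k t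
      unfolding X_def using fin that by (intro sum.mono_neutral_cong_right) auto
    have "X m t - X n t = (\<Sum>\<nu>\<in>?U. d \<nu> * ap_exp \<nu> t)" for t
      using part[of m t] part[of n t] by (simp add: d_def left_diff_distrib sum_subtractf)
    then have "(ap_norm (\<lambda>t. X m t - X n t))\<^sup>2 = (\<Sum>\<nu>\<in>?U. (norm (d \<nu>))\<^sup>2)"
      using ap_exp_sum_norm[OF fin, of d] by simp
    also have "\<dots> = (\<Sum>\<nu>\<in>(A n - A m) \<union> (A m - A n). (norm (c \<nu>))\<^sup>2)"
      using fin by (intro sum.mono_neutral_cong_right) (auto simp: d_def)
    also have "\<dots> = s (A n - A m) + s (A m - A n)"
      unfolding s_def using A(1) by (intro sum.union_disjoint) auto
    also have "\<dots> \<le> 1 / real (Suc m) + 1 / real (Suc n)" by (intro add_mono tail A)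
    finally show ?thesis .
  qed
  have XC: "X \<in> AP_cauchy"
    unfolding AP_cauchy_def
  proof (intro CollectI conjI allI impI)
    fix \<epsilon> :: real assume \<epsilon>: "\<epsilon> > 0"
    obtain N where N: "inverse (real (Suc N)) < \<epsilon>\<^sup>2 / 2" using reals_Archimedean[of "\<epsilon>\<^sup>2 / 2"] \<epsilon> by auto
    have small: "1 / real (Suc n) < \<epsilon>\<^sup>2 / 2" if "n \<ge> N" for n
    proof -
      have "1 / real (Suc n) \<le> 1 / real (Suc N)" using that by (intro divide_left_mono) auto
      then show ?thesis using N by (simp add: inverse_eq_divide)
    qed
    have "ap_norm (\<lambda>t. X m t - X n t) < \<epsilon>" if "m \<ge> N" "n \<ge> N" for m n
      using dist[of m n] small[OF that(1)] small[OF that(2)] \<epsilon> by (intro power2_less_imp_less[of _ \<epsilon>]) auto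
    then show "\<exists>N. \<forall>m\<ge>N. \<forall>n\<ge>N. ap_norm (\<lambda>t. X m t - X n t) < \<epsilon>" by blast
  qed (rule mem)
  show ?thesis
  proof (intro bexI[of _ "AP_rel `` {X}"] conjI allI)
    show "AP_rel `` {X} \<in> AP2" unfolding AP2_def using XC by (rule quotientI)
    show "AP2_norm (AP_rel `` {X}) \<le> sqrt S"
      using bound A(1) XC by (intro AP2_norm_le real_le_rsqrt) (simp_all add: X_def ap_exp_sum_norm)
    fix \<nu>
    have "(\<lambda>n. ap_inner (X n) (ap_exp \<nu>)) \<longlonglongrightarrow> c \<nu>"
    proof (cases "c \<nu> = 0")
      case True
      have "ap_inner (X n) (ap_exp \<nu>) = c \<nu>" for n
        using A(1) True by (simp add: X_def ap_exp_sum_inner)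
      then show ?thesis by simp
    next
      case False
      have "eventually (\<lambda>n. ap_inner (X n) (ap_exp \<nu>) = c \<nu>) sequentially"
      proof -
        obtain N where N: "inverse (real (Suc N)) < (norm (c \<nu>))\<^sup>2"
          using reals_Archimedean[of "(norm (c \<nu>))\<^sup>2"] False by auto
        have "\<nu> \<in> A n" if "n \<ge> N" for n
        proof (rule ccontr)
          assume "\<nu> \<notin> A n"
          then have "{\<nu>} - A n = {\<nu>}" by auto
          then have "(norm (c \<nu>))\<^sup>2 \<le> 1 / real (Suc n)" using tail[of "{\<nu>}" n] by (simp add: s_def)
          also have "\<dots> \<le> 1 / real (Suc N)" using that by (intro divide_left_mono) auto
          finally show False using N by (simp add: inverse_eq_divide)
        qed
        then have "\<forall>n\<ge>N. ap_inner (X n) (ap_exp \<nu>) = c \<nu>"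
          using A(1) by (simp add: X_def ap_exp_sum_inner)
        then show ?thesis unfolding eventually_sequentially by blast
      qed
      then show ?thesis by (rule tendsto_eventually)
    qed
    then show "AP2_inner (AP_rel `` {X}) (AP2_of (ap_exp \<nu>)) = c \<nu>"
      using AP2_coefficient_tendsto[OF XC, of "ap_exp \<nu>"] LIMSEQ_unique by (metis ap_exp_mem)
  qed
qed

section \<open>Lattice sums of Wiener functions\<close>

definition lattice_sums_le :: "(real \<Rightarrow> complex) \<Rightarrow> real \<Rightarrow> real \<Rightarrow> bool" where
  "lattice_sums_le \<phi> h D \<longleftrightarrow> (\<forall>x L. finite L \<longrightarrow> (\<Sum>l\<in>L. norm (\<phi> (x - of_int l * h))) \<le> D)"

lemma lattice_sums_leD:
  "lattice_sums_le \<phi> h D \<Longrightarrow> finite L \<Longrightarrow> (\<Sum>l\<in>L. norm (\<phi> (x - of_int l * h))) \<le> D"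
  by (simp add: lattice_sums_le_def)

lemma lattice_sums_le_nonneg: "lattice_sums_le \<phi> h D \<Longrightarrow> D \<ge> 0"
  using lattice_sums_leD[of \<phi> h D "{}"] by simp

text \<open>
  Each half-open unit interval contains at most \<open>1/h + 1\<close> points of a translate of the lattice \<open>h\<int>\<close>, and the
  suprema of \<open>|\<phi>|\<close> over the unit intervals are summable.
\<close>

lemma wiener_lattice_sum_bounded:
  assumes \<phi>: "\<phi> \<in> W0" and h: "h > 0"
  shows "\<exists>D. lattice_sums_le \<phi> h D"
proof -
  define s where "s k = (SUP x\<in>{0..1}. norm (\<phi> (x - of_int k)))" for k :: int
  have cont: "continuous_on UNIV \<phi>" and sum: "s summable_on UNIV"
    using \<phi> by (auto simp: W0_def s_def[abs_def])
  have le: "norm (\<phi> (x - of_int k)) \<le> s k" if "x \<in> {0..1}" for x k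
    unfolding s_def
  proof (rule cSUP_upper[OF that])
    have "compact ((\<lambda>x. norm (\<phi> (x - of_int k))) ` {0..1})"
      by (intro compact_continuous_image continuous_intros continuous_on_compose2[OF cont]) auto
    then show "bdd_above ((\<lambda>x. norm (\<phi> (x - of_int k))) ` {0..1})"
      by (intro bounded_imp_bdd_above compact_imp_bounded)
  qed
  have le': "norm (\<phi> y) \<le> s (- \<lfloor>y\<rfloor>)" for y
    using le[of "y - of_int \<lfloor>y\<rfloor>" "- \<lfloor>y\<rfloor>"] by (simp add: le_floor_iff) linarith
  have s0: "s k \<ge> 0" for k using order_trans[OF norm_ge_zero le[of 0 k]] by simp
  define N where "N = nat (\<lfloor>1 / h\<rfloor> + 1)"
  have fibre: "card {l\<in>L. - \<lfloor>x - of_int l * h\<rfloor> = k} \<le> N" if L: "finite L" for L :: "int set" and x k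
  proof (cases "{l\<in>L. - \<lfloor>x - of_int l * h\<rfloor> = k} = {}")
    case False
    define m where "m = Min {l\<in>L. - \<lfloor>x - of_int l * h\<rfloor> = k}"
    have m: "m \<in> {l\<in>L. - \<lfloor>x - of_int l * h\<rfloor> = k}" unfolding m_def using L False by (intro Min_in) auto
    have "{l\<in>L. - \<lfloor>x - of_int l * h\<rfloor> = k} \<subseteq> {m..m + \<lfloor>1 / h\<rfloor>}"
    proof
      fix l assume l: "l \<in> {l\<in>L. - \<lfloor>x - of_int l * h\<rfloor> = k}"
      have "m \<le> l" unfolding m_def using L l by (intro Min_le) auto
      have "\<lfloor>x - of_int l * h\<rfloor> = \<lfloor>x - of_int m * h\<rfloor>" using l m by simp
      then have "(x - of_int m * h) - (x - of_int l * h) < 1" by linarith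
      then have "real_of_int (l - m) * h < 1" by (simp add: algebra_simps)
      then have "real_of_int (l - m) \<le> 1 / h" using h by (simp add: field_simps)
      then have "l - m \<le> \<lfloor>1 / h\<rfloor>" by (simp only: le_floor_iff)
      then show "l \<in> {m..m + \<lfloor>1 / h\<rfloor>}" using \<open>m \<le> l\<close> by simp
    qed
    then have "card {l\<in>L. - \<lfloor>x - of_int l * h\<rfloor> = k} \<le> card {m..m + \<lfloor>1 / h\<rfloor>}" by (intro card_mono) auto
    then show ?thesis by (simp add: N_def)
  next
    case True
    then show ?thesis by (simp only: card.empty)
  qed
  show ?thesis
    unfolding lattice_sums_le_def
  proof (intro exI[of _ "real N * infsum s UNIV"] allI impI)
    fix x and L :: "int set" assume L: "finite L"
    let ?\<kappa> = "\<lambda>l. - \<lfloor>x - of_int l * h\<rfloor>"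
    have "(\<Sum>l\<in>L. norm (\<phi> (x - of_int l * h))) \<le> (\<Sum>l\<in>L. s (?\<kappa> l))" by (intro sum_mono le')
    also have "\<dots> = (\<Sum>k\<in>?\<kappa> ` L. \<Sum>l\<in>{l\<in>L. ?\<kappa> l = k}. s (?\<kappa> l))" by (rule sum.image_gen[OF L])
    also have "\<dots> = (\<Sum>k\<in>?\<kappa> ` L. real (card {l\<in>L. ?\<kappa> l = k}) * s k)" by (intro sum.cong refl) simp
    also have "\<dots> \<le> (\<Sum>k\<in>?\<kappa> ` L. real N * s k)"
      using fibre[OF L] s0 by (intro sum_mono mult_right_mono) auto
    also have "\<dots> = real N * sum s (?\<kappa> ` L)" by (simp add: sum_distrib_left)
    also have "\<dots> \<le> real N * infsum s UNIV"
      using L s0 by (intro mult_left_mono finite_sum_le_infsum sum) auto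
    finally show "(\<Sum>l\<in>L. norm (\<phi> (x - of_int l * h))) \<le> real N * infsum s UNIV" .
  qed
qed

lemma weighted_cauchy_schwarz:
  fixes w c :: "'i \<Rightarrow> complex"
  shows "(norm (\<Sum>i\<in>I. w i * c i))\<^sup>2 \<le> (\<Sum>i\<in>I. norm (w i)) * (\<Sum>i\<in>I. norm (w i) * (norm (c i))\<^sup>2)"
proof -
  have "norm (\<Sum>i\<in>I. w i * c i) \<le> (\<Sum>i\<in>I. sqrt (norm (w i)) * (sqrt (norm (w i)) * norm (c i)))"
    by (rule order_trans[OF norm_sum]) (intro sum_mono, simp add: norm_mult flip: mult.assoc)
  then have "(norm (\<Sum>i\<in>I. w i * c i))\<^sup>2 \<le> (\<Sum>i\<in>I. sqrt (norm (w i)) * (sqrt (norm (w i)) * norm (c i)))\<^sup>2"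
    by (intro power_mono) auto
  also have "\<dots> \<le> (\<Sum>i\<in>I. (sqrt (norm (w i)))\<^sup>2) * (\<Sum>i\<in>I. (sqrt (norm (w i)) * norm (c i))\<^sup>2)"
    by (rule Cauchy_Schwarz_ineq_sum)
  finally show ?thesis by (simp add: power_mult_distrib)
qed

text \<open>
  Frequencies with the same value of \<open>cis (\<nu> * \<alpha>)\<close> lie in one translate of \<open>(2\<pi>/\<alpha>)\<int>\<close>.
\<close>

lemma periodization_fibre_bound:
  assumes \<alpha>: "\<alpha> > 0" and D: "lattice_sums_le \<phi> (2 * pi / \<alpha>) D"
    and W: "finite W" "\<And>\<nu>. \<nu> \<in> W \<Longrightarrow> cis (\<nu> * \<alpha>) = z"
  shows "(\<Sum>\<nu>\<in>W. norm (\<phi> (\<nu> - y))) \<le> D"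
proof (cases "W = {}")
  case False
  then obtain \<mu> where \<mu>: "\<mu> \<in> W" by blast
  have "\<exists>n::int. \<nu> = \<mu> - of_int n * (2 * pi / \<alpha>)" if "\<nu> \<in> W" for \<nu>
  proof -
    have "cis (\<mu> * \<alpha> - \<nu> * \<alpha>) = 1" using W(2)[OF \<mu>] W(2)[OF that] cis_neq_zero[of "\<nu> * \<alpha>"] by (simp flip: cis_divide)
    then have "exp (\<i> * of_real (\<mu> * \<alpha> - \<nu> * \<alpha>)) = 1" by (simp add: cis_conv_exp)
    then obtain n :: int where "\<mu> * \<alpha> - \<nu> * \<alpha> = of_int (2 * n) * pi" by (auto simp: exp_eq_1)
    then have "\<nu> = \<mu> - of_int n * (2 * pi / \<alpha>)" using \<alpha> by (simp add: field_simps)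
    then show ?thesis by blast
  qed
  then obtain j where j: "\<And>\<nu>. \<nu> \<in> W \<Longrightarrow> \<nu> = \<mu> - of_int (j \<nu>) * (2 * pi / \<alpha>)" by metis
  then have "inj_on j W" by (metis inj_onI)
  have "(\<Sum>\<nu>\<in>W. norm (\<phi> (\<nu> - y))) = (\<Sum>\<nu>\<in>W. norm (\<phi> ((\<mu> - y) - of_int (j \<nu>) * (2 * pi / \<alpha>))))"
    by (intro sum.cong refl arg_cong[where f = norm] arg_cong[where f = \<phi>]) (use j in \<open>simp add: algebra_simps\<close>)
  also have "\<dots> = (\<Sum>l\<in>j ` W. norm (\<phi> ((\<mu> - y) - of_int l * (2 * pi / \<alpha>))))"
    using \<open>inj_on j W\<close> by (simp add: sum.reindex)
  also have "\<dots> \<le> D" using W by (intro lattice_sums_leD[OF D]) auto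
  finally show ?thesis .
qed (use lattice_sums_le_nonneg[OF D] in simp)

section \<open>Sampled exponentials and the synthesis coefficients\<close>

text \<open>
  The argument of a unit complex number picks one frequency from each class of frequencies that
  agree on the integers.
\<close>

lemma apz_exp_Arg: "apz_exp (Arg (cis \<theta>)) = apz_exp \<theta>"
  by (rule apz_exp_cong) (simp add: cis_Arg sgn_cis)

lemma apz_exp_Arg_orthonormal:
  assumes "z \<in> range cis" "z' \<in> range cis"
  shows "apz_inner (apz_exp (Arg z)) (apz_exp (Arg z')) = (if z = z' then 1 else 0)"
  using assms by (auto simp: apz_exp_orthonormal cis_Arg sgn_cis)

lemma sum_over_fibres:
  fixes h :: "real \<Rightarrow> complex \<Rightarrow> 'a::comm_monoid_add"
  assumes "finite V"
  shows "(\<Sum>\<nu>\<in>V. h \<nu> (g \<nu>)) = (\<Sum>z\<in>g ` V. \<Sum>\<nu>\<in>{\<nu>\<in>V. g \<nu> = z}. h \<nu> z)"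
  unfolding sum.image_gen[OF assms, of _ g] by (intro sum.cong refl) simp

text \<open>
  Frequencies \<open>\<nu>\<close> in the same fibre of \<open>\<nu> \<mapsto> cis (\<nu> * \<alpha>)\<close> share their Fourier coefficient. Each fibre
  contributes at most the factor \<open>D\<close>, and the characters of distinct fibres are orthonormal.
\<close>

lemma apz_exp_bessel_fibres:
  assumes \<alpha>: "\<alpha> > 0" and D: "lattice_sums_le \<phi> (2 * pi / \<alpha>) D"
    and V: "finite V" and a: "a \<in> AP_Z"
  shows "(\<Sum>\<nu>\<in>V. norm (\<phi> (\<nu> - y)) * (norm (apz_inner a (apz_exp (\<nu> * \<alpha>))))\<^sup>2) \<le> D * (apz_norm a)\<^sup>2"
proof -
  define g where "g \<nu> = cis (\<nu> * \<alpha>)" for \<nu>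
  define q where "q z = (norm (apz_inner a (apz_exp (Arg z))))\<^sup>2" for z
  have "(\<Sum>\<nu>\<in>V. norm (\<phi> (\<nu> - y)) * (norm (apz_inner a (apz_exp (\<nu> * \<alpha>))))\<^sup>2) = (\<Sum>\<nu>\<in>V. norm (\<phi> (\<nu> - y)) * q (g \<nu>))"
    by (simp add: q_def g_def apz_exp_Arg)
  also have "\<dots> = (\<Sum>z\<in>g ` V. (\<Sum>\<nu>\<in>{\<nu>\<in>V. g \<nu> = z}. norm (\<phi> (\<nu> - y))) * q z)"
    unfolding sum_over_fibres[OF V, of "\<lambda>\<nu> z. norm (\<phi> (\<nu> - y)) * q z" g] sum_distrib_right ..
  also have "\<dots> \<le> (\<Sum>z\<in>g ` V. D * q z)"
    using V by (intro sum_mono mult_right_mono periodization_fibre_bound[OF \<alpha> D]) (auto simp: g_def q_def)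
  also have "\<dots> = D * (\<Sum>z\<in>g ` V. q z)" by (simp add: sum_distrib_left)
  also have "\<dots> \<le> D * (apz_norm a)\<^sup>2"
    unfolding q_def using V
    by (intro mult_left_mono Z.bessel a lattice_sums_le_nonneg[OF D] apz_exp_Arg_orthonormal) (auto simp: g_def)
  finally show ?thesis .
qed

text \<open>
  Dual to the preceding bound: after collecting the terms of each fibre the characters are
  orthonormal, and the Cauchy-Schwarz inequality controls the sum over a fibre.
\<close>

lemma apz_exp_sum_norm_fibres:
  assumes \<alpha>: "\<alpha> > 0" and D: "lattice_sums_le \<phi> (2 * pi / \<alpha>) D" and V: "finite V"
  shows "(apz_norm (\<lambda>k. \<Sum>\<nu>\<in>V. cnj (\<phi> (\<nu> - y)) * c \<nu> * apz_exp (\<nu> * \<alpha>) k))\<^sup>2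
    \<le> D * (\<Sum>\<nu>\<in>V. norm (\<phi> (\<nu> - y)) * (norm (c \<nu>))\<^sup>2)"
proof -
  define g where "g \<nu> = cis (\<nu> * \<alpha>)" for \<nu>
  define w where "w \<nu> = cnj (\<phi> (\<nu> - y)) * c \<nu>" for \<nu>
  have "(\<Sum>\<nu>\<in>V. w \<nu> * apz_exp (\<nu> * \<alpha>) k) = (\<Sum>z\<in>g ` V. (\<Sum>\<nu>\<in>{\<nu>\<in>V. g \<nu> = z}. w \<nu>) * apz_exp (Arg z) k)" for k
    unfolding sum_distrib_right sum_over_fibres[OF V, of "\<lambda>\<nu> z. w \<nu> * apz_exp (Arg z) k" g, symmetric]
    by (simp add: g_def apz_exp_Arg)
  then have "(apz_norm (\<lambda>k. \<Sum>\<nu>\<in>V. w \<nu> * apz_exp (\<nu> * \<alpha>) k))\<^sup>2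
      = (apz_norm (\<lambda>k. \<Sum>z\<in>g ` V. (\<Sum>\<nu>\<in>{\<nu>\<in>V. g \<nu> = z}. w \<nu>) * apz_exp (Arg z) k))\<^sup>2"
    by simp
  also have "\<dots> = (\<Sum>z\<in>g ` V. (norm (\<Sum>\<nu>\<in>{\<nu>\<in>V. g \<nu> = z}. w \<nu>))\<^sup>2)"
    using V by (intro Z.nrm_orthonormal_sum apz_exp_Arg_orthonormal) (auto simp: g_def)
  also have "\<dots> \<le> (\<Sum>z\<in>g ` V. D * (\<Sum>\<nu>\<in>{\<nu>\<in>V. g \<nu> = z}. norm (\<phi> (\<nu> - y)) * (norm (c \<nu>))\<^sup>2))"
  proof (rule sum_mono)
    fix z
    have "(norm (\<Sum>\<nu>\<in>{\<nu>\<in>V. g \<nu> = z}. w \<nu>))\<^sup>2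
        \<le> (\<Sum>\<nu>\<in>{\<nu>\<in>V. g \<nu> = z}. norm (cnj (\<phi> (\<nu> - y)))) * (\<Sum>\<nu>\<in>{\<nu>\<in>V. g \<nu> = z}. norm (cnj (\<phi> (\<nu> - y))) * (norm (c \<nu>))\<^sup>2)"
      unfolding w_def by (rule weighted_cauchy_schwarz)
    also have "\<dots> \<le> D * (\<Sum>\<nu>\<in>{\<nu>\<in>V. g \<nu> = z}. norm (\<phi> (\<nu> - y)) * (norm (c \<nu>))\<^sup>2)"
      unfolding complex_mod_cnj
      using V by (intro mult_right_mono periodization_fibre_bound[OF \<alpha> D] sum_nonneg) (auto simp: g_def)
    finally show "(norm (\<Sum>\<nu>\<in>{\<nu>\<in>V. g \<nu> = z}. w \<nu>))\<^sup>2 \<le> D * (\<Sum>\<nu>\<in>{\<nu>\<in>V. g \<nu> = z}. norm (\<phi> (\<nu> - y)) * (norm (c \<nu>))\<^sup>2)" .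
  qed
  also have "\<dots> = D * (\<Sum>\<nu>\<in>V. norm (\<phi> (\<nu> - y)) * (norm (c \<nu>))\<^sup>2)"
    unfolding sum_distrib_left[symmetric] by (simp only: sum.image_gen[OF V, of _ g, symmetric])
  finally show ?thesis by (simp only: w_def)
qed

lemma l2_APZ_norm_le:
  assumes a: "a \<in> l2_APZ"
  shows "apz_norm (a l) \<le> l2_norm a"
proof -
  have "(\<Sum>l\<in>{l}. (apz_norm (a l))\<^sup>2) \<le> (\<Sum>\<^sub>\<infinity>l. (apz_norm (a l))\<^sup>2)"
    using a by (intro finite_sum_le_infsum) (auto simp: l2_APZ_def)
  then show ?thesis unfolding l2_norm_def by (intro real_le_rsqrt) simp
qed

lemma l2_norm_sq: "(l2_norm a)\<^sup>2 = (\<Sum>\<^sub>\<infinity>l. (apz_norm (a l))\<^sup>2)"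
  unfolding l2_norm_def by (simp add: infsum_nonneg)

text \<open>
  For finitely many \<open>\<ell>\<close> and \<open>\<nu>\<close> this is the Schur test. The bound passes to the infinite sums over
  \<open>\<ell>\<close> because it involves only finitely many \<open>\<nu>\<close> at a time.
\<close>

lemma synthesis_coefficients:
  fixes \<phi> :: "real \<Rightarrow> complex"
  assumes \<alpha>: "\<alpha> > 0"
    and A: "lattice_sums_le \<phi> \<beta> A"
    and D: "lattice_sums_le \<phi> (2 * pi / \<alpha>) D"
    and a: "a \<in> l2_APZ"
  shows "\<exists>c. (\<forall>\<nu>. ((\<lambda>l::int. \<phi> (\<nu> - of_int l * \<beta>) * apz_inner (a l) (apz_exp (\<nu> * \<alpha>))) has_sum c \<nu>) UNIV) \<and>
    (\<forall>V. finite V \<longrightarrow> (\<Sum>\<nu>\<in>V. (norm (c \<nu>))\<^sup>2) \<le> A * D * (l2_norm a)\<^sup>2)"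
proof -
  note nn = lattice_sums_le_nonneg[OF A] lattice_sums_le_nonneg[OF D]
  have aZ: "a l \<in> AP_Z" for l using a by (simp add: l2_APZ_def)
  define t where "t \<nu> l = \<phi> (\<nu> - of_int l * \<beta>) * apz_inner (a l) (apz_exp (\<nu> * \<alpha>))" for \<nu> and l :: int
  have one: "apz_norm (apz_exp \<theta>) \<le> 1" for \<theta>
    by (rule Z.nrm_le_bound) (simp_all add: apz_exp_cis AP_Z_cis)
  have inner_le: "norm (apz_inner (a l) (apz_exp \<theta>)) \<le> l2_norm a" for l \<theta>
  proof -
    have "norm (apz_inner (a l) (apz_exp \<theta>)) \<le> apz_norm (a l) * apz_norm (apz_exp \<theta>)"
      by (intro Z.cauchy_schwarz aZ apz_exp_mem)
    also have "\<dots> \<le> l2_norm a * 1"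
      using l2_APZ_norm_le[OF a] one aZ order_trans[OF Z.nrm_nonneg[OF aZ] l2_APZ_norm_le[OF a]]
      by (intro mult_mono) auto
    finally show ?thesis by simp
  qed
  have "t \<nu> summable_on UNIV" for \<nu>
  proof (rule abs_summable_summable)
    have "(\<Sum>l\<in>L. norm (t \<nu> l)) \<le> A * l2_norm a" if "finite L" for L
    proof -
      have "(\<Sum>l\<in>L. norm (t \<nu> l)) \<le> (\<Sum>l\<in>L. norm (\<phi> (\<nu> - of_int l * \<beta>)) * l2_norm a)"
        unfolding t_def norm_mult by (intro sum_mono mult_left_mono inner_le) auto
      also have "\<dots> \<le> A * l2_norm a"
        unfolding sum_distrib_right[symmetric] using order_trans[OF norm_ge_zero inner_le]
        by (intro mult_right_mono lattice_sums_leD[OF A] that)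
      finally show ?thesis .
    qed
    then show "(\<lambda>l. norm (t \<nu> l)) summable_on UNIV"
      by (intro nonneg_bdd_above_summable_on bdd_aboveI2) auto
  qed
  then have hs: "(t \<nu> has_sum infsum (t \<nu>) UNIV) UNIV" for \<nu> by simp
  let ?q = "\<lambda>\<nu> l. norm (\<phi> (\<nu> - of_int l * \<beta>)) * (norm (apz_inner (a l) (apz_exp (\<nu> * \<alpha>))))\<^sup>2"
  have fin: "(\<Sum>\<nu>\<in>V. (norm (\<Sum>l\<in>L. t \<nu> l))\<^sup>2) \<le> A * D * (l2_norm a)\<^sup>2"
    if V: "finite V" and L: "finite L" for V L
  proof -
    have "(\<Sum>\<nu>\<in>V. (norm (\<Sum>l\<in>L. t \<nu> l))\<^sup>2)
        \<le> (\<Sum>\<nu>\<in>V. A * (\<Sum>l\<in>L. ?q \<nu> l))"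
      unfolding t_def
      by (intro sum_mono order_trans[OF weighted_cauchy_schwarz] mult_right_mono lattice_sums_leD[OF A] L sum_nonneg) auto
    also have "\<dots> = A * (\<Sum>l\<in>L. \<Sum>\<nu>\<in>V. ?q \<nu> l)"
      unfolding sum_distrib_left[symmetric] by (subst sum.swap) (rule refl)
    also have "\<dots> \<le> A * (\<Sum>l\<in>L. D * (apz_norm (a l))\<^sup>2)"
      using nn V by (intro mult_left_mono sum_mono apz_exp_bessel_fibres[OF \<alpha> D] aZ) auto
    also have "\<dots> = A * D * (\<Sum>l\<in>L. (apz_norm (a l))\<^sup>2)" by (simp add: sum_distrib_left mult.assoc)
    also have "\<dots> \<le> A * D * (l2_norm a)\<^sup>2"
      unfolding l2_norm_sq using nn a L by (intro mult_left_mono finite_sum_le_infsum) (auto simp: l2_APZ_def)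
    finally show ?thesis .
  qed
  show ?thesis
  proof (intro exI[of _ "\<lambda>\<nu>. infsum (t \<nu>) UNIV"] conjI allI impI)
    show "((\<lambda>l. \<phi> (\<nu> - of_int l * \<beta>) * apz_inner (a l) (apz_exp (\<nu> * \<alpha>))) has_sum infsum (t \<nu>) UNIV) UNIV" for \<nu>
      using hs[of \<nu>] unfolding t_def .
    fix V :: "real set" assume V: "finite V"
    have lim: "((\<lambda>L. \<Sum>\<nu>\<in>V. (norm (\<Sum>l\<in>L. t \<nu> l))\<^sup>2) \<longlongrightarrow> (\<Sum>\<nu>\<in>V. (norm (infsum (t \<nu>) UNIV))\<^sup>2))
        (finite_subsets_at_top UNIV)"
      using hs unfolding has_sum_def by (intro tendsto_intros) auto
    show "(\<Sum>\<nu>\<in>V. (norm (infsum (t \<nu>) UNIV))\<^sup>2) \<le> A * D * (l2_norm a)\<^sup>2"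
    proof (rule tendsto_upperbound[OF lim])
      show "\<forall>\<^sub>F L in finite_subsets_at_top UNIV. (\<Sum>\<nu>\<in>V. (norm (\<Sum>l\<in>L. t \<nu> l))\<^sup>2) \<le> A * D * (l2_norm a)\<^sup>2"
        by (rule eventually_finite_subsets_at_top_weakI) (rule fin[OF V])
    qed simp
  qed
qed

section \<open>Gabor coefficients of almost periodic functions\<close>

lemma lebesgue_translate: "distr lebesgue lebesgue (\<lambda>x. s + x) = (lebesgue :: real measure)"
  using lebesgue_real_affine[of 1 s] by (simp add: density_1)

lemma measurable_lebesgue_translate: "(\<lambda>x. s + x) \<in> lebesgue \<rightarrow>\<^sub>M (lebesgue :: real measure)"
  using lebesgue_affine_measurable[of "\<lambda>_. 1" s] by simp

lemma lebesgue_integral_translate: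
  fixes f :: "real \<Rightarrow> complex"
  assumes "f \<in> borel_measurable lebesgue"
  shows "(LINT t|lebesgue. f (s + t)) = (LINT t|lebesgue. f t)"
  using integral_distr[OF measurable_lebesgue_translate assms, of s] by (simp add: lebesgue_translate)

lemma integrable_bounded_continuous_mult:
  fixes f :: "real \<Rightarrow> complex"
  assumes f: "continuous_on UNIV f" "\<And>t. norm (f t) \<le> B" and g: "integrable lebesgue g"
  shows "integrable lebesgue (\<lambda>t. f t * g t)"
proof (rule Bochner_Integration.integrable_bound)
  show "integrable lebesgue (\<lambda>t. B * norm (g t))" using g by simp
  have "f \<in> borel_measurable lebesgue"
    using continuous_imp_measurable_on_sets_lebesgue[OF f(1)] by (simp add: lebesgue_on_UNIV_eq)
  then show "(\<lambda>t. f t * g t) \<in> borel_measurable lebesgue"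
    using g by (intro borel_measurable_times) auto
  have "norm (f t * g t) \<le> norm (B * norm (g t))" for t
    using f(2)[of t] order_trans[OF norm_ge_zero f(2)[of t]]
    by (simp add: norm_mult mult_right_mono)
  then show "AE t in lebesgue. norm (f t * g t) \<le> norm (B * norm (g t))" by simp
qed

lemma modul_integrable:
  assumes "integrable lebesgue \<psi>"
  shows "integrable lebesgue (modul \<omega> \<psi>)"
  unfolding modul_def[abs_def]
  by (rule integrable_bounded_continuous_mult[where B = 1]) (auto intro!: continuous_intros assms)

text \<open>
  Moving the translation from the window to \<open>f\<close> exhibits the coefficients as samples of a convolution
  of \<open>f\<close> with an integrable function.
\<close>

lemma gabor_coeffs_eq:
  assumes f: "f \<in> AP_R" and \<psi>: "integrable lebesgue \<psi>"
  shows "gabor_coeffs \<alpha> \<beta> \<psi> f l k = (LINT u|lebesgue. f (u + \<alpha> * of_int k) * cnj (modul (\<beta> * of_int l) \<psi> u))"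
    and "integrable lebesgue (\<lambda>u. f (u + s) * cnj (modul (\<beta> * of_int l) \<psi> u))"
proof -
  obtain B where B: "\<And>t. norm (f t) \<le> B" "B \<ge> 0" using AP_R_bounded[OF f] by blast
  show int: "integrable lebesgue (\<lambda>u. f (u + s) * cnj (modul (\<beta> * of_int l) \<psi> u))" for s
    using B by (intro integrable_bounded_continuous_mult[of _ B] AP_R_continuous AP_R_translate f
        integrable_cnj modul_integrable \<psi>)
  have meas: "(\<lambda>u. f (u + \<alpha> * of_int k) * cnj (modul (\<beta> * of_int l) \<psi> u)) \<in> borel_measurable lebesgue"
    using int by (rule borel_measurable_integrable)
  show "gabor_coeffs \<alpha> \<beta> \<psi> f l k = (LINT u|lebesgue. f (u + \<alpha> * of_int k) * cnj (modul (\<beta> * of_int l) \<psi> u))"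
    using lebesgue_integral_translate[OF meas, of "- (\<alpha> * of_int k)"]
    by (simp add: gabor_coeffs_def bracket_def transl_def)
qed

text \<open>
  Taking \<open>g = f\<close> shows that almost periods are inherited, and taking \<open>k' = k\<close> that the coefficients
  are continuous for the supremum norm.
\<close>

lemma gabor_coeffs_diff_le:
  assumes f: "f \<in> AP_R" and g: "g \<in> AP_R" and \<psi>: "integrable lebesgue \<psi>"
    and le: "\<And>u. norm (f (u + \<alpha> * of_int k) - g (u + \<alpha> * of_int k')) \<le> \<epsilon>"
  shows "norm (gabor_coeffs \<alpha> \<beta> \<psi> f l k - gabor_coeffs \<alpha> \<beta> \<psi> g l k') \<le> \<epsilon> * (LINT t|lebesgue. norm (\<psi> t))"
proof -
  let ?w = "\<lambda>u. cnj (modul (\<beta> * of_int l) \<psi> u)"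
  have "gabor_coeffs \<alpha> \<beta> \<psi> f l k - gabor_coeffs \<alpha> \<beta> \<psi> g l k'
      = (LINT u|lebesgue. f (u + \<alpha> * of_int k) * ?w u - g (u + \<alpha> * of_int k') * ?w u)"
    by (simp add: gabor_coeffs_eq(1) f g \<psi> Bochner_Integration.integral_diff gabor_coeffs_eq(2))
  also have "norm \<dots> \<le> (LINT u|lebesgue. \<epsilon> * norm (\<psi> u))"
  proof (rule Bochner_Integration.integral_norm_bound_integral)
    show "integrable lebesgue (\<lambda>u. f (u + \<alpha> * of_int k) * ?w u - g (u + \<alpha> * of_int k') * ?w u)"
      by (intro Bochner_Integration.integrable_diff gabor_coeffs_eq(2) f g \<psi>)
    show "integrable lebesgue (\<lambda>u. \<epsilon> * norm (\<psi> u))" using \<psi> by simp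
    show "norm (f (u + \<alpha> * of_int k) * ?w u - g (u + \<alpha> * of_int k') * ?w u) \<le> \<epsilon> * norm (\<psi> u)" for u
      using le[of u] by (simp add: norm_mult modul_def mult_right_mono flip: left_diff_distrib)
  qed
  finally show ?thesis by simp
qed

text \<open>
  Sampling on \<open>\<alpha>\<int>\<close> turns a Bohr set of the line into the Bohr set of the integers with frequencies
  multiplied by \<open>\<alpha>\<close>.
\<close>

lemma gabor_coeffs_AP_Z:
  assumes f: "f \<in> AP_R" and \<psi>: "integrable lebesgue \<psi>"
  shows "gabor_coeffs \<alpha> \<beta> \<psi> f l \<in> AP_Z"
  unfolding AP_Z_iff_bohr_ap bohr_ap_def
proof (intro allI impI)
  fix \<epsilon> :: real assume \<epsilon>: "\<epsilon> > 0"
  define I where "I = (LINT t|lebesgue. norm (\<psi> t))"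
  have I: "I \<ge> 0" unfolding I_def by simp
  have ap: "bohr_ap (\<lambda>x. x) f" using f by (simp add: AP_R_iff_bohr_ap)
  have "\<epsilon> / (I + 1) > 0" using \<epsilon> I by simp
  then obtain \<Lambda> \<delta> where L: "finite \<Lambda>" "\<delta> > 0" "\<And>p t. p \<in> bohr_set \<Lambda> \<delta> \<Longrightarrow> norm (f (t + p) - f t) \<le> \<epsilon> / (I + 1)"
    using bohr_apE[OF ap] by blast
  have "norm (gabor_coeffs \<alpha> \<beta> \<psi> f l (n + p) - gabor_coeffs \<alpha> \<beta> \<psi> f l n) \<le> \<epsilon>"
    if p: "real_of_int p \<in> bohr_set ((\<lambda>\<nu>. \<nu> * \<alpha>) ` \<Lambda>) \<delta>" for p n
  proof -
    have "\<alpha> * of_int p \<in> bohr_set \<Lambda> \<delta>" using p by (simp add: bohr_set_def mult.assoc)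
    then have "norm (f (u + \<alpha> * of_int (n + p)) - f (u + \<alpha> * of_int n)) \<le> \<epsilon> / (I + 1)" for u
      using L(3)[of "\<alpha> * of_int p" "u + \<alpha> * of_int n"] by (simp add: algebra_simps)
    then have "norm (gabor_coeffs \<alpha> \<beta> \<psi> f l (n + p) - gabor_coeffs \<alpha> \<beta> \<psi> f l n) \<le> \<epsilon> / (I + 1) * I"
      unfolding I_def by (rule gabor_coeffs_diff_le[OF f f \<psi>])
    also have "\<dots> \<le> \<epsilon> / (I + 1) * (I + 1)" using \<epsilon> I by (intro mult_left_mono) auto
    also have "\<dots> = \<epsilon>" using I by simp
    finally show ?thesis .
  qed
  then show "\<exists>\<Lambda> \<delta>. finite \<Lambda> \<and> 0 < \<delta> \<and> (\<forall>p. real_of_int p \<in> bohr_set \<Lambda> \<delta> \<longrightarrow>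
      (\<forall>t. norm (gabor_coeffs \<alpha> \<beta> \<psi> f l (t + p) - gabor_coeffs \<alpha> \<beta> \<psi> f l t) \<le> \<epsilon>))"
    using L(1,2) by (intro exI[of _ "(\<lambda>\<nu>. \<nu> * \<alpha>) ` \<Lambda>"] exI[of _ \<delta>]) auto
qed

lemma gabor_coeffs_sum:
  assumes V: "finite V" and \<psi>: "integrable lebesgue \<psi>"
  shows "gabor_coeffs \<alpha> \<beta> \<psi> (\<lambda>t. \<Sum>\<nu>\<in>V. c \<nu> * ap_exp \<nu> t) l k
    = (\<Sum>\<nu>\<in>V. cnj (fourier \<psi> (\<nu> - of_int l * \<beta>)) * c \<nu> * apz_exp (\<nu> * \<alpha>) k)"
proof -
  let ?w = "\<lambda>u. cnj (modul (\<beta> * of_int l) \<psi> u)"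
  have p: "(\<lambda>t. \<Sum>\<nu>\<in>V. c \<nu> * ap_exp \<nu> t) \<in> AP_R" using V by (intro R.sum_mem R.cmult_mem ap_exp_mem)
  have int: "integrable lebesgue (\<lambda>u. c \<nu> * (ap_exp \<nu> (u + \<alpha> * of_int k) * ?w u))" for \<nu>
    by (intro integrable_mult_right gabor_coeffs_eq(2) ap_exp_mem \<psi>)
  have one: "(LINT u|lebesgue. ap_exp \<nu> (u + \<alpha> * of_int k) * ?w u)
      = apz_exp (\<nu> * \<alpha>) k * cnj (fourier \<psi> (\<nu> - of_int l * \<beta>))" for \<nu>
  proof -
    have "ap_exp \<nu> (u + \<alpha> * of_int k) * ?w u
        = apz_exp (\<nu> * \<alpha>) k * cnj (\<psi> u * exp (- \<i> * of_real ((\<nu> - of_int l * \<beta>) * u)))" for u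
    proof -
      have "exp (- \<i> * of_real ((\<nu> - of_int l * \<beta>) * u)) = cis (- ((\<nu> - of_int l * \<beta>) * u))"
        by (simp add: cis_conv_exp)
      moreover have "exp (\<i> * of_real (\<beta> * of_int l * u)) = cis (\<beta> * of_int l * u)"
        by (simp only: cis_conv_exp)
      ultimately show ?thesis
        by (simp add: ap_exp_cis apz_exp_cis modul_def cis_cnj cis_mult algebra_simps)
    qed
    then show ?thesis
      unfolding fourier_def by (simp only: Bochner_Integration.integral_mult_right_zero Bochner_Integration.integral_cnj)
  qed
  have "gabor_coeffs \<alpha> \<beta> \<psi> (\<lambda>t. \<Sum>\<nu>\<in>V. c \<nu> * ap_exp \<nu> t) l k
      = (LINT u|lebesgue. (\<Sum>\<nu>\<in>V. c \<nu> * (ap_exp \<nu> (u + \<alpha> * of_int k) * ?w u)))"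
    by (simp only: gabor_coeffs_eq(1)[OF p \<psi>] sum_distrib_right mult.assoc)
  also have "\<dots> = (\<Sum>\<nu>\<in>V. LINT u|lebesgue. c \<nu> * (ap_exp \<nu> (u + \<alpha> * of_int k) * ?w u))"
    by (intro Bochner_Integration.integral_sum int)
  also have "\<dots> = (\<Sum>\<nu>\<in>V. cnj (fourier \<psi> (\<nu> - of_int l * \<beta>)) * c \<nu> * apz_exp (\<nu> * \<alpha>) k)"
    by (simp only: Bochner_Integration.integral_mult_right_zero one) (simp only: mult_ac)
  finally show ?thesis .
qed

text \<open>
  The fibre bound for each \<open>\<ell>\<close> costs the factor \<open>D\<close>; the weights \<open>|\<phi>(\<nu> - \<ell>\<beta>)|\<close> that remain are then
  summed over \<open>\<ell>\<close>, at the cost of \<open>A\<close>. Here \<open>\<phi>\<close> is the Fourier transform of \<open>\<psi>\<close>.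
\<close>

lemma analysis_trigpoly_bound:
  assumes \<alpha>: "\<alpha> > 0" and \<psi>: "integrable lebesgue \<psi>"
    and A: "lattice_sums_le (fourier \<psi>) \<beta> A"
    and D: "lattice_sums_le (fourier \<psi>) (2 * pi / \<alpha>) D"
    and p: "p \<in> trigpoly" and L: "finite L"
  shows "(\<Sum>l\<in>L. (apz_norm (gabor_coeffs \<alpha> \<beta> \<psi> p l))\<^sup>2) \<le> A * D * (ap_norm p)\<^sup>2"
proof -
  note nn = lattice_sums_le_nonneg[OF A] lattice_sums_le_nonneg[OF D]
  obtain V c where V: "finite V" "p = (\<lambda>t. \<Sum>\<nu>\<in>V. c \<nu> * ap_exp \<nu> t)" using trigpoly_finite_sum[OF p] .
  have "gabor_coeffs \<alpha> \<beta> \<psi> p l = (\<lambda>k. \<Sum>\<nu>\<in>V. cnj (fourier \<psi> (\<nu> - of_int l * \<beta>)) * c \<nu> * apz_exp (\<nu> * \<alpha>) k)" for l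
    unfolding V(2) by (rule ext) (rule gabor_coeffs_sum[OF V(1) \<psi>])
  then have "(\<Sum>l\<in>L. (apz_norm (gabor_coeffs \<alpha> \<beta> \<psi> p l))\<^sup>2)
      \<le> (\<Sum>l\<in>L. D * (\<Sum>\<nu>\<in>V. norm (fourier \<psi> (\<nu> - of_int l * \<beta>)) * (norm (c \<nu>))\<^sup>2))"
    using apz_exp_sum_norm_fibres[OF \<alpha> D V(1)] by (intro sum_mono) simp
  also have "\<dots> = D * (\<Sum>\<nu>\<in>V. (\<Sum>l\<in>L. norm (fourier \<psi> (\<nu> - of_int l * \<beta>))) * (norm (c \<nu>))\<^sup>2)"
    unfolding sum_distrib_left[symmetric] sum_distrib_right by (subst sum.swap) (rule refl)
  also have "\<dots> \<le> D * (\<Sum>\<nu>\<in>V. A * (norm (c \<nu>))\<^sup>2)"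
    using nn by (intro mult_left_mono sum_mono mult_right_mono lattice_sums_leD[OF A] L) auto
  also have "\<dots> = A * D * (ap_norm p)\<^sup>2"
    unfolding V(2) ap_exp_sum_norm[OF V(1)] by (simp add: sum_distrib_left mult_ac)
  finally show ?thesis .
qed

text \<open>
  Coefficients of trigonometric polynomials that converge uniformly to \<open>f\<close> converge in norm for each
  \<open>\<ell>\<close>, and the norms of the polynomials converge to that of \<open>f\<close>.
\<close>

lemma analysis_bound:
  assumes \<alpha>: "\<alpha> > 0" and \<psi>: "integrable lebesgue \<psi>"
    and A: "lattice_sums_le (fourier \<psi>) \<beta> A"
    and D: "lattice_sums_le (fourier \<psi>) (2 * pi / \<alpha>) D"
    and f: "f \<in> AP_R" and L: "finite L"
  shows "(\<Sum>l\<in>L. (apz_norm (gabor_coeffs \<alpha> \<beta> \<psi> f l))\<^sup>2) \<le> A * D * (ap_norm f)\<^sup>2"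
proof -
  define I where "I = (LINT t|lebesgue. norm (\<psi> t))"
  have I: "I \<ge> 0" unfolding I_def by simp
  let ?G = "gabor_coeffs \<alpha> \<beta> \<psi>" and ?r = "\<lambda>n. inverse (real (Suc n))"
  have "\<exists>p. p \<in> trigpoly \<and> (\<forall>t. norm (f t - p t) \<le> ?r n)" for n
    using trigpoly_dense[OF f, of "?r n"] by (metis inverse_positive_iff_positive of_nat_0_less_iff zero_less_Suc)
  then obtain p where p: "\<And>n. p n \<in> trigpoly" "\<And>n t. norm (f t - p n t) \<le> ?r n" by metis
  have pA: "p n \<in> AP_R" for n by (rule trigpoly_AP_R[OF p(1)])
  have lim1: "(\<lambda>n. ap_norm (p n)) \<longlonglongrightarrow> ap_norm f"
  proof (rule LIM_zero_cancel, rule Lim_null_comparison[OF always_eventually[OF allI]])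
    show "norm (ap_norm (p n) - ap_norm f) \<le> ?r n" for n
    proof -
      have "\<bar>ap_norm f - ap_norm (p n)\<bar> \<le> ap_norm (\<lambda>t. f t - p n t)" by (rule R.nrm_reverse_triangle[OF f pA])
      also have "\<dots> \<le> ?r n" by (intro R.nrm_le_bound R.diff_mem f pA p(2)) auto
      finally show ?thesis by (simp add: abs_minus_commute)
    qed
  qed (rule LIMSEQ_inverse_real_of_nat)
  have lim2: "(\<lambda>n. apz_norm (?G (p n) l)) \<longlonglongrightarrow> apz_norm (?G f l)" for l
  proof (rule LIM_zero_cancel, rule Lim_null_comparison[OF always_eventually[OF allI]])
    show "norm (apz_norm (?G (p n) l) - apz_norm (?G f l)) \<le> ?r n * I" for n
    proof -
      have mem: "?G (p n) l \<in> AP_Z" "?G f l \<in> AP_Z"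
        by (intro gabor_coeffs_AP_Z pA f \<psi>)+
      have "\<bar>apz_norm (?G f l) - apz_norm (?G (p n) l)\<bar>
          \<le> apz_norm (\<lambda>k. ?G f l k - ?G (p n) l k)"
        by (rule Z.nrm_reverse_triangle[OF mem(2,1)])
      also have "\<dots> \<le> ?r n * I"
        unfolding I_def
        by (intro Z.nrm_le_bound Z.diff_mem mem gabor_coeffs_diff_le f pA \<psi> p(2)) simp
      finally show ?thesis by (simp add: abs_minus_commute)
    qed
    show "(\<lambda>n. ?r n * I) \<longlonglongrightarrow> 0"
      by (intro tendsto_mult_left_zero LIMSEQ_inverse_real_of_nat)
  qed
  show ?thesis
  proof (rule LIMSEQ_le)
    show "(\<lambda>n. \<Sum>l\<in>L. (apz_norm (?G (p n) l))\<^sup>2) \<longlonglongrightarrow> (\<Sum>l\<in>L. (apz_norm (?G f l))\<^sup>2)"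
      by (intro tendsto_intros lim2)
    show "(\<lambda>n. A * D * (ap_norm (p n))\<^sup>2) \<longlonglongrightarrow> A * D * (ap_norm f)\<^sup>2"
      by (intro tendsto_intros lim1)
    show "\<exists>N. \<forall>n\<ge>N. (\<Sum>l\<in>L. (apz_norm (?G (p n) l))\<^sup>2) \<le> A * D * (ap_norm (p n))\<^sup>2"
      using analysis_trigpoly_bound[OF \<alpha> \<psi> A D p(1) L] by blast
  qed
qed

lemma l2_APZ_diff:
  assumes a: "a \<in> l2_APZ" and b: "b \<in> l2_APZ"
  shows "(\<lambda>l n. b l n - a l n) \<in> l2_APZ"
proof -
  have mem: "a l \<in> AP_Z" "b l \<in> AP_Z" for l using a b by (auto simp: l2_APZ_def)
  have le: "(apz_norm (\<lambda>n. b l n - a l n))\<^sup>2 \<le> 2 * (apz_norm (b l))\<^sup>2 + 2 * (apz_norm (a l))\<^sup>2" for l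
  proof -
    have "(apz_norm (\<lambda>n. b l n - a l n))\<^sup>2 \<le> (apz_norm (b l) + apz_norm (a l))\<^sup>2"
      by (intro power_mono Z.nrm_diff_triangle Z.nrm_nonneg Z.diff_mem mem)
    also have "\<dots> \<le> 2 * (apz_norm (b l))\<^sup>2 + 2 * (apz_norm (a l))\<^sup>2"
      using zero_le_power2[of "apz_norm (b l) - apz_norm (a l)"] by (simp add: power2_sum power2_diff)
    finally show ?thesis .
  qed
  have "(\<lambda>l. (apz_norm (\<lambda>n. b l n - a l n))\<^sup>2) summable_on UNIV"
  proof (rule summable_on_comparison_test)
    show "(\<lambda>l. 2 * (apz_norm (b l))\<^sup>2 + 2 * (apz_norm (a l))\<^sup>2) summable_on UNIV"
      using a b by (intro summable_on_add summable_on_cmult_right) (auto simp: l2_APZ_def)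
  qed (use le in auto)
  then show ?thesis using mem by (simp add: l2_APZ_def Z.diff_mem)
qed

lemma AP2_diff_inner:
  assumes F: "F \<in> AP2" and G: "G \<in> AP2" and f: "f \<in> AP_R"
  shows "AP2_diff F G \<in> AP2"
    and "AP2_inner (AP2_diff F G) (AP2_of f) = AP2_inner F (AP2_of f) - AP2_inner G (AP2_of f)"
proof -
  obtain X where X: "X \<in> AP_cauchy" "F = AP_rel `` {X}" using F unfolding AP2_def by (rule quotientE)
  obtain Y where Y: "Y \<in> AP_cauchy" "G = AP_rel `` {Y}" using G unfolding AP2_def by (rule quotientE)
  have mem: "X n \<in> AP_R" "Y n \<in> AP_R" for n using X(1) Y(1) by (auto intro: AP_cauchy_mem)
  note C = AP_cauchy_diff[OF X(1) Y(1)]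
  show "AP2_diff F G \<in> AP2"
    unfolding X(2) Y(2) AP2_diff_class[OF X(1) Y(1)] AP2_def using C by (rule quotientI)
  have "(\<lambda>n. ap_inner (\<lambda>t. X n t - Y n t) f) \<longlonglongrightarrow> AP2_inner F (AP2_of f) - AP2_inner G (AP2_of f)"
    using tendsto_diff[OF AP2_coefficient_tendsto[OF X(1) f] AP2_coefficient_tendsto[OF Y(1) f]] mem f
    by (simp add: R.ip_diff_left X(2) Y(2))
  then show "AP2_inner (AP2_diff F G) (AP2_of f) = AP2_inner F (AP2_of f) - AP2_inner G (AP2_of f)"
    unfolding X(2) Y(2) AP2_diff_class[OF X(1) Y(1)]
    using AP2_coefficient_tendsto[OF C f] LIMSEQ_unique by blast
qed

section \<open>Synthesis and analysis\<close>

theorem theorem15: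
  fixes \<alpha> \<beta> :: real and \<psi> :: "real \<Rightarrow> complex"
  assumes "\<alpha> > 0" and "\<beta> > 0"
    and "integrable lebesgue \<psi>" and "fourier \<psi> \<in> W0"
  shows "(\<forall>a\<in>l2_APZ. \<exists>!F. is_synthesis \<alpha> \<beta> \<psi> a F) \<and>
    (\<forall>a\<in>l2_APZ. \<forall>\<epsilon>>0. \<exists>\<delta>>0. \<forall>b\<in>l2_APZ. l2_norm (\<lambda>l n. b l n - a l n) < \<delta> \<longrightarrow>
       AP2_norm (AP2_diff (synthesis \<alpha> \<beta> \<psi> b) (synthesis \<alpha> \<beta> \<psi> a)) < \<epsilon>) \<and>
    (\<exists>C::real. \<forall>f\<in>AP_R. gabor_coeffs \<alpha> \<beta> \<psi> f \<in> l2_APZ \<and>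
       (\<Sum>\<^sub>\<infinity>l. (apz_norm (gabor_coeffs \<alpha> \<beta> \<psi> f l))\<^sup>2) \<le> C * (ap_norm f)\<^sup>2)"
proof -
  obtain A where A: "lattice_sums_le (fourier \<psi>) \<beta> A"
    using wiener_lattice_sum_bounded[OF assms(4,2)] by blast
  obtain D where D: "lattice_sums_le (fourier \<psi>) (2 * pi / \<alpha>) D"
    using wiener_lattice_sum_bounded[OF assms(4), of "2 * pi / \<alpha>"] assms(1) by auto
  define C where "C = A * D"
  have C: "C \<ge> 0" using lattice_sums_le_nonneg[OF A] lattice_sums_le_nonneg[OF D] by (simp add: C_def)
  have ex: "\<exists>F. is_synthesis \<alpha> \<beta> \<psi> a F \<and> AP2_norm F \<le> sqrt C * l2_norm a" if a: "a \<in> l2_APZ" for a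
  proof -
    have l0: "l2_norm a \<ge> 0" by (simp add: l2_norm_def infsum_nonneg)
    obtain c where c: "\<And>\<nu>. ((\<lambda>l::int. fourier \<psi> (\<nu> - of_int l * \<beta>) * apz_inner (a l) (apz_exp (\<nu> * \<alpha>))) has_sum c \<nu>) UNIV"
      "\<And>V. finite V \<Longrightarrow> (\<Sum>\<nu>\<in>V. (norm (c \<nu>))\<^sup>2) \<le> C * (l2_norm a)\<^sup>2"
      using synthesis_coefficients[OF assms(1) A D a] unfolding C_def by blast
    obtain F where F: "F \<in> AP2" "\<And>\<nu>. AP2_inner F (AP2_of (ap_exp \<nu>)) = c \<nu>" "AP2_norm F \<le> sqrt (C * (l2_norm a)\<^sup>2)"
      using riesz_fischer[OF c(2)] by blast
    have "AP2_norm F \<le> sqrt C * l2_norm a" using F(3) l0 by (simp add: real_sqrt_mult)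
    then show ?thesis using F c(1) by (auto simp: is_synthesis_def)
  qed
  have uniq: "F = G" if F: "is_synthesis \<alpha> \<beta> \<psi> a F" and G: "is_synthesis \<alpha> \<beta> \<psi> a G" for a F G
  proof (rule AP2_eqI)
    show "F \<in> AP2" "G \<in> AP2" using F G by (auto simp: is_synthesis_def)
    show "AP2_inner F (AP2_of (ap_exp \<nu>)) = AP2_inner G (AP2_of (ap_exp \<nu>))" for \<nu>
      using F G unfolding is_synthesis_def by (blast intro: has_sum_unique)
  qed
  have ex1: "\<exists>!F. is_synthesis \<alpha> \<beta> \<psi> a F" if "a \<in> l2_APZ" for a
    using ex[OF that] uniq by blast
  have syn: "is_synthesis \<alpha> \<beta> \<psi> a (synthesis \<alpha> \<beta> \<psi> a)" if "a \<in> l2_APZ" for a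
    unfolding synthesis_def by (rule theI'[OF ex1[OF that]])
  have diff: "AP2_norm (AP2_diff (synthesis \<alpha> \<beta> \<psi> b) (synthesis \<alpha> \<beta> \<psi> a)) \<le> sqrt C * l2_norm (\<lambda>l n. b l n - a l n)"
    if a: "a \<in> l2_APZ" and b: "b \<in> l2_APZ" for a b
  proof -
    have mem: "a l \<in> AP_Z" "b l \<in> AP_Z" for l using a b by (auto simp: l2_APZ_def)
    let ?Fa = "synthesis \<alpha> \<beta> \<psi> a" and ?Fb = "synthesis \<alpha> \<beta> \<psi> b"
    have AP2: "?Fa \<in> AP2" "?Fb \<in> AP2" using syn[OF a] syn[OF b] by (auto simp: is_synthesis_def)
    have "is_synthesis \<alpha> \<beta> \<psi> (\<lambda>l n. b l n - a l n) (AP2_diff ?Fb ?Fa)"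
      unfolding is_synthesis_def
    proof (intro conjI allI)
      show "AP2_diff ?Fb ?Fa \<in> AP2" by (rule AP2_diff_inner(1)[OF AP2(2,1) ap_exp_mem])
      fix \<nu>
      let ?t = "\<lambda>a l. fourier \<psi> (\<nu> - real_of_int l * \<beta>) * apz_inner (a l) (apz_exp (\<nu> * \<alpha>))"
      have "((\<lambda>l. ?t b l + - ?t a l) has_sum AP2_inner ?Fb (AP2_of (ap_exp \<nu>)) + - AP2_inner ?Fa (AP2_of (ap_exp \<nu>))) UNIV"
        using syn[OF a] syn[OF b] unfolding is_synthesis_def
        by (intro has_sum_add) (simp_all add: has_sum_uminus)
      then show "(?t (\<lambda>l n. b l n - a l n) has_sum AP2_inner (AP2_diff ?Fb ?Fa) (AP2_of (ap_exp \<nu>))) UNIV"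
        using mem by (simp add: AP2_diff_inner(2)[OF AP2(2,1)] Z.ip_diff_left right_diff_distrib)
    qed
    then show ?thesis using ex[OF l2_APZ_diff[OF a b]] uniq by metis
  qed
  have cont: "\<exists>\<delta>>0. \<forall>b\<in>l2_APZ. l2_norm (\<lambda>l n. b l n - a l n) < \<delta> \<longrightarrow>
       AP2_norm (AP2_diff (synthesis \<alpha> \<beta> \<psi> b) (synthesis \<alpha> \<beta> \<psi> a)) < \<epsilon>"
    if a: "a \<in> l2_APZ" and \<epsilon>: "\<epsilon> > 0" for a \<epsilon>
  proof -
    have s: "sqrt C + 1 > 0" using C by (simp add: add_nonneg_pos)
    show ?thesis
    proof (intro exI[of _ "\<epsilon> / (sqrt C + 1)"] conjI ballI impI)
      fix b assume b: "b \<in> l2_APZ" and lt: "l2_norm (\<lambda>l n. b l n - a l n) < \<epsilon> / (sqrt C + 1)"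
      have "0 \<le> l2_norm (\<lambda>l n. b l n - a l n)" by (simp add: l2_norm_def infsum_nonneg)
      then have "sqrt C * l2_norm (\<lambda>l n. b l n - a l n) \<le> (sqrt C + 1) * l2_norm (\<lambda>l n. b l n - a l n)"
        by (intro mult_right_mono) auto
      also have "\<dots> < \<epsilon>" using lt s by (simp add: field_simps)
      finally show "AP2_norm (AP2_diff (synthesis \<alpha> \<beta> \<psi> b) (synthesis \<alpha> \<beta> \<psi> a)) < \<epsilon>"
        using diff[OF a b] by linarith
    qed (use \<epsilon> s in simp)
  qed
  have analysis: "gabor_coeffs \<alpha> \<beta> \<psi> f \<in> l2_APZ \<and>
       (\<Sum>\<^sub>\<infinity>l. (apz_norm (gabor_coeffs \<alpha> \<beta> \<psi> f l))\<^sup>2) \<le> C * (ap_norm f)\<^sup>2" if f: "f \<in> AP_R" for f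
  proof -
    have bound: "(\<Sum>l\<in>L. (apz_norm (gabor_coeffs \<alpha> \<beta> \<psi> f l))\<^sup>2) \<le> C * (ap_norm f)\<^sup>2" if "finite L" for L
      unfolding C_def by (rule analysis_bound[OF assms(1,3) A D f that])
    have sum: "(\<lambda>l. (apz_norm (gabor_coeffs \<alpha> \<beta> \<psi> f l))\<^sup>2) summable_on UNIV"
      by (rule nonneg_bdd_above_summable_on) (auto intro!: bdd_aboveI2 bound)
    show ?thesis
      using sum infsum_le_finite_sums[OF sum bound] gabor_coeffs_AP_Z[OF f assms(3)]
      by (simp add: l2_APZ_def)
  qed
  show ?thesis
    by (intro conjI ballI allI impI exI[of _ C] ex1 cont analysis[THEN conjunct1] analysis[THEN conjunct2])
qed

end
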